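(* Let $k\ge0$ be an integer and $\delta\in(-1,\infty)$. Let $(\mathcal D(n))_{n\ge0}$ be the sequence of degree vectors of all $k$-simplices in the preferential attachment complex $(G_n)_{n\ge0}$ with parameters $k,\delta$, and let $(\widetilde{\mathcal D}(n))_{n\ge0}$ be the sequence built from independent linear birth processes with immigration, both as defined in the context. Then the sequences $(\mathcal D(n))_{n\ge0}$ and $(\widetilde{\mathcal D}(n))_{n\ge0}$ of random elements of $(\mathbb N^{k+1})^\infty$, $\mathbb N=\{0,1,2,\dots\}$, have the same law.
   Context: An (abstract) simplicial complex is a collection of nonempty finite sets closed under taking nonempty subsets; an $m$-simplex is an element with $m+1$ points. The $m$-degree of an $m$-simplex is the number of $(m+1)$-simplices of the complex containing it. Preferential attachment complex. $G_0$ consists of all nonempty subsets of $\{1,\dots,k+2\}$. Let $\mathcal F_{m,n}$ be the set of $m$-simplices of $G_n$ and $D^{(m)}_n(\sigma)$ the $m$-degree of $\sigma$ in $G_n$. For $n\ge1$, given $G_0,\dots,G_{n-1}$, a $k$-simplex $\sigma\in\mathcal F_{k,n-1}$ is chosen with probability $(D^{(k)}_{n-1}(\sigma)+\delta)/\sum_{\tau\in\mathcal F_{k,n-1}}(D^{(k)}_{n-1}(\tau)+\delta)$, and $G_n$ is obtained from $G_{n-1}$ by adding $\sigma\cup\{n+k+2\}$ and all its nonempty subsets. One has $|\mathcal F_{k,n}|=1+(n+1)(k+1)$. Enumeration of $k$-simplices. Write a $k$-simplex as $\sigma=\{\sigma(0),\dots,\sigma(k)\}$ with $\sigma(0)<\cdots<\sigma(k)$.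 Set $\sigma_j=\{1,\dots,k+2\}\setminus\{k+3-j\}$ for $j=1,\dots,k+2$. For $n\ge1$, if $\ell(n)\in\{1,\dots,1+n(k+1)\}$ is the label of the $k$-simplex selected at time $n$, set $$\sigma_{1+n(k+1)+r}=\big(\sigma_{\ell(n)}\setminus\{\sigma_{\ell(n)}(k+1-r)\}\big)\cup\{k+n+2\},\qquad r=1,\dots,k+1.$$ $\mathcal D(n):=\Big(\big(D_n^{(m)}(\{\sigma_j(k-m),\dots,\sigma_j(k)\})\big)_{m=0}^k:\ 1\le j\le|\mathcal F_{k,n}|\Big)$, extended on the right by infinitely many zero vectors. Birth process construction. A B.I. process with parameters $(1,\delta)$ started at $1$ is a pure birth continuous-time Markov chain on $\{1,2,\dots\}$ with transition rate $i+\delta$ from $i$ to $i+1$. Attach to each simplex label $i\ge1$ an independent such process, denoted $BI_{\sigma_i}$, with $BI_{\sigma_i}(0)=1$, whose clock starts when $\sigma_i$ is created: put $T_0=0$; the simplices $\sigma_j=\{1,\dots,k+2\}\setminus\{k+3-j\}$, $j=1,\dots,k+2$, are created at time $T_0$. For $n\ge1$, $T_n$ is the time of the first jump after $T_{n-1}$ among the processes $t\mapsto BI_{\sigma_i}(t-T_{b(\sigma_i)})$, $1\le i\le1+n(k+1)$; $\ell(n)$ is the label of the process that jumps, and the next $k+1$ simplices are defined from $\sigma_{\ell(n)}$ by $\sigma_{1+n(k+1)+r}=\big(\sigma_{\ell(n)}\setminus\{\sigma_{\ell(n)}(k+1-r)\}\big)\cup\{k+n+2\}$, $r=1,\dots,k+1$,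 and are created at time $T_n$. Here $b(\sigma_i)$ is the index of the step at which $\sigma_i$ is created: $b(\sigma_i)=0$ for $i\le k+2$, and $b(\sigma_{1+n(k+1)+r})=n$ for $n\ge1$, $1\le r\le k+1$. Let $\mathcal H_{k,n}=\{\sigma_1,\dots,\sigma_{1+(n+1)(k+1)}\}$ and $$\widetilde{\mathcal D}(n):=\bigg(\Big(k-m+\frac1{k-m+1}\sum_{\substack{\tau\in\mathcal H_{k,n}\\ \{\sigma_j(k-m),\dots,\sigma_j(k)\}\subset\tau}}BI_\tau(T_n-T_{b(\tau)})\Big)_{m=0}^k:\ 1\le j\le|\mathcal H_{k,n}|\bigg),$$ extended on the right by infinitely many zero vectors (processes are right-continuous). *)

theory Defs
  imports "HOL-Probability.Probability"
begin

section \<open>Preferential attachment complex\<close>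

text \<open>An abstract simplicial complex on the positive integers is represented by the set of its
  (nonempty, finite) simplices; \<open>card A = m + 1\<close> forces finiteness.\<close>

definition simplices :: "nat \<Rightarrow> nat set set \<Rightarrow> nat set set" where
  "simplices m G = {A \<in> G. card A = m + 1}"

definition simplex_degree :: "nat \<Rightarrow> nat set set \<Rightarrow> nat set \<Rightarrow> nat" where
  "simplex_degree m G A = card {B \<in> simplices (m + 1) G. A \<subseteq> B}"

text \<open>\<open>pa_complex k s n\<close> is the complex obtained after \<open>n\<close> steps when \<open>s 1, s 2, \<dots>\<close> are the
  selected \<open>k\<close>-simplices.\<close>

primrec pa_complex :: "nat \<Rightarrow> (nat \<Rightarrow> nat set) \<Rightarrow> nat \<Rightarrow> nat set set" where
  "pa_complex k s 0 = {A. A \<noteq> {} \<and> A \<subseteq> {1..k + 2}}"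
| "pa_complex k s (Suc n) =
     pa_complex k s n \<union> {A. A \<noteq> {} \<and> A \<subseteq> s (Suc n) \<union> {Suc n + k + 2}}"

text \<open>\<open>S n \<omega>\<close> (\<open>n \<ge> 1\<close>) is the simplex selected at time \<open>n\<close>. All random variables involved are
  discrete, so conditioning on \<open>G\<^sub>0, \<dots>, G\<^sub>n\<^sub>-\<^sub>1\<close> is elementary conditioning on each history
  of positive probability.\<close>

definition preferential_attachment ::
    "'a measure \<Rightarrow> nat \<Rightarrow> real \<Rightarrow> (nat \<Rightarrow> 'a \<Rightarrow> nat set) \<Rightarrow> bool" where
  "preferential_attachment M k \<delta> S \<longleftrightarrow>
     (\<forall>n\<ge>1. S n \<in> measurable M (count_space UNIV)) \<and>
     (\<forall>n\<ge>1. \<forall>\<omega>\<in>space M. S n \<omega> \<in> simplices k (pa_complex k (\<lambda>i. S i \<omega>) (n - 1))) \<and>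
     (\<forall>n\<ge>1. \<forall>g. \<P>(\<omega> in M. \<forall>i<n. pa_complex k (\<lambda>i. S i \<omega>) i = g i) > 0 \<longrightarrow>
        (\<forall>A \<in> simplices k (g (n - 1)).
           \<P>(\<omega> in M. S n \<omega> = A \<bar> \<forall>i<n. pa_complex k (\<lambda>i. S i \<omega>) i = g i) =
             (real (simplex_degree k (g (n - 1)) A) + \<delta>) /
             (\<Sum>B\<in>simplices k (g (n - 1)). (real (simplex_degree k (g (n - 1)) B) + \<delta>))))"


section \<open>Enumeration of the simplices\<close>

text \<open>\<open>vertex A i\<close> is the element written \<open>\<sigma>(i)\<close> for \<open>\<sigma> = A\<close> (counting from 0 in increasing
  order).\<close>

definition vertex :: "nat set \<Rightarrow> nat \<Rightarrow> nat" where
  "vertex A i = sorted_list_of_set A ! i"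

definition top_face :: "nat \<Rightarrow> nat \<Rightarrow> nat set \<Rightarrow> nat set" where
  "top_face k m A = vertex A ` {k - m..k}"

text \<open>Enumerations are functions on labels \<open>j \<ge> 1\<close>. After step \<open>n\<close> exactly the labels
  \<open>1, \<dots>, num_labels k n\<close> are meaningful.\<close>

definition num_labels :: "nat \<Rightarrow> nat \<Rightarrow> nat" where
  "num_labels k n = 1 + (n + 1) * (k + 1)"

definition initial_enum :: "nat \<Rightarrow> nat \<Rightarrow> nat set" where
  "initial_enum k j = {1..k + 2} - {k + 3 - j}"

text \<open>Step \<open>n \<ge> 1\<close>, when the simplex with label \<open>l\<close> is selected. The new labels are
  \<open>1 + n (k + 1) + r\<close> with \<open>1 \<le> r \<le> k + 1\<close>.\<close>

definition extend_enum :: "nat \<Rightarrow> nat \<Rightarrow> nat \<Rightarrow> (nat \<Rightarrow> nat set) \<Rightarrow> nat \<Rightarrow> nat set" where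
  "extend_enum k n l \<sigma> j =
     (if 1 + n * (k + 1) < j \<and> j \<le> 1 + n * (k + 1) + (k + 1)
      then let r = j - (1 + n * (k + 1))
           in (\<sigma> l - {vertex (\<sigma> l) (k + 1 - r)}) \<union> {k + n + 2}
      else \<sigma> j)"

primrec pa_enum :: "nat \<Rightarrow> (nat \<Rightarrow> nat set) \<Rightarrow> nat \<Rightarrow> nat \<Rightarrow> nat set" where
  "pa_enum k s 0 = initial_enum k"
| "pa_enum k s (Suc n) =
     extend_enum k (Suc n)
       (THE l. 1 \<le> l \<and> l \<le> num_labels k n \<and> pa_enum k s n l = s (Suc n))
       (pa_enum k s n)"

definition pa_degree_vector :: "nat \<Rightarrow> (nat \<Rightarrow> nat set) \<Rightarrow> nat \<Rightarrow> nat \<Rightarrow> nat \<Rightarrow> real" where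
  "pa_degree_vector k s n =
     (\<lambda>j\<in>{1..}. \<lambda>m\<in>{..k}.
        if j \<le> card (simplices k (pa_complex k s n))
        then real (simplex_degree m (pa_complex k s n) (top_face k m (pa_enum k s n j)))
        else 0)"


section \<open>Birth processes\<close>

text \<open>For a right-continuous path \<open>f\<close> with discrete values, the first jump time after \<open>s\<close> is the
  first time at which the value differs from \<open>f s\<close>. If there is no further jump, the value is \<open>s\<close>
  by convention.\<close>

definition next_jump :: "(real \<Rightarrow> 'b) \<Rightarrow> real \<Rightarrow> real" where
  "next_jump f s = (if \<exists>t>s. f t \<noteq> f s then Inf {t. s < t \<and> f t \<noteq> f s} else s)"

primrec jump_time :: "(real \<Rightarrow> 'b) \<Rightarrow> nat \<Rightarrow> real" where
  "jump_time f 0 = 0"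
| "jump_time f (Suc i) = next_jump f (jump_time f i)"

definition holding_time :: "(real \<Rightarrow> 'b) \<Rightarrow> nat \<Rightarrow> real" where
  "holding_time f i = jump_time f (Suc i) - jump_time f i"

text \<open>The right-continuous pure birth Markov chain on the integers \<open>\<ge> x\<close>, started at \<open>x\<close>, with
  transition rate \<open>q i\<close> from \<open>i\<close> to \<open>i + 1\<close>, in the usual jump chain/holding time definition of
  a continuous-time Markov chain with given rates: the chain visits \<open>x, x + 1, x + 2, \<dots>\<close> in this
  order, and the holding times in these states are independent and exponential with parameters
  \<open>q x, q (x + 1), \<dots>\<close>. For rates without explosion, as below, this determines the whole path.\<close>

definition pure_birth_chain ::
    "'a measure \<Rightarrow> (nat \<Rightarrow> real) \<Rightarrow> nat \<Rightarrow> (real \<Rightarrow> 'a \<Rightarrow> nat) \<Rightarrow> bool" where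
  "pure_birth_chain M q x X \<longleftrightarrow>
     (\<forall>t\<ge>0. X t \<in> measurable M (count_space UNIV)) \<and>
     (\<forall>\<omega>\<in>space M. \<forall>t\<ge>0. continuous (at_right t) (\<lambda>u. X u \<omega>)) \<and>
     (AE \<omega> in M. \<forall>i. X (jump_time (\<lambda>t. X t \<omega>) i) \<omega> = x + i) \<and>
     prob_space.indep_vars M (\<lambda>_. borel) (\<lambda>i \<omega>. holding_time (\<lambda>t. X t \<omega>) i) UNIV \<and>
     (\<forall>i. distributed M lborel (\<lambda>\<omega>. holding_time (\<lambda>t. X t \<omega>) i)
            (exponential_density (q (x + i))))"

definition birth_immigration :: "'a measure \<Rightarrow> real \<Rightarrow> (real \<Rightarrow> 'a \<Rightarrow> nat) \<Rightarrow> bool" where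
  "birth_immigration M \<delta> X \<longleftrightarrow> pure_birth_chain M (\<lambda>i. real i + \<delta>) 1 X"


section \<open>The process built from birth processes\<close>

text \<open>\<open>birth_index k i\<close> is \<open>0\<close> for \<open>1 \<le> i \<le> k + 2\<close> and \<open>n\<close> for \<open>i = 1 + n (k + 1) + r\<close>
  with \<open>n \<ge> 1\<close>, \<open>1 \<le> r \<le> k + 1\<close>.\<close>

definition birth_index :: "nat \<Rightarrow> nat \<Rightarrow> nat" where
  "birth_index k i = (i - 2) div (k + 1)"

lemma birth_index_le: "i \<le> num_labels k n \<Longrightarrow> birth_index k i \<le> n"
proof -
  assume "i \<le> num_labels k n"
  then have "i - 2 < (n + 1) * (k + 1)" by (simp add: num_labels_def)
  then show ?thesis
    by (metis birth_index_def less_mult_imp_div_less Suc_eq_plus1 less_Suc_eq_le)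
qed

text \<open>In the following, \<open>X i\<close> is one path of the birth process attached to the simplex with
  label \<open>i\<close> (distinct labels belong to distinct simplices). The first jump of any of the finitely
  many current processes is the first jump of the vector of their values; the entries for labels
  that do not exist yet are set to the constant 0.\<close>

function event_time :: "nat \<Rightarrow> (nat \<Rightarrow> real \<Rightarrow> nat) \<Rightarrow> nat \<Rightarrow> real" where
  "event_time k X 0 = 0"
| "event_time k X (Suc n) =
     next_jump
       (\<lambda>t i. if 1 \<le> i \<and> i \<le> num_labels k n
              then X i (t - event_time k X (birth_index k i)) else 0)
       (event_time k X n)"
  by pat_completeness auto
termination
  by (relation "Wellfounded.measure (\<lambda>(k, X, n). n)") (auto simp: less_Suc_eq_le birth_index_le)

text \<open>The label of the process that jumps at the \<open>n\<close>-th event, \<open>n \<ge> 1\<close>. It is almost surely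
  unique; ties are broken in favour of the smallest label.\<close>

definition event_label :: "nat \<Rightarrow> (nat \<Rightarrow> real \<Rightarrow> nat) \<Rightarrow> nat \<Rightarrow> nat" where
  "event_label k X n =
     (LEAST i. 1 \<le> i \<and> i \<le> 1 + n * (k + 1) \<and>
        X i (event_time k X n - event_time k X (birth_index k i)) \<noteq>
        X i (event_time k X (n - 1) - event_time k X (birth_index k i)))"

primrec bi_enum :: "nat \<Rightarrow> (nat \<Rightarrow> real \<Rightarrow> nat) \<Rightarrow> nat \<Rightarrow> nat \<Rightarrow> nat set" where
  "bi_enum k X 0 = initial_enum k"
| "bi_enum k X (Suc n) =
     extend_enum k (Suc n) (event_label k X (Suc n)) (bi_enum k X n)"

definition bi_degree_vector :: "nat \<Rightarrow> (nat \<Rightarrow> real \<Rightarrow> nat) \<Rightarrow> nat \<Rightarrow> nat \<Rightarrow> nat \<Rightarrow> real" where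
  "bi_degree_vector k X n =
     (\<lambda>j\<in>{1..}. \<lambda>m\<in>{..k}.
        if j \<le> num_labels k n
        then real (k - m) + 1 / real (k - m + 1) *
          (\<Sum>i | i \<in> {1..num_labels k n} \<and> top_face k m (bi_enum k X n j) \<subseteq> bi_enum k X n i.
             real (X i (event_time k X n - event_time k X (birth_index k i))))
        else 0)"


section \<open>The space of sequences of degree vectors\<close>

text \<open>Values are taken in \<open>\<real>\<close> rather than \<open>\<nat>\<close>, because the second sequence involves a division;
  coordinates are time \<open>n \<ge> 0\<close>, label \<open>j \<ge> 1\<close> and dimension \<open>0 \<le> m \<le> k\<close>.\<close>

definition degree_seq_space :: "nat \<Rightarrow> (nat \<Rightarrow> nat \<Rightarrow> nat \<Rightarrow> real) measure" where
  "degree_seq_space k =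
     Pi\<^sub>M UNIV (\<lambda>_. Pi\<^sub>M {1..} (\<lambda>_. Pi\<^sub>M {..k} (\<lambda>_. borel)))"

definition pa_degrees :: "nat \<Rightarrow> (nat \<Rightarrow> 'a \<Rightarrow> nat set) \<Rightarrow> 'a \<Rightarrow> nat \<Rightarrow> nat \<Rightarrow> nat \<Rightarrow> real" where
  "pa_degrees k S \<omega> n = pa_degree_vector k (\<lambda>i. S i \<omega>) n"

definition bi_degrees ::
    "nat \<Rightarrow> (nat \<Rightarrow> real \<Rightarrow> 'a \<Rightarrow> nat) \<Rightarrow> 'a \<Rightarrow> nat \<Rightarrow> nat \<Rightarrow> nat \<Rightarrow> real" where
  "bi_degrees k BI \<omega> n = bi_degree_vector k (\<lambda>i t. BI i t \<omega>) n"

end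

(*
Both sequences are the same function of the sequence of selected labels, so it suffices to compare
the laws of the label sequences.

In the complex, a face A with m + 1 vertices has m-degree k - m + N(A), where N(A) is the number
of top simplices (the initial one, and each selected simplex together with its new vertex) that
contain A: the first top simplex around A provides k + 1 - m neighbours and every further one
exactly one more. For a k-simplex, N is one plus the number of times it has been selected, and
double counting the k-simplices between A and a top simplex gives
(k - m + 1) N(A) = sum of N over the k-simplices containing A. This is the formula in the second
sequence, since the birth process of a simplex has then made as many jumps as the simplex has been
selected.

In the complex, the label sequence has the product law with factors
(1 + c(l) + delta) / (sum over i of (1 + c(i) + delta)), c counting earlier selections. In the birth
process construction the next label is the winner of a race between independent exponential
clocks with rates 1 + c(i) + delta; by memorylessness the residual waiting times after
the race are again independent exponentials with updated rates and are independent of the winner, so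
the same product law results. Ties need no separate argument: the probabilities of the tie-free
races already add up to one.
*)

theory Submission
  imports Defs
begin

section \<open>Faces and degrees along a label sequence\<close>

text \<open>The hypotheses live on other sigma-algebras than the argument. In the complex,
  conditioning is on the complexes, not on labels. Nothing is lost, because the vertex added at a
  step lies in only one facet so far, so the complexes reveal every selected simplex
  (\<open>pa_history_iff\<close>). In the birth process construction, independence is assumed for
  whole paths in a product space, where jump times, defined through uncountably many times, are not
  evidently measurable. They are replaced by \<open>hitting_time\<close>, which reads rational times
  only and agrees with them almost surely. Births need no separate treatment in the race: every
  label owns its clocks from the outset, an unborn label just does not compete, and it joins at age
  zero with untouched clocks. The degree sequence of the complex is a function of the labels at
  every sample point, the other one only almost surely. On a space that need not be complete, an
  almost sure identity does not transfer measurability, so this is derived for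
  \<open>bi_degrees\<close> itself from right-continuity.\<close>

text \<open>Label sequences are indexed from 0: \<open>L n\<close> is the label selected at step \<open>n + 1\<close>.\<close>

primrec lab_enum :: "nat \<Rightarrow> (nat \<Rightarrow> nat) \<Rightarrow> nat \<Rightarrow> nat \<Rightarrow> nat set" where
  "lab_enum k L 0 = initial_enum k"
| "lab_enum k L (Suc n) = extend_enum k (Suc n) (L n) (lab_enum k L n)"

text \<open>Step \<open>n\<close> uses the label \<open>L (n - 1)\<close>: labels are counted from
  0, while \<open>pa_complex\<close> reads the selected simplices from index 1 on.\<close>

definition lab_selection :: "nat \<Rightarrow> (nat \<Rightarrow> nat) \<Rightarrow> nat \<Rightarrow> nat set" where
  "lab_selection k L n = lab_enum k L (n - 1) (L (n - 1))"

text \<open>The simplices of top dimension \<open>k + 1\<close>: the initial one and, for positive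
  \<open>i\<close>, the one glued on at step \<open>i\<close>. They generate the complex, so
  counting simplices becomes a matter of containment in facets.\<close>

definition lab_facet :: "nat \<Rightarrow> (nat \<Rightarrow> nat) \<Rightarrow> nat \<Rightarrow> nat set" where
  "lab_facet k L i = (if i = 0 then {1..k + 2} else lab_selection k L i \<union> {i + k + 2})"

definition valid_labels :: "nat \<Rightarrow> nat \<Rightarrow> (nat \<Rightarrow> nat) \<Rightarrow> bool" where
  "valid_labels k n L \<longleftrightarrow> (\<forall>i<n. L i \<in> {1..num_labels k i})"

definition label_count :: "(nat \<Rightarrow> nat) \<Rightarrow> nat \<Rightarrow> nat \<Rightarrow> nat" where
  "label_count L n j = card {a. a < n \<and> L a = j}"

lemma label_count_0 [simp]: "label_count L 0 j = 0"
  by (simp add: label_count_def)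

lemma label_count_Suc: "label_count L (Suc n) j = label_count L n j + (if L n = j then 1 else 0)"
proof -
  have "{a. a < Suc n \<and> L a = j} = (if L n = j then insert n {a. a < n \<and> L a = j} else {a. a < n \<and> L a = j})"
    by (auto simp: less_Suc_eq)
  then show ?thesis by (simp add: label_count_def)
qed

lemma lab_enum_cong: "(\<And>i. i < n \<Longrightarrow> L i = L' i) \<Longrightarrow> lab_enum k L n = lab_enum k L' n"
  by (induction n) auto

lemma lab_facet_cong: "(\<And>i. i < n \<Longrightarrow> L i = L' i) \<Longrightarrow> lab_facet k L n = lab_facet k L' n"
  using lab_enum_cong[of "n - 1" L L' k] by (auto simp: lab_facet_def lab_selection_def)

lemma valid_labels_cong: "(\<And>i. i < n \<Longrightarrow> L i = L' i) \<Longrightarrow> valid_labels k n L = valid_labels k n L'"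
  by (auto simp: valid_labels_def)

lemma valid_labels_mono: "valid_labels k n L \<Longrightarrow> m \<le> n \<Longrightarrow> valid_labels k m L"
  by (auto simp: valid_labels_def)

lemma num_labels_Suc: "num_labels k (Suc n) = num_labels k n + (k + 1)"
  by (simp add: num_labels_def)

lemma num_labels_mono: "m \<le> n \<Longrightarrow> num_labels k m \<le> num_labels k n"
  unfolding num_labels_def by (intro add_left_mono mult_right_mono) auto

lemma lab_enum_old: "j \<le> num_labels k n \<Longrightarrow> lab_enum k L (Suc n) j = lab_enum k L n j"
  by (simp add: extend_enum_def num_labels_def)

lemma lab_enum_new:
  assumes "r \<in> {1..k + 1}"
  shows "lab_enum k L (Suc n) (num_labels k n + r) =
           lab_enum k L n (L n) - {vertex (lab_enum k L n (L n)) (k + 1 - r)} \<union> {k + Suc n + 2}"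
  using assms by (simp add: extend_enum_def num_labels_def Let_def)

lemma pa_complex_lab_selection:
  "pa_complex k (lab_selection k L) n = {A. A \<noteq> {} \<and> (\<exists>i\<le>n. A \<subseteq> lab_facet k L i)}"
proof (induction n)
  case 0
  then show ?case by (auto simp: lab_facet_def)
next
  case (Suc n)
  have "lab_selection k L (Suc n) \<union> {Suc n + k + 2} = lab_facet k L (Suc n)"
    by (simp add: lab_facet_def)
  then show ?case
    unfolding pa_complex.simps Suc by (auto simp only: le_Suc_eq)
qed

section \<open>Vertices of a simplex, and sets between a face and a facet\<close>

lemma bij_betw_vertex:
  assumes "finite A" "card A = k + 1"
  shows "bij_betw (vertex A) {..k} A"
proof -
  have "bij_betw ((!) (sorted_list_of_set A)) {..<length (sorted_list_of_set A)} (set (sorted_list_of_set A))"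
    by (rule bij_betw_nth) auto
  moreover have "vertex A = (!) (sorted_list_of_set A)"
    by (simp add: vertex_def fun_eq_iff)
  ultimately show ?thesis
    using assms by (simp add: lessThan_Suc_atMost)
qed

lemma top_face_subset:
  assumes "finite A" "card A = k + 1" "m \<le> k"
  shows "top_face k m A \<subseteq> A" "card (top_face k m A) = m + 1"
proof -
  have bij: "bij_betw (vertex A) {..k} A" by (rule bij_betw_vertex) (use assms in auto)
  show "top_face k m A \<subseteq> A"
    using bij by (auto simp: top_face_def bij_betw_def)
  have "inj_on (vertex A) {k - m..k}"
    using bij by (auto simp: bij_betw_def intro: inj_on_subset)
  then show "card (top_face k m A) = m + 1"
    using assms by (simp add: top_face_def card_image)
qed

lemma subsets_card_pred:
  assumes "finite T"
  shows "{B. B \<subseteq> T \<and> Suc (card B) = card T} = (\<lambda>x. T - {x}) ` T"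
proof (intro equalityI subsetI)
  fix B assume "B \<in> {B. B \<subseteq> T \<and> Suc (card B) = card T}"
  then have B: "B \<subseteq> T" "Suc (card B) = card T" by auto
  have "card (T - B) = 1"
    using B assms by (simp add: card_Diff_subset finite_subset)
  then obtain x where "T - B = {x}" by (auto simp: card_1_singleton_iff)
  then show "B \<in> (\<lambda>x. T - {x}) ` T" using B by (intro image_eqI[of _ _ x]) auto
next
  fix B assume "B \<in> (\<lambda>x. T - {x}) ` T"
  then show "B \<in> {B. B \<subseteq> T \<and> Suc (card B) = card T}"
    using assms card_Suc_Diff1 by fastforce
qed

lemma inj_on_remove: "inj_on (\<lambda>x. T - {x}) T"
  by (auto simp: inj_on_def)

text \<open>Such a \<open>B\<close> omits one vertex of \<open>T\<close>, and this vertex must lie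
  outside \<open>A\<close>. For a facet \<open>T\<close> this is the inner count of the double
  counting.\<close>

lemma card_between_pred:
  assumes "finite T" "A \<subseteq> T"
  shows "card {B. A \<subseteq> B \<and> B \<subseteq> T \<and> Suc (card B) = card T} = card T - card A"
proof -
  have "{B. A \<subseteq> B \<and> B \<subseteq> T \<and> Suc (card B) = card T}
      = {B. A \<subseteq> B} \<inter> {B. B \<subseteq> T \<and> Suc (card B) = card T}" by auto
  also have "\<dots> = (\<lambda>x. T - {x}) ` (T - A)"
    unfolding subsets_card_pred[OF assms(1)] using assms(2) by auto
  also have "card \<dots> = card (T - A)"
    by (rule card_image) (auto simp: inj_on_def)
  finally show ?thesis
    using assms by (simp add: card_Diff_subset finite_subset)
qed

text \<open>Such a \<open>B\<close> adds one vertex of \<open>T - A\<close>. For a facet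
  \<open>T\<close> this is the degree of \<open>A\<close> at the moment when its first facet
  appears.\<close>

lemma card_between_Suc:
  assumes "finite T" "A \<subseteq> T"
  shows "card {B. A \<subseteq> B \<and> B \<subseteq> T \<and> card B = Suc (card A)} = card T - card A"
proof -
  have fA: "finite A" using assms finite_subset by auto
  have "{B. A \<subseteq> B \<and> B \<subseteq> T \<and> card B = Suc (card A)} = (\<lambda>x. insert x A) ` (T - A)"
  proof (intro equalityI subsetI)
    fix B assume B: "B \<in> {B. A \<subseteq> B \<and> B \<subseteq> T \<and> card B = Suc (card A)}"
    then have "card (B - A) = 1" using fA by (simp add: card_Diff_subset)
    then obtain x where "B - A = {x}" by (auto simp: card_1_singleton_iff)
    then show "B \<in> (\<lambda>x. insert x A) ` (T - A)" using B by (intro image_eqI[of _ _ x]) auto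
  qed (use fA assms in auto)
  also have "card \<dots> = card (T - A)"
    by (rule card_image) (auto simp: inj_on_def)
  finally show ?thesis
    using assms fA by (simp add: card_Diff_subset)
qed

text \<open>A \<open>k\<close>-simplex created by gluing \<open>insert v s\<close> must contain the
  new vertex \<open>v\<close>, since otherwise it lies in \<open>s\<close> and is old. So it omits
  exactly one vertex of \<open>s\<close>, and the new labels run through these omissions from the
  largest vertex down. The bounds on the facets belong to the induction because they make
  \<open>v\<close> new.\<close>

lemma lab_enum_facets:
  assumes "valid_labels k n L"
  shows "bij_betw (lab_enum k L n) {1..num_labels k n} {A. card A = k + 1 \<and> (\<exists>i\<le>n. A \<subseteq> lab_facet k L i)}
       \<and> (\<forall>i\<le>n. lab_facet k L i \<subseteq> {1..i + k + 2} \<and> card (lab_facet k L i) = k + 2)"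
  using assms
proof (induction n)
  case 0
  let ?T = "{1..k + 2}"
  have "bij_betw (\<lambda>x. ?T - {x}) ?T {A. card A = k + 1 \<and> (\<exists>i\<le>0. A \<subseteq> lab_facet k L i)}"
    using subsets_card_pred[of ?T] inj_on_remove[of ?T]
    by (auto simp: bij_betw_def lab_facet_def)
  moreover have "bij_betw (\<lambda>j. k + 3 - j) {1..num_labels k 0} ?T"
    by (rule bij_betw_byWitness[where f' = "\<lambda>j. k + 3 - j"]) (auto simp: num_labels_def)
  ultimately have "bij_betw ((\<lambda>x. ?T - {x}) \<circ> (\<lambda>j. k + 3 - j)) {1..num_labels k 0}
      {A. card A = k + 1 \<and> (\<exists>i\<le>0. A \<subseteq> lab_facet k L i)}"
    by (rule bij_betw_trans[rotated])
  moreover have "(\<lambda>x. ?T - {x}) \<circ> (\<lambda>j. k + 3 - j) = lab_enum k L 0"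
    by (simp add: fun_eq_iff initial_enum_def)
  ultimately show ?case by (auto simp: lab_facet_def)
next
  case (Suc n)
  let ?K = "\<lambda>n. {A. card A = k + 1 \<and> (\<exists>i\<le>n. A \<subseteq> lab_facet k L i)}"
  have "valid_labels k n L" and Ln: "L n \<in> {1..num_labels k n}"
    using Suc.prems by (auto simp: valid_labels_def)
  with Suc.IH have bij: "bij_betw (lab_enum k L n) {1..num_labels k n} (?K n)"
    and fac: "\<And>i. i \<le> n \<Longrightarrow> lab_facet k L i \<subseteq> {1..i + k + 2} \<and> card (lab_facet k L i) = k + 2"
    by auto
  define s where "s = lab_enum k L n (L n)"
  define v where "v = Suc n + k + 2"
  have facet: "lab_facet k L (Suc n) = insert v s"
    by (simp add: lab_facet_def lab_selection_def s_def v_def)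
  have s: "s \<in> ?K n" unfolding s_def using bij Ln by (rule bij_betw_apply)
  have sub: "A \<subseteq> {1..n + k + 2}" if "i \<le> n" "A \<subseteq> lab_facet k L i" for i A
    using fac[OF that(1)] that by fastforce
  have s_sub: "s \<subseteq> {1..n + k + 2}" using s sub by auto
  then have fin_s: "finite s" using finite_subset by blast
  have card_s: "card s = k + 1" using s by auto
  have v_notin: "v \<notin> s" using s_sub by (auto simp: v_def)
  have v_new: "v \<notin> A" if "i \<le> n" "A \<subseteq> lab_facet k L i" for i A
    using sub[OF that] by (auto simp: v_def)
  have newbij: "bij_betw (\<lambda>x. insert v s - {x}) s (?K (Suc n) - ?K n)"
  proof (rule bij_betw_imageI)
    show "inj_on (\<lambda>x. insert v s - {x}) s" using inj_on_remove[of "insert v s"] by (rule inj_on_subset) auto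
    have iff: "A \<in> ?K (Suc n) - ?K n \<longleftrightarrow> A \<in> (\<lambda>x. insert v s - {x}) ` insert v s \<and> v \<in> A" for A
    proof
      assume A: "A \<in> ?K (Suc n) - ?K n"
      then have "A \<subseteq> insert v s" "card A = k + 1" by (auto simp: le_Suc_eq facet)
      moreover have "v \<in> A"
      proof (rule ccontr)
        assume "v \<notin> A"
        with \<open>A \<subseteq> insert v s\<close> have "A \<subseteq> s" by auto
        moreover obtain i where "i \<le> n" "s \<subseteq> lab_facet k L i" using s by auto
        ultimately have "A \<in> ?K n" using \<open>card A = k + 1\<close> by blast
        then show False using A by simp
      qed
      ultimately show "A \<in> (\<lambda>x. insert v s - {x}) ` insert v s \<and> v \<in> A"
        using subsets_card_pred[of "insert v s"] fin_s v_notin card_s by auto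
    next
      assume A: "A \<in> (\<lambda>x. insert v s - {x}) ` insert v s \<and> v \<in> A"
      then have "A \<subseteq> insert v s" "card A = k + 1"
        using subsets_card_pred[of "insert v s"] fin_s v_notin card_s by auto
      then show "A \<in> ?K (Suc n) - ?K n" using A v_new by (auto simp: facet)
    qed
    show "(\<lambda>x. insert v s - {x}) ` s = ?K (Suc n) - ?K n"
    proof (rule set_eqI)
      fix A
      have "A \<in> (\<lambda>x. insert v s - {x}) ` s \<longleftrightarrow> A \<in> (\<lambda>x. insert v s - {x}) ` insert v s \<and> v \<in> A"
        using v_notin by auto
      then show "A \<in> (\<lambda>x. insert v s - {x}) ` s \<longleftrightarrow> A \<in> ?K (Suc n) - ?K n"
        by (simp only: iff)
    qed
  qed
  \<comment> \<open>Label \<open>num_labels k n + r\<close> omits the vertex at position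
    \<open>k + 1 - r\<close>, so the new labels correspond to the positions \<open>0\<close> to
    \<open>k\<close> in reverse.\<close>
  have "bij_betw (\<lambda>j. Suc (num_labels k n) + k - j) {num_labels k n + 1..num_labels k (Suc n)} {..k}"
    by (rule bij_betw_byWitness[where f' = "\<lambda>i. Suc (num_labels k n) + k - i"]) (auto simp: num_labels_Suc)
  from bij_betw_trans[OF bij_betw_trans[OF this bij_betw_vertex[OF fin_s card_s]] newbij]
  have "bij_betw (lab_enum k L (Suc n)) {num_labels k n + 1..num_labels k (Suc n)} (?K (Suc n) - ?K n)"
  proof (rule iffD1[OF bij_betw_cong, rotated])
    fix j assume "j \<in> {num_labels k n + 1..num_labels k (Suc n)}"
    then obtain r where r: "j = num_labels k n + r" "r \<in> {1..k+1}"
      by (intro that[of "j - num_labels k n"]) (auto simp: num_labels_Suc)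
    \<comment> \<open>\<open>extend_enum\<close> removes the vertex before \<open>v\<close> is
      added, \<open>newbij\<close> afterwards; the results agree because the removed vertex is not
      \<open>v\<close>.\<close>
    have "v \<noteq> vertex s (k + 1 - r)"
      using bij_betw_vertex[OF fin_s card_s] r v_notin by (auto simp: bij_betw_def)
    then show "((\<lambda>x. insert v s - {x}) \<circ> (vertex s \<circ> (\<lambda>j. Suc (num_labels k n) + k - j))) j = lab_enum k L (Suc n) j"
      unfolding r(1) lab_enum_new[OF r(2)] s_def[symmetric] by (auto simp: v_def add_ac)
  qed
  moreover have "bij_betw (lab_enum k L (Suc n)) {1..num_labels k n} (?K n)"
    using bij by (rule iffD1[OF bij_betw_cong, rotated]) (simp add: lab_enum_old del: lab_enum.simps)
  ultimately have "bij_betw (lab_enum k L (Suc n))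
      ({1..num_labels k n} \<union> {num_labels k n + 1..num_labels k (Suc n)}) (?K n \<union> (?K (Suc n) - ?K n))"
    by (intro bij_betw_combine) auto
  moreover have "?K n \<union> (?K (Suc n) - ?K n) = ?K (Suc n)" by (auto intro: le_SucI)
  moreover have "{1..num_labels k n} \<union> {num_labels k n + 1..num_labels k (Suc n)} = {1..num_labels k (Suc n)}"
    by (auto simp: num_labels_Suc num_labels_def)
  moreover have "lab_facet k L (Suc n) \<subseteq> {1..Suc n + k + 2}" "card (lab_facet k L (Suc n)) = k + 2"
    using s_sub card_s fin_s v_notin by (auto simp: facet) (auto simp: v_def)
  ultimately show ?case using fac by (auto simp: le_Suc_eq simp del: lab_enum.simps)
qed

lemmas lab_enum_bij = conjunct1[OF lab_enum_facets]

lemma lab_facet_props: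
  assumes "valid_labels k n L" "i \<le> n"
  shows "lab_facet k L i \<subseteq> {1..i + k + 2}" "card (lab_facet k L i) = k + 2" "finite (lab_facet k L i)"
  using lab_enum_facets[OF assms(1)] assms(2) finite_subset by blast+

lemma lab_enum_simplex:
  assumes "valid_labels k n L" "j \<in> {1..num_labels k n}"
  shows "card (lab_enum k L n j) = k + 1" "finite (lab_enum k L n j)"
    "\<exists>i\<le>n. lab_enum k L n j \<subseteq> lab_facet k L i"
proof -
  show c: "card (lab_enum k L n j) = k + 1" and "\<exists>i\<le>n. lab_enum k L n j \<subseteq> lab_facet k L i"
    using bij_betw_apply[OF lab_enum_bij[OF assms(1)] assms(2)] by auto
  show "finite (lab_enum k L n j)" using c by (intro card_ge_0_finite) auto
qed

lemma simplices_lab_selection: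
  "simplices m (pa_complex k (lab_selection k L) n) =
     {A. card A = m + 1 \<and> (\<exists>i\<le>n. A \<subseteq> lab_facet k L i)}"
  by (auto simp: simplices_def pa_complex_lab_selection)

lemma new_vertex_notin_facet:
  assumes "valid_labels k n L" "i \<le> n" "A \<subseteq> lab_facet k L i"
  shows "Suc n + k + 2 \<notin> A"
  using lab_facet_props(1)[OF assms(1,2)] assms by force

text \<open>A further facet \<open>insert v s\<close> around an old \<open>A\<close> contributes
  only \<open>insert v A\<close>: an \<open>(m + 1)\<close>-simplex in it that avoids
  \<open>v\<close> lies in \<open>s\<close> and was already present. The offset is
  \<open>k - m\<close>, one less than the \<open>k + 1 - m\<close> simplices from the first facet,
  since that facet is itself counted in the cardinality.\<close>

lemma simplex_degree_lab_selection:
  assumes "valid_labels k n L" "card A = m + 1" "m \<le> k" "\<exists>i\<le>n. A \<subseteq> lab_facet k L i"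
  shows "simplex_degree m (pa_complex k (lab_selection k L) n) A =
           k - m + card {i. i \<le> n \<and> A \<subseteq> lab_facet k L i}"
proof -
  let ?B = "\<lambda>n. {B. card B = m + 2 \<and> A \<subseteq> B \<and> (\<exists>i\<le>n. B \<subseteq> lab_facet k L i)}"
  let ?I = "\<lambda>n. {i. i \<le> n \<and> A \<subseteq> lab_facet k L i}"
  have "card (?B n) = k - m + card (?I n)"
    using assms(1,4)
  proof (induction n)
    case 0
    have "?B 0 = {B. A \<subseteq> B \<and> B \<subseteq> lab_facet k L 0 \<and> card B = Suc (card A)}"
      using assms(2) by auto
    also have "card \<dots> = k + 2 - (m + 1)"
      using card_between_Suc[of "lab_facet k L 0" A] 0 lab_facet_props[OF 0(1)] assms(2) by auto
    finally have "card (?B 0) = k + 2 - (m + 1)" .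
    moreover have "?I 0 = {0}" using 0 by auto
    ultimately show ?case using assms(3) by simp
  next
    case (Suc n)
    let ?v = "Suc n + k + 2"
    have val: "valid_labels k n L" using Suc.prems(1) by (rule valid_labels_mono) simp
    have fin: "finite (?B j)" if "j \<le> n" for j
    proof (rule finite_subset)
      show "?B j \<subseteq> (\<Union>i\<le>j. Pow (lab_facet k L i))" by auto
      show "finite (\<Union>i\<le>j. Pow (lab_facet k L i))" using that lab_facet_props(3)[OF val] by auto
    qed
    have finI: "finite (?I n)" by auto
    have finA: "finite A" by (rule card_ge_0_finite) (use assms in simp)
    show ?case
    proof (cases "\<exists>i\<le>n. A \<subseteq> lab_facet k L i")
      case True
      have vA: "?v \<notin> A" using True new_vertex_notin_facet[OF val] by blast
      show ?thesis
      proof (cases "A \<subseteq> lab_facet k L (Suc n)")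
        case A: True
        define s where "s = lab_enum k L n (L n)"
        have facet: "lab_facet k L (Suc n) = insert ?v s"
          by (simp add: lab_facet_def lab_selection_def s_def)
        have s: "\<exists>i\<le>n. s \<subseteq> lab_facet k L i" using Suc.prems(1)
          unfolding s_def by (intro lab_enum_simplex(3)[OF val]) (auto simp: valid_labels_def)
        have B_new: "B \<in> ?B n" if B: "B \<in> ?B (Suc n)" "B \<noteq> insert ?v A" for B
        proof (cases "?v \<in> B")
          case True
          then have "insert ?v A \<subseteq> B" "finite B" "card (insert ?v A) = card B"
            using B assms(2) vA finA by (auto intro: card_ge_0_finite)
          then have "insert ?v A = B" by (intro card_subset_eq) auto
          then show ?thesis using B by auto
        next
          case False
          obtain i where i: "i \<le> Suc n" "B \<subseteq> lab_facet k L i" using B by auto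
          have "\<exists>i\<le>n. B \<subseteq> lab_facet k L i"
          proof (cases "i = Suc n")
            case True
            then have "B \<subseteq> s" using i False by (auto simp: facet)
            then show ?thesis using s by blast
          next
            case False
            then have "i \<le> n" using i(1) by simp
            then show ?thesis using i(2) by blast
          qed
          then show ?thesis using B by auto
        qed
        have "?B (Suc n) = insert (insert ?v A) (?B n)"
        proof (intro equalityI subsetI)
          fix B assume "B \<in> insert (insert ?v A) (?B n)"
          then show "B \<in> ?B (Suc n)"
          proof
            assume "B = insert ?v A"
            moreover have "card (insert ?v A) = m + 2" using vA finA assms(2) by simp
            moreover have "insert ?v A \<subseteq> lab_facet k L (Suc n)" using A facet by auto
            ultimately show ?thesis by auto
          qed (auto intro: le_SucI)
        qed (use B_new in blast)
        moreover have "insert ?v A \<notin> ?B n" using new_vertex_notin_facet[OF val] by blast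
        moreover have "?I (Suc n) = insert (Suc n) (?I n)" using A by (auto simp: le_Suc_eq)
        ultimately show ?thesis
          using Suc.IH[OF val True] fin[of n] finI by simp
      next
        case A: False
        have "?I (Suc n) = ?I n" "?B (Suc n) = ?B n" using A by (auto simp: le_Suc_eq)
        then show ?thesis using Suc.IH[OF val True] by simp
      qed
    next
      case False
      then have A: "A \<subseteq> lab_facet k L (Suc n)" using Suc.prems by (auto simp: le_Suc_eq)
      have "?B (Suc n) = {B. A \<subseteq> B \<and> B \<subseteq> lab_facet k L (Suc n) \<and> card B = Suc (card A)}"
        using False assms(2) by (auto simp: le_Suc_eq)
      also have "card \<dots> = k + 2 - (m + 1)"
        using card_between_Suc[of "lab_facet k L (Suc n)" A] A lab_facet_props[OF Suc.prems(1) order_refl] assms(2)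
        by auto
      finally have "card (?B (Suc n)) = k + 2 - (m + 1)" .
      moreover have "?I (Suc n) = {Suc n}" using A False by (auto simp: le_Suc_eq)
      ultimately show ?thesis using assms(3) by simp
    qed
  qed
  moreover have "{B \<in> simplices (m + 1) (pa_complex k (lab_selection k L) n). A \<subseteq> B} = ?B n"
    by (auto simp: simplices_lab_selection)
  ultimately show ?thesis by (simp add: simplex_degree_def)
qed

text \<open>An old \<open>k\<close>-simplex inside the facet \<open>insert v s\<close> avoids
  \<open>v\<close> and has as many vertices as \<open>s\<close>, so it equals \<open>s\<close>;
  injectivity of the enumeration turns this into equality of labels. A simplex created at this step
  contains \<open>v\<close>, hence lies in one facet, and its label exceeds all labels selected so
  far.\<close>

lemma card_facets_lab_enum:
  assumes "valid_labels k n L" "j \<in> {1..num_labels k n}"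
  shows "card {i. i \<le> n \<and> lab_enum k L n j \<subseteq> lab_facet k L i} = 1 + label_count L n j"
  using assms
proof (induction n)
  case 0
  have "{i. i \<le> 0 \<and> lab_enum k L 0 j \<subseteq> lab_facet k L i} = {0}"
    by (auto simp: lab_facet_def initial_enum_def)
  then show ?case by simp
next
  case (Suc n)
  have val: "valid_labels k n L" using Suc.prems(1) by (rule valid_labels_mono) simp
  have Ln: "L n \<in> {1..num_labels k n}" using Suc.prems by (auto simp: valid_labels_def)
  define s where "s = lab_enum k L n (L n)"
  let ?v = "Suc n + k + 2"
  have facet: "lab_facet k L (Suc n) = insert ?v s"
    by (simp add: lab_facet_def lab_selection_def s_def)
  note s = lab_enum_simplex[OF val Ln, folded s_def]
  show ?case
  proof (cases "j \<le> num_labels k n")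
    case True
    then have j: "j \<in> {1..num_labels k n}" using Suc.prems by auto
    note e = lab_enum_simplex[OF val j]
    have "lab_enum k L n j \<subseteq> insert ?v s \<longleftrightarrow> lab_enum k L n j \<subseteq> s"
      using new_vertex_notin_facet[OF val] e(3) by blast
    also have "\<dots> \<longleftrightarrow> lab_enum k L n j = s"
      using card_subset_eq[of s "lab_enum k L n j"] s e by auto
    also have "\<dots> \<longleftrightarrow> L n = j"
      using lab_enum_bij[OF val] Ln j unfolding s_def bij_betw_def by (auto dest: inj_onD)
    finally have "{i. i \<le> Suc n \<and> lab_enum k L (Suc n) j \<subseteq> lab_facet k L i} =
        {i. i \<le> n \<and> lab_enum k L n j \<subseteq> lab_facet k L i} \<union> (if L n = j then {Suc n} else {})"
      unfolding lab_enum_old[OF True] by (auto simp: le_Suc_eq facet)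
    also have "card \<dots> = card {i. i \<le> n \<and> lab_enum k L n j \<subseteq> lab_facet k L i} + (if L n = j then 1 else 0)"
      by (subst card_Un_disjoint) auto
    finally show ?thesis using Suc.IH[OF val j] by (simp add: label_count_Suc)
  next
    case False
    then obtain r where r: "j = num_labels k n + r" "r \<in> {1..k+1}"
      using Suc.prems by (intro that[of "j - num_labels k n"]) (auto simp: num_labels_Suc)
    have e: "lab_enum k L (Suc n) j = s - {vertex s (k + 1 - r)} \<union> {?v}"
      using lab_enum_new[OF r(2), of L n] by (simp add: r(1) s_def add_ac del: lab_enum.simps)
    have "{i. i \<le> Suc n \<and> lab_enum k L (Suc n) j \<subseteq> lab_facet k L i} = {Suc n}"
      unfolding e using new_vertex_notin_facet[OF val] by (auto simp: le_Suc_eq facet)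
    moreover have "L a \<noteq> j" if "a < Suc n" for a
    proof -
      have "L a \<le> num_labels k a" using Suc.prems(1) that by (auto simp: valid_labels_def)
      also have "\<dots> \<le> num_labels k n" using that by (intro num_labels_mono) auto
      finally show ?thesis using False by auto
    qed
    ultimately have "label_count L (Suc n) j = 0" "card {i. i \<le> Suc n \<and> lab_enum k L (Suc n) j \<subseteq> lab_facet k L i} = 1"
      unfolding label_count_def by auto
    then show ?thesis by simp
  qed
qed

lemma bij_betw_Collect_image:
  assumes "bij_betw f S T"
  shows "bij_betw f {x. x \<in> S \<and> P (f x)} {y \<in> T. P y}"
  using assms by (auto simp: bij_betw_def inj_on_def)

text \<open>Counts in two ways the pairs of a \<open>k\<close>-simplex containing \<open>A\<close>
  and a facet containing that simplex. The summand is a number of facets by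
  \<open>card_facets_lab_enum\<close>; the factor is \<open>(k + 2) - (m + 1)\<close>, the number of
  vertices of a facet outside \<open>A\<close>.\<close>

lemma sum_label_count_containing:
  assumes "valid_labels k n L" "card A = m + 1" "m \<le> k"
  shows "(\<Sum>i | i \<in> {1..num_labels k n} \<and> A \<subseteq> lab_enum k L n i. 1 + label_count L n i) =
           (k - m + 1) * card {i. i \<le> n \<and> A \<subseteq> lab_facet k L i}"
proof -
  let ?K = "{B. card B = k + 1 \<and> (\<exists>i\<le>n. B \<subseteq> lab_facet k L i)}"
  let ?J = "{i. i \<in> {1..num_labels k n} \<and> A \<subseteq> lab_enum k L n i}"
  have bij: "bij_betw (lab_enum k L n) ?J {B\<in>?K. A \<subseteq> B}"
    by (rule bij_betw_Collect_image[OF lab_enum_bij[OF assms(1)]])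
  have finK: "finite {B\<in>?K. A \<subseteq> B}" using bij_betw_finite[OF bij] by simp
  have "(\<Sum>i\<in>?J. 1 + label_count L n i) = (\<Sum>i\<in>?J. card {l. l \<le> n \<and> lab_enum k L n i \<subseteq> lab_facet k L l})"
    by (rule sum.cong) (auto simp: card_facets_lab_enum[OF assms(1)])
  also have "\<dots> = (\<Sum>B\<in>{B\<in>?K. A \<subseteq> B}. card {l. l \<le> n \<and> B \<subseteq> lab_facet k L l})"
    by (rule sum.reindex_bij_betw[OF bij, where g = "\<lambda>B. card {l. l \<le> n \<and> B \<subseteq> lab_facet k L l}"])
  also have "\<dots> = (\<Sum>B\<in>{B\<in>?K. A \<subseteq> B}. \<Sum>l | l \<in> {..n} \<and> B \<subseteq> lab_facet k L l. 1)"
    by (rule sum.cong) auto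
  also have "\<dots> = (\<Sum>l\<in>{..n}. \<Sum>B | B \<in> {B\<in>?K. A \<subseteq> B} \<and> B \<subseteq> lab_facet k L l. 1)"
    by (rule sum.swap_restrict) (use finK in auto)
  also have "\<dots> = (\<Sum>l\<in>{..n}. if A \<subseteq> lab_facet k L l then k - m + 1 else 0)"
  proof (rule sum.cong)
    fix l assume l: "l \<in> {..n}"
    note f = lab_facet_props[OF assms(1), of l]
    have "(\<Sum>B | B \<in> {B\<in>?K. A \<subseteq> B} \<and> B \<subseteq> lab_facet k L l. 1)
       = card {B. A \<subseteq> B \<and> B \<subseteq> lab_facet k L l \<and> Suc (card B) = card (lab_facet k L l)}"
      unfolding card_eq_sum[symmetric] by (rule arg_cong[where f = card]) (use l f in auto)
    also have "\<dots> = (if A \<subseteq> lab_facet k L l then k - m + 1 else 0)"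
    proof (cases "A \<subseteq> lab_facet k L l")
      case True
      then show ?thesis using card_between_pred[of "lab_facet k L l" A] l f assms by auto
    next
      case False
      then have "{B. A \<subseteq> B \<and> B \<subseteq> lab_facet k L l \<and> Suc (card B) = card (lab_facet k L l)} = {}" by blast
      then show ?thesis using False by (simp only: card.empty if_False)
    qed
    finally show "(\<Sum>B | B \<in> {B\<in>?K. A \<subseteq> B} \<and> B \<subseteq> lab_facet k L l. 1) = \<dots>" .
  qed simp
  also have "\<dots> = (\<Sum>l\<in>{i. i \<le> n \<and> A \<subseteq> lab_facet k L i}. k - m + 1)"
    by (rule sum.mono_neutral_cong_right) auto
  finally show ?thesis by (simp add: mult.commute)
qed

section \<open>The label law of the preferential attachment complex\<close>

text \<open>The function of the label sequence through which both degree sequences factor. The facet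
  count stands for the degree, up to the shift \<open>k - m\<close>, on one side and for the
  weighted sum of birth processes on the other.\<close>

definition lab_degrees :: "nat \<Rightarrow> (nat \<Rightarrow> nat) \<Rightarrow> nat \<Rightarrow> nat \<Rightarrow> nat \<Rightarrow> real" where
  "lab_degrees k L n =
     (\<lambda>j\<in>{1..}. \<lambda>m\<in>{..k}.
        if j \<le> num_labels k n
        then real (k - m) + real (card {i. i \<le> n \<and> top_face k m (lab_enum k L n j) \<subseteq> lab_facet k L i})
        else 0)"

definition pa_label :: "nat \<Rightarrow> (nat \<Rightarrow> nat set) \<Rightarrow> nat \<Rightarrow> nat" where
  "pa_label k s n = (THE l. 1 \<le> l \<and> l \<le> num_labels k n \<and> pa_enum k s n l = s (Suc n))"

definition pa_admissible :: "nat \<Rightarrow> (nat \<Rightarrow> nat set) \<Rightarrow> bool" where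
  "pa_admissible k s \<longleftrightarrow> (\<forall>n. s (Suc n) \<in> simplices k (pa_complex k s n))"

lemma pa_complex_cong:
  "(\<And>i. i < n \<Longrightarrow> s (Suc i) = s' (Suc i)) \<Longrightarrow> pa_complex k s n = pa_complex k s' n"
  by (induction n) auto

lemma pa_enum_eq_lab_enum: "pa_enum k s n = lab_enum k (pa_label k s) n"
  by (induction n) (simp_all add: pa_label_def)

lemma lab_selection_Suc: "lab_selection k L (Suc n) = lab_enum k L n (L n)"
  by (simp add: lab_selection_def)

text \<open>Makes the definite description in \<open>pa_enum\<close> meaningful as long as the
  complex arises from valid labels.\<close>

lemma ex1_label:
  assumes "valid_labels k n L" "A \<in> simplices k (pa_complex k (lab_selection k L) n)"
  shows "\<exists>!l. 1 \<le> l \<and> l \<le> num_labels k n \<and> lab_enum k L n l = A"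
proof -
  have "A \<in> lab_enum k L n ` {1..num_labels k n}"
    using lab_enum_bij[OF assms(1)] assms(2) by (simp add: bij_betw_def simplices_lab_selection)
  then obtain l where l: "l \<in> {1..num_labels k n}" "lab_enum k L n l = A" by auto
  show ?thesis
  proof (rule ex1I[of _ l])
    fix l' assume "1 \<le> l' \<and> l' \<le> num_labels k n \<and> lab_enum k L n l' = A"
    then show "l' = l"
      using bij_betw_imp_inj_on[OF lab_enum_bij[OF assms(1)]] l by (auto dest: inj_onD)
  qed (use l in auto)
qed

text \<open>Both claims need one common induction: the next label is well defined only once the
  current complex is known to be generated by the previous labels.\<close>

lemma pa_label_props:
  assumes "pa_admissible k s"
  shows "valid_labels k n (pa_label k s)"
    and "i < n \<Longrightarrow> lab_selection k (pa_label k s) (Suc i) = s (Suc i)"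
proof -
  have "valid_labels k n (pa_label k s) \<and> (\<forall>i<n. lab_selection k (pa_label k s) (Suc i) = s (Suc i))"
  proof (induction n)
    case 0
    then show ?case by (simp add: valid_labels_def)
  next
    case (Suc n)
    have "pa_complex k s n = pa_complex k (lab_selection k (pa_label k s)) n"
      by (rule pa_complex_cong) (use Suc in simp)
    then have "s (Suc n) \<in> simplices k (pa_complex k (lab_selection k (pa_label k s)) n)"
      using assms by (metis pa_admissible_def)
    from theI'[OF ex1_label[OF conjunct1[OF Suc.IH] this]]
    have "1 \<le> pa_label k s n \<and> pa_label k s n \<le> num_labels k n \<and>
        lab_enum k (pa_label k s) n (pa_label k s n) = s (Suc n)"
      by (simp add: pa_label_def[of k s n] pa_enum_eq_lab_enum)
    then show ?case using Suc by (auto simp: valid_labels_def less_Suc_eq lab_selection_Suc)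
  qed
  then show "valid_labels k n (pa_label k s)"
    "i < n \<Longrightarrow> lab_selection k (pa_label k s) (Suc i) = s (Suc i)" by auto
qed

lemma pa_complex_eq_lab:
  assumes "pa_admissible k s"
  shows "pa_complex k s n = pa_complex k (lab_selection k (pa_label k s)) n"
  by (rule pa_complex_cong) (use pa_label_props(2)[OF assms, of _ n] in simp)

lemma card_simplices_lab_selection:
  assumes "valid_labels k n L"
  shows "card (simplices k (pa_complex k (lab_selection k L) n)) = num_labels k n"
  using bij_betw_same_card[OF lab_enum_bij[OF assms]] by (simp add: simplices_lab_selection)

lemma top_face_lab_enum:
  assumes "valid_labels k n L" "j \<in> {1..num_labels k n}" "m \<le> k"
  shows "card (top_face k m (lab_enum k L n j)) = m + 1"
    "\<exists>i\<le>n. top_face k m (lab_enum k L n j) \<subseteq> lab_facet k L i"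
proof -
  note e = lab_enum_simplex[OF assms(1,2)]
  note t = top_face_subset[OF e(2,1) assms(3)]
  show "card (top_face k m (lab_enum k L n j)) = m + 1" by (rule t)
  show "\<exists>i\<le>n. top_face k m (lab_enum k L n j) \<subseteq> lab_facet k L i" using t(1) e(3) by blast
qed

lemma pa_degree_vector_eq:
  assumes "pa_admissible k s"
  shows "pa_degree_vector k s n = lab_degrees k (pa_label k s) n"
proof -
  let ?L = "pa_label k s"
  have val: "valid_labels k n ?L" by (rule pa_label_props(1)[OF assms])
  show ?thesis
    unfolding pa_degree_vector_def lab_degrees_def pa_complex_eq_lab[OF assms]
      card_simplices_lab_selection[OF val] pa_enum_eq_lab_enum
  proof (intro restrict_ext if_cong refl)
    fix j m assume "j \<in> {1..}" "m \<in> {..k}" "j \<le> num_labels k n"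
    then have "j \<in> {1..num_labels k n}" "m \<le> k" by auto
    from simplex_degree_lab_selection[OF val top_face_lab_enum(1)[OF val this] this(2)
      top_face_lab_enum(2)[OF val this]]
    show "real (simplex_degree m (pa_complex k (lab_selection k ?L) n) (top_face k m (lab_enum k ?L n j))) =
      real (k - m) + real (card {i. i \<le> n \<and> top_face k m (lab_enum k ?L n j) \<subseteq> lab_facet k ?L i})"
      by simp
  qed
qed

lemma simplex_degree_lab_enum:
  assumes "valid_labels k n L" "j \<in> {1..num_labels k n}"
  shows "simplex_degree k (pa_complex k (lab_selection k L) n) (lab_enum k L n j) = 1 + label_count L n j"
  using simplex_degree_lab_selection[OF assms(1), of _ k] lab_enum_simplex[OF assms]
    card_facets_lab_enum[OF assms] by simp

text \<open>The label law needs histories of labels, while \<open>preferential_attachment\<close>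
  conditions on histories of complexes. A complex determines the simplex selected last, because the
  vertex added with it occurs in a single facet.\<close>

lemma pa_history_iff:
  assumes s: "pa_admissible k s" and L: "valid_labels k n L"
  shows "(\<forall>i<n. pa_label k s i = L i) \<longleftrightarrow> (\<forall>i<n. s (Suc i) = lab_selection k L (Suc i))" (is "?A \<longleftrightarrow> ?B")
    and "(\<forall>i<n. pa_label k s i = L i) \<longleftrightarrow>
           (\<forall>i<Suc n. pa_complex k s i = pa_complex k (lab_selection k L) i)" (is "_ \<longleftrightarrow> ?C")
proof -
  have val: "valid_labels k i L" if "i \<le> n" for i using L that by (rule valid_labels_mono)
  have "?A" if B: "?B"
  proof (intro allI impI)
    fix i assume "i < n"
    then show "pa_label k s i = L i"
    proof (induction i rule: less_induct)
      case (less i)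
      have e: "lab_enum k (pa_label k s) i = lab_enum k L i"
        by (rule lab_enum_cong) (use less in auto)
      have "lab_enum k L i (pa_label k s i) = lab_enum k L i (L i)"
        using pa_label_props(2)[OF s, of i "Suc i"] B less.prems by (simp add: e lab_selection_Suc)
      moreover have "pa_label k s i \<in> {1..num_labels k i}"
        using pa_label_props(1)[OF s, of "Suc i"] by (simp add: valid_labels_def)
      moreover have "L i \<in> {1..num_labels k i}" using L less.prems by (simp add: valid_labels_def)
      ultimately show ?case
        using bij_betw_imp_inj_on[OF lab_enum_bij[OF val[of i]]] less.prems by (auto dest: inj_onD)
    qed
  qed
  moreover have "?C" if "?B"
    using that by (auto intro!: pa_complex_cong)
  moreover have "?B" if "?A"
  proof (intro allI impI)
    fix i assume i: "i < n"
    have "lab_enum k (pa_label k s) i = lab_enum k L i"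
      by (rule lab_enum_cong) (use that i in auto)
    then show "s (Suc i) = lab_selection k L (Suc i)"
      using pa_label_props(2)[OF s, of i "Suc i"] that i by (simp add: lab_selection_Suc)
  qed
  moreover have "?B" if C: "?C"
  proof (intro allI impI)
    fix i assume i: "i < n"
    let ?v = "Suc i + k + 2" and ?t = "lab_selection k L (Suc i)"
    have eq: "pa_complex k s j = pa_complex k (lab_selection k L) j" if "j \<le> Suc i" for j
      using C that i by auto
    have "s (Suc i) \<in> simplices k (pa_complex k (lab_selection k L) i)"
      using s eq[of i] by (metis pa_admissible_def le_SucI order_refl)
    then obtain a where a: "card (s (Suc i)) = k + 1" "a \<le> i" "s (Suc i) \<subseteq> lab_facet k L a"
      by (auto simp: simplices_lab_selection)
    have v: "?v \<notin> s (Suc i)" using new_vertex_notin_facet[OF val a(2,3)] i by simp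
    \<comment> \<open>In the complex generated by \<open>L\<close>, only the facet of step
      \<open>Suc i\<close> contains \<open>?v\<close>. So this simplex lies in that facet, and
      \<open>s (Suc i)\<close> lies in \<open>?t\<close>; equal cardinalities give equality.\<close>
    have "s (Suc i) \<union> {?v} \<in> pa_complex k s (Suc i)" by auto
    then obtain b where b: "b \<le> Suc i" "s (Suc i) \<union> {?v} \<subseteq> lab_facet k L b"
      unfolding eq[OF order_refl] pa_complex_lab_selection by blast
    have "b = Suc i"
    proof (rule ccontr)
      assume "b \<noteq> Suc i"
      then have "b \<le> i" using b by simp
      from new_vertex_notin_facet[OF val this b(2)] i show False by simp
    qed
    then have "s (Suc i) \<subseteq> ?t" using b v by (auto simp: lab_facet_def)
    moreover have "L i \<in> {1..num_labels k i}" using L i by (simp add: valid_labels_def)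
    from lab_enum_simplex[OF val this] i have "card ?t = k + 1" "finite ?t" by (auto simp: lab_selection_Suc)
    ultimately show "s (Suc i) = ?t" using a by (intro card_subset_eq) auto
  qed
  ultimately show "?A \<longleftrightarrow> ?B" "?A \<longleftrightarrow> ?C" by blast+
qed

abbreviation label_space :: "(nat \<Rightarrow> nat) measure" where
  "label_space \<equiv> Pi\<^sub>M UNIV (\<lambda>_. count_space UNIV)"

text \<open>The event that label \<open>i\<close> equals \<open>v\<close> is a countable union of
  prefix events, one for each list of length \<open>Suc i\<close> ending in
  \<open>v\<close>.\<close>

lemma measurable_label_sequence:
  assumes "\<And>n L. {\<omega> \<in> space M. \<forall>i<n. U \<omega> i = L i} \<in> sets M"
  shows "U \<in> measurable M label_space"
proof (rule measurable_PiM_single')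
  fix i :: nat
  show "(\<lambda>\<omega>. U \<omega> i) \<in> measurable M (count_space UNIV)"
  proof (rule measurable_count_space_eq2_countable[THEN iffD2])
    have "(\<lambda>\<omega>. U \<omega> i) -` {v} \<inter> space M \<in> sets M" for v
    proof -
      have "(\<lambda>\<omega>. U \<omega> i) -` {v} \<inter> space M =
          (\<Union>xs\<in>{xs. length xs = Suc i \<and> xs ! i = v}. {\<omega> \<in> space M. \<forall>a<Suc i. U \<omega> a = xs ! a})"
      proof (intro equalityI subsetI)
        fix \<omega> assume "\<omega> \<in> (\<lambda>\<omega>. U \<omega> i) -` {v} \<inter> space M"
        then show "\<omega> \<in> (\<Union>xs\<in>{xs. length xs = Suc i \<and> xs ! i = v}. {\<omega> \<in> space M. \<forall>a<Suc i. U \<omega> a = xs ! a})"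
          by (intro UN_I[of "map (U \<omega>) [0..<Suc i]"]) (auto simp del: upt_Suc)
      qed auto
      also have "\<dots> \<in> sets M" by (intro sets.countable_UN'' assms) auto
      finally show ?thesis .
    qed
    then show "(\<lambda>\<omega>. U \<omega> i) \<in> space M \<rightarrow> UNIV \<and> (\<forall>a\<in>UNIV. (\<lambda>\<omega>. U \<omega> i) -` {a} \<inter> space M \<in> sets M)"
      by auto
  qed
qed auto

definition label_prob :: "nat \<Rightarrow> real \<Rightarrow> (nat \<Rightarrow> nat) \<Rightarrow> nat \<Rightarrow> real" where
  "label_prob k \<delta> L n = (\<Prod>j<n. (1 + real (label_count L j (L j)) + \<delta>) /
       (\<Sum>i\<in>{1..num_labels k j}. 1 + real (label_count L j i) + \<delta>))"

lemma preferential_attachment_admissible: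
  assumes "preferential_attachment M k \<delta> S" "\<omega> \<in> space M"
  shows "pa_admissible k (\<lambda>i. S i \<omega>)"
  unfolding pa_admissible_def
proof
  fix n
  have "\<forall>n\<ge>1. S n \<omega> \<in> simplices k (pa_complex k (\<lambda>i. S i \<omega>) (n - 1))"
    using assms by (auto simp: preferential_attachment_def)
  from this[rule_format, of "Suc n"]
  show "S (Suc n) \<omega> \<in> simplices k (pa_complex k (\<lambda>i. S i \<omega>) n)" by simp
qed

lemma pa_label_event:
  assumes "preferential_attachment M k \<delta> S"
  shows "{\<omega> \<in> space M. \<forall>i<n. pa_label k (\<lambda>i. S i \<omega>) i = L i} =
      (if valid_labels k n L then {\<omega> \<in> space M. \<forall>i<n. S (Suc i) \<omega> = lab_selection k L (Suc i)} else {})"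
proof (cases "valid_labels k n L")
  case True
  then show ?thesis
    using pa_history_iff(1)[OF preferential_attachment_admissible[OF assms] True] by auto
next
  case False
  have "valid_labels k n L" if "\<omega> \<in> space M" "\<forall>i<n. pa_label k (\<lambda>i. S i \<omega>) i = L i" for \<omega>
    using pa_label_props(1)[OF preferential_attachment_admissible[OF assms that(1)]]
      valid_labels_cong[of n "pa_label k (\<lambda>i. S i \<omega>)" L k] that(2) by auto
  with False show ?thesis by auto
qed

lemma pa_label_event_sets:
  assumes "preferential_attachment M k \<delta> S"
  shows "{\<omega> \<in> space M. \<forall>i<n. pa_label k (\<lambda>i. S i \<omega>) i = L i} \<in> sets M"
proof -
  have [measurable]: "S (Suc i) \<in> measurable M (count_space UNIV)" for i
    using assms by (auto simp: preferential_attachment_def)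
  have "{\<omega> \<in> space M. \<forall>i<n. S (Suc i) \<omega> = lab_selection k L (Suc i)} \<in> sets M"
    by measurable
  then show "{\<omega> \<in> space M. \<forall>i<n. pa_label k (\<lambda>i. S i \<omega>) i = L i} \<in> sets M"
    unfolding pa_label_event[OF assms] by auto
qed

lemma pa_label_measurable:
  assumes "preferential_attachment M k \<delta> S"
  shows "(\<lambda>\<omega>. pa_label k (\<lambda>i. S i \<omega>)) \<in> measurable M label_space"
  by (rule measurable_label_sequence) (rule pa_label_event_sets[OF assms])

lemma pa_label_prob:
  assumes M: "prob_space M" and pa: "preferential_attachment M k \<delta> S" and L: "valid_labels k n L"
  shows "measure M {\<omega> \<in> space M. \<forall>i<n. pa_label k (\<lambda>i. S i \<omega>) i = L i} = label_prob k \<delta> L n"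
  using L
proof (induction n)
  case 0
  interpret prob_space M by fact
  show ?case by (simp add: label_prob_def prob_space)
next
  case (Suc n)
  interpret prob_space M by fact
  let ?E = "\<lambda>n. {\<omega> \<in> space M. \<forall>i<n. pa_label k (\<lambda>i. S i \<omega>) i = L i}"
  let ?g = "pa_complex k (lab_selection k L)"
  let ?w = "(1 + real (label_count L n (L n)) + \<delta>) / (\<Sum>i\<in>{1..num_labels k n}. 1 + real (label_count L n i) + \<delta>)"
  have val: "valid_labels k n L" using Suc.prems by (rule valid_labels_mono) simp
  have Ln: "L n \<in> {1..num_labels k n}" using Suc.prems by (simp add: valid_labels_def)
  note adm = preferential_attachment_admissible[OF pa]
  \<comment> \<open>The first \<open>n\<close> labels carry the information of the complexes up to
    time \<open>n\<close>, which is the history on which the rule for step \<open>Suc n\<close>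
    conditions.\<close>
  have E: "?E n = {\<omega> \<in> space M. \<forall>i<Suc n. pa_complex k (\<lambda>i. S i \<omega>) i = ?g i}"
    using pa_history_iff(2)[OF adm val] by auto
  have E': "?E (Suc n) = {\<omega> \<in> space M. S (Suc n) \<omega> = lab_enum k L n (L n) \<and>
      (\<forall>i<Suc n. pa_complex k (\<lambda>i. S i \<omega>) i = ?g i)}"
  proof (intro Collect_cong conj_cong refl)
    fix \<omega> assume \<omega>: "\<omega> \<in> space M"
    have "(\<forall>i<Suc n. pa_label k (\<lambda>i. S i \<omega>) i = L i) \<longleftrightarrow>
        S (Suc n) \<omega> = lab_selection k L (Suc n) \<and> (\<forall>i<n. S (Suc i) \<omega> = lab_selection k L (Suc i))"
      unfolding pa_history_iff(1)[OF adm[OF \<omega>] Suc.prems] by (rule All_less_Suc)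
    also have "(\<forall>i<n. S (Suc i) \<omega> = lab_selection k L (Suc i)) \<longleftrightarrow>
        (\<forall>i<Suc n. pa_complex k (\<lambda>i. S i \<omega>) i = ?g i)"
      by (rule trans[OF pa_history_iff(1)[OF adm[OF \<omega>] val, symmetric] pa_history_iff(2)[OF adm[OF \<omega>] val]])
    finally show "(\<forall>i<Suc n. pa_label k (\<lambda>i. S i \<omega>) i = L i) \<longleftrightarrow>
        S (Suc n) \<omega> = lab_enum k L n (L n) \<and> (\<forall>i<Suc n. pa_complex k (\<lambda>i. S i \<omega>) i = ?g i)"
      unfolding lab_selection_Suc .
  qed
  have meas: "?E n \<in> sets M" for n by (rule pa_label_event_sets[OF pa])
  show ?case
  proof (cases "measure M (?E n) > 0")
    case True
    have eqs: "simplices k (?g n) = lab_enum k L n ` {1..num_labels k n}" 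
      using lab_enum_bij[OF val] by (simp add: bij_betw_def simplices_lab_selection)
    have mem: "lab_enum k L n (L n) \<in> simplices k (?g n)" using Ln by (auto simp: eqs)
    have "\<P>(\<omega> in M. S (Suc n) \<omega> = lab_enum k L n (L n) \<bar> \<forall>i<Suc n. pa_complex k (\<lambda>i. S i \<omega>) i = ?g i) =
        (real (simplex_degree k (?g n) (lab_enum k L n (L n))) + \<delta>) /
        (\<Sum>B\<in>simplices k (?g n). real (simplex_degree k (?g n) B) + \<delta>)"
      by (rule pa[unfolded preferential_attachment_def, THEN conjunct2, THEN conjunct2, rule_format,
            of "Suc n" ?g, unfolded diff_Suc_1, OF _ True[unfolded E] mem]) simp
    also have "(\<Sum>B\<in>simplices k (?g n). real (simplex_degree k (?g n) B) + \<delta>) =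
        (\<Sum>i\<in>{1..num_labels k n}. real (simplex_degree k (?g n) (lab_enum k L n i)) + \<delta>)"
      unfolding eqs by (subst sum.reindex) (use lab_enum_bij[OF val] in \<open>auto simp: bij_betw_def\<close>)
    also have "\<dots> = (\<Sum>i\<in>{1..num_labels k n}. 1 + real (label_count L n i) + \<delta>)"
      by (rule sum.cong) (auto simp: simplex_degree_lab_enum[OF val])
    also have "real (simplex_degree k (?g n) (lab_enum k L n (L n))) = 1 + real (label_count L n (L n))"
      using simplex_degree_lab_enum[OF val Ln] by simp
    finally have "measure M (?E (Suc n)) / measure M (?E n) = ?w"
      unfolding cond_prob_def E E' .
    then have "measure M (?E (Suc n)) = measure M (?E n) * ?w"
      using True by (simp add: field_simps)
    then show ?thesis using Suc.IH[OF val] by (simp add: label_prob_def)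
  next
    \<comment> \<open>The transition rule says nothing about null histories; there both sides
      vanish.\<close>
    case False
    then have 0: "measure M (?E n) = 0" using measure_nonneg[of M "?E n"] by linarith
    have "measure M (?E (Suc n)) \<le> measure M (?E n)"
      by (rule finite_measure_mono[OF _ meas]) (auto simp only: less_Suc_eq)
    then have "measure M (?E (Suc n)) = 0" using 0 measure_nonneg[of M "?E (Suc n)"] by linarith
    moreover have "label_prob k \<delta> L (Suc n) = 0" using Suc.IH[OF val] 0 by (simp add: label_prob_def)
    ultimately show ?thesis by simp
  qed
qed

section \<open>Races of exponential clocks\<close>

definition exp_measure :: "real \<Rightarrow> real measure" where
  "exp_measure r = density lborel (exponential_density r)"

lemma sets_exp_measure [simp, measurable_cong]: "sets (exp_measure r) = sets borel"
  by (simp add: exp_measure_def)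

lemma space_exp_measure [simp]: "space (exp_measure r) = UNIV"
  by (simp add: exp_measure_def)

lemma prob_space_exp_measure: "0 < r \<Longrightarrow> prob_space (exp_measure r)"
  unfolding exp_measure_def by (rule prob_space_exponential_density)

lemma AE_exp_measure_nonneg: "AE t in exp_measure r. 0 \<le> t"
  unfolding exp_measure_def by (subst AE_density) (auto simp: exponential_density_def)

text \<open>The probability that a clock of rate \<open>r\<close> rings before independent rivals of
  total rate \<open>R\<close>; \<open>R = 0\<close> is a race without rivals. The damped density is
  \<open>r / (r + R)\<close> times the density of rate \<open>r + R\<close>, which integrates to
  one.\<close>

lemma nn_integral_exp_exp_measure:
  assumes "0 < r" "0 \<le> R"
  shows "(\<integral>\<^sup>+t. ennreal (exp (- R * t)) \<partial>exp_measure r) = ennreal (r / (r + R))"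
proof -
  interpret prob_space "exp_measure (r + R)" using assms by (intro prob_space_exp_measure) simp
  have "(\<integral>\<^sup>+t. ennreal (exp (- R * t)) \<partial>exp_measure r) =
      (\<integral>\<^sup>+t. ennreal (exponential_density r t) * ennreal (exp (- R * t)) \<partial>lborel)"
    unfolding exp_measure_def by (subst nn_integral_density) auto
  also have "\<dots> = (\<integral>\<^sup>+t. ennreal (r / (r + R)) * ennreal (exponential_density (r + R) t) \<partial>lborel)"
  proof (rule nn_integral_cong)
    fix t
    have "exponential_density r t * exp (- R * t) = r / (r + R) * exponential_density (r + R) t"
    proof -
      have "exp (- t * r) * exp (- R * t) = exp (- t * (r + R))"
        by (simp add: exp_add[symmetric] algebra_simps)
      moreover have "r / (r + R) * (r + R) = r" using assms by simp
      ultimately show ?thesis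
        using assms by (simp add: exponential_density_def mult.assoc)
    qed
    then show "ennreal (exponential_density r t) * ennreal (exp (- R * t)) =
        ennreal (r / (r + R)) * ennreal (exponential_density (r + R) t)"
      using assms by (simp add: ennreal_mult''[symmetric] exponential_density_nonneg)
  qed
  also have "\<dots> = ennreal (r / (r + R)) * emeasure (exp_measure (r + R)) UNIV"
    by (subst nn_integral_cmult) (auto simp: exp_measure_def emeasure_density)
  finally show ?thesis using emeasure_space_1 by simp
qed

lemma exp_measure_memoryless:
  assumes "0 < r" "0 \<le> t" and A: "A \<in> sets borel"
  shows "emeasure (exp_measure r) {v. t < v \<and> v - t \<in> A} = ennreal (exp (- r * t)) * emeasure (exp_measure r) A"
proof -
  have [measurable]: "A \<in> sets borel" by fact
  let ?f = "\<lambda>v. ennreal (exponential_density r v) * indicator {v. t < v \<and> v - t \<in> A} v"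
  have "emeasure (exp_measure r) {v. t < v \<and> v - t \<in> A} = (\<integral>\<^sup>+v. ?f v \<partial>lborel)"
    unfolding exp_measure_def by (subst emeasure_density) auto
  also have "\<dots> = (\<integral>\<^sup>+u. ?f (t + 1 * u) \<partial>lborel)"
    by (subst nn_integral_real_affine[where c = 1 and t = t]) auto
  also have "\<dots> = (\<integral>\<^sup>+u. ennreal (exp (- r * t)) * (ennreal (exponential_density r u) * indicator A u) \<partial>lborel)"
  proof (rule nn_integral_cong_AE)
    \<comment> \<open>At \<open>u = 0\<close> the strict inequality \<open>t < v\<close> fails
      although the density is positive, so the integrands agree only off a null set.\<close>
    have "AE u in lborel. u \<noteq> (0::real)" by (rule AE_lborel_singleton)
    then show "AE u in lborel. ?f (t + 1 * u) =
        ennreal (exp (- r * t)) * (ennreal (exponential_density r u) * indicator A u)"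
    proof eventually_elim
      case (elim u)
      have "exponential_density r (t + u) = exp (- r * t) * exponential_density r u" if "0 < u"
        using that assms by (simp add: exponential_density_def exp_add[symmetric] algebra_simps)
      then have "ennreal (exponential_density r (t + u)) = ennreal (exp (- r * t)) * ennreal (exponential_density r u)" if "0 < u"
        using that assms by (simp add: ennreal_mult' exponential_density_nonneg)
      moreover have "exponential_density r u = 0" if "\<not> 0 < u"
        using that elim by (auto simp: exponential_density_def)
      ultimately show ?case using elim by (auto simp: indicator_def)
    qed
  qed
  also have "\<dots> = ennreal (exp (- r * t)) * emeasure (exp_measure r) A"
    unfolding exp_measure_def by (subst nn_integral_cmult) (auto simp: emeasure_density)
  finally show ?thesis .
qed

text \<open>A family \<open>x\<close> lists, for each competitor \<open>i\<close>, its successive waiting times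
  \<open>x (i, 0), x (i, 1), \<dots>\<close>. When \<open>l\<close> wins the race among the competitors in \<open>A\<close>, the first
  waiting time of \<open>l\<close> is used up and the other competitors keep their residual waiting times.\<close>

definition race_index :: "'i \<Rightarrow> 'i \<times> nat \<Rightarrow> 'i \<times> nat" where
  "race_index l p = (if fst p = l then (l, Suc (snd p)) else p)"

definition race_wins :: "'i set \<Rightarrow> 'i \<Rightarrow> ('i \<times> nat \<Rightarrow> real) \<Rightarrow> bool" where
  "race_wins A l x \<longleftrightarrow> (\<forall>i\<in>A - {l}. x (l, 0) < x (i, 0))"

definition race_shift :: "'i set \<Rightarrow> 'i set \<Rightarrow> 'i \<Rightarrow> ('i \<times> nat \<Rightarrow> real) \<Rightarrow> 'i \<times> nat \<Rightarrow> real" where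
  "race_shift R A l x =
     (\<lambda>p\<in>R \<times> UNIV. x (race_index l p) - (if p \<in> (A - {l}) \<times> {0} then x (l, 0) else 0))"

lemma inj_race_index: "inj (race_index l)"
  by (auto simp: inj_def race_index_def split: if_splits)

lemma race_index_neq: "race_index l p \<noteq> (l, 0)"
  by (auto simp: race_index_def prod_eq_iff)

lemma measurable_race_shift:
  assumes "A \<subseteq> R" "l \<in> R"
  shows "race_shift R A l \<in> measurable (Pi\<^sub>M (R \<times> UNIV) (\<lambda>_. borel)) (Pi\<^sub>M (R \<times> UNIV) (\<lambda>_. borel))"
proof -
  have [measurable]: "(\<lambda>x. x (race_index l p)) \<in> borel_measurable (Pi\<^sub>M (R \<times> UNIV) (\<lambda>_. borel))"
    if "p \<in> R \<times> UNIV" for p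
    by (rule measurable_component_singleton) (use assms that in \<open>auto simp: race_index_def\<close>)
  have [measurable]: "(\<lambda>x. x (l, 0)) \<in> borel_measurable (Pi\<^sub>M (R \<times> UNIV) (\<lambda>_. borel))"
    by (rule measurable_component_singleton) (use assms in auto)
  show ?thesis unfolding race_shift_def[abs_def] by measurable
qed

lemma sets_race_wins:
  assumes "A \<subseteq> R" "l \<in> R" "finite A"
  shows "{x \<in> space (Pi\<^sub>M (R \<times> UNIV) (\<lambda>_. borel)). race_wins A l x} \<in> sets (Pi\<^sub>M (R \<times> UNIV) (\<lambda>_. borel))"
proof -
  have [measurable]: "(\<lambda>x. x (i, 0)) \<in> borel_measurable (Pi\<^sub>M (R \<times> UNIV) (\<lambda>_. borel))"
    if "i \<in> R" for i
    by (rule measurable_component_singleton) (use that in auto)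
  have "{x \<in> space (Pi\<^sub>M (R \<times> UNIV) (\<lambda>_. borel)). x (l, 0) < (x (i, 0) :: real)} \<in> sets (Pi\<^sub>M (R \<times> UNIV) (\<lambda>_. borel))"
    if "i \<in> A - {l}" for i
    using that assms by (intro borel_measurable_less) auto
  then show ?thesis
    unfolding race_wins_def using assms by (intro sets.sets_Collect_finite_All) auto
qed

abbreviation exp_family :: "'i set \<Rightarrow> ('i \<times> nat \<Rightarrow> real) \<Rightarrow> ('i \<times> nat \<Rightarrow> real) measure" where
  "exp_family R \<rho> \<equiv> Pi\<^sub>M (R \<times> UNIV) (\<lambda>p. exp_measure (\<rho> p))"

lemma sets_exp_family: "sets (Pi\<^sub>M I (\<lambda>p. exp_measure (\<rho> p))) = sets (Pi\<^sub>M I (\<lambda>_. borel))"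
  by (intro sets_PiM_cong) auto

lemma space_exp_family: "space (Pi\<^sub>M I (\<lambda>p. exp_measure (\<rho> p))) = space (Pi\<^sub>M I (\<lambda>_. borel))"
  by (simp add: space_PiM)

text \<open>Once the winning time \<open>t\<close> is fixed in coordinate \<open>(l, 0)\<close>, the
  race event is a box: winning and the residual conditions constrain each remaining coordinate
  separately, and \<open>race_index l\<close> tells which one. The memoryless factors of the rivals
  combine into the exponential.\<close>

lemma race_section:
  fixes J :: "('i \<times> nat) set"
  assumes J: "finite J" "J \<subseteq> R \<times> UNIV" "\<And>p. p \<in> J \<Longrightarrow> F p \<in> sets borel"
    and A: "finite A" "A \<subseteq> R" "l \<in> A" and \<rho>: "\<And>p. 0 < \<rho> p" and t: "0 \<le> t"
  shows "emeasure (Pi\<^sub>M (R \<times> UNIV - {(l, 0)}) (\<lambda>p. exp_measure (\<rho> p)))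
     {X \<in> space (Pi\<^sub>M (R \<times> UNIV - {(l, 0)}) (\<lambda>p. exp_measure (\<rho> p))).
        race_wins A l (X((l, 0) := t)) \<and> (\<forall>p\<in>J. race_shift R A l (X((l, 0) := t)) p \<in> F p)} =
     ennreal (exp (- (\<Sum>i\<in>A - {l}. \<rho> (i, 0)) * t)) * (\<Prod>p\<in>J. emeasure (exp_measure (\<rho> (race_index l p))) (F p))"
proof -
  let ?I = "R \<times> UNIV - {(l, 0::nat)}"
  let ?K = "Pi\<^sub>M ?I (\<lambda>p. exp_measure (\<rho> p))"
  let ?\<sigma> = "race_index l"
  interpret prob_space "exp_measure (\<rho> p)" for p by (rule prob_space_exp_measure) (rule \<rho>)
  interpret K: product_prob_space "\<lambda>p. exp_measure (\<rho> p)" ?I by unfold_locales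
  define G where "G = (A - {l}) \<times> {0::nat}"
  \<comment> \<open>Winning constrains the first waiting time of every rival, also of rivals outside
    \<open>J\<close>; for these the residual condition is the trivial set
    \<open>UNIV\<close>.\<close>
  define J' where "J' = J \<union> G"
  define F' where "F' p = (if p \<in> J then F p else UNIV)" for p
  define D where "D p = (if p \<in> G then {v. t < v \<and> v - t \<in> F' p} else F' p)" for p
  have F': "F' p \<in> sets borel" for p using J(3) by (auto simp: F'_def)
  have D: "D p \<in> sets borel" for p
    using F'[of p] unfolding D_def by auto
  have G: "finite G" using A by (simp add: G_def)
  have J': "finite J'" "J' \<subseteq> R \<times> UNIV" using J A by (auto simp: J'_def G_def)
  have \<sigma>G: "?\<sigma> p = p" if "p \<in> G" for p using that by (auto simp: G_def race_index_def)
  have \<sigma>I: "?\<sigma> ` J' \<subseteq> ?I" using J'(2) A race_index_neq[of l] by (auto simp: race_index_def)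
  have shift: "race_shift R A l (X((l, 0) := t)) p = X (?\<sigma> p) - (if p \<in> G then t else 0)"
    if "p \<in> R \<times> UNIV" for X p
    using that race_index_neq[of l p] by (simp add: race_shift_def G_def)
  have wins: "race_wins A l (X((l, 0) := t)) \<longleftrightarrow> (\<forall>p\<in>G. t < X (?\<sigma> p))" for X
    unfolding race_wins_def by (auto simp: G_def race_index_def)
  have iff: "race_wins A l (X((l, 0) := t)) \<and> (\<forall>p\<in>J. race_shift R A l (X((l, 0) := t)) p \<in> F p)
      \<longleftrightarrow> (\<forall>q\<in>?\<sigma> ` J'. X q \<in> D (inv ?\<sigma> q))" for X
  proof -
    have "(\<forall>q\<in>?\<sigma> ` J'. X q \<in> D (inv ?\<sigma> q)) \<longleftrightarrow> (\<forall>p\<in>J'. X (?\<sigma> p) \<in> D p)"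
      by (simp add: inv_f_f[OF inj_race_index])
    also have "\<dots> \<longleftrightarrow> (\<forall>p\<in>J'. (p \<in> G \<longrightarrow> t < X (?\<sigma> p)) \<and> (X (?\<sigma> p) - (if p \<in> G then t else 0) \<in> F' p))"
      by (intro ball_cong) (auto simp: D_def)
    also have "\<dots> \<longleftrightarrow> (\<forall>p\<in>G. t < X (?\<sigma> p)) \<and> (\<forall>p\<in>J. X (?\<sigma> p) - (if p \<in> G then t else 0) \<in> F p)"
      by (auto simp: J'_def F'_def)
    also have "(\<forall>p\<in>J. X (?\<sigma> p) - (if p \<in> G then t else 0) \<in> F p) \<longleftrightarrow>
        (\<forall>p\<in>J. race_shift R A l (X((l, 0) := t)) p \<in> F p)"
      by (intro ball_cong refl) (use J(2) shift in auto)
    finally show ?thesis by (simp add: wins)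
  qed
  have "emeasure ?K {X \<in> space ?K. \<forall>q\<in>?\<sigma> ` J'. X q \<in> D (inv ?\<sigma> q)} =
      (\<Prod>q\<in>?\<sigma> ` J'. emeasure (exp_measure (\<rho> q)) (D (inv ?\<sigma> q)))"
    using J' \<sigma>I D by (intro K.emeasure_PiM_Collect) auto
  also have "\<dots> = (\<Prod>p\<in>J'. emeasure (exp_measure (\<rho> (?\<sigma> p))) (D p))"
    by (subst prod.reindex) (auto intro: inj_on_subset[OF inj_race_index] simp: inv_f_f[OF inj_race_index])
  also have "\<dots> = (\<Prod>p\<in>J'. (if p \<in> G then ennreal (exp (- \<rho> p * t)) else 1) * emeasure (exp_measure (\<rho> (?\<sigma> p))) (F' p))"
    by (intro prod.cong refl) (auto simp: D_def \<sigma>G exp_measure_memoryless[OF \<rho> t F'])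
  also have "\<dots> = (\<Prod>p\<in>J'. if p \<in> G then ennreal (exp (- \<rho> p * t)) else 1) *
      (\<Prod>p\<in>J'. emeasure (exp_measure (\<rho> (?\<sigma> p))) (F' p))"
    by (rule prod.distrib)
  also have "(\<Prod>p\<in>J'. if p \<in> G then ennreal (exp (- \<rho> p * t)) else 1) = (\<Prod>p\<in>G. ennreal (exp (- \<rho> p * t)))"
    by (rule prod.mono_neutral_cong_right) (use J' in \<open>auto simp: J'_def\<close>)
  also have "\<dots> = ennreal (\<Prod>p\<in>G. exp (- \<rho> p * t))"
    by (rule prod_ennreal) simp
  also have "(\<Prod>p\<in>G. exp (- \<rho> p * t)) = exp (- (\<Sum>p\<in>G. \<rho> p) * t)"
    using G by (simp add: exp_sum[symmetric] sum_distrib_right sum_negf)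
  also have "(\<Sum>p\<in>G. \<rho> p) = (\<Sum>i\<in>A - {l}. \<rho> (i, 0))"
  proof -
    have "G = (\<lambda>i. (i, 0)) ` (A - {l})" by (auto simp: G_def)
    then show ?thesis by (simp add: sum.reindex inj_on_def)
  qed
  also have "(\<Prod>p\<in>J'. emeasure (exp_measure (\<rho> (?\<sigma> p))) (F' p)) = (\<Prod>p\<in>J. emeasure (exp_measure (\<rho> (?\<sigma> p))) (F p))"
  proof (rule prod.mono_neutral_cong_right)
    show "\<forall>i\<in>J' - J. emeasure (exp_measure (\<rho> (?\<sigma> i))) (F' i) = 1"
      using emeasure_space_1 by (auto simp: F'_def)
  qed (use J' in \<open>auto simp: J'_def F'_def\<close>)
  finally show ?thesis by (simp only: iff)
qed

text \<open>The value from \<open>race_section\<close> depends on the winning time only through an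
  exponential factor. Integrating that time out leaves a constant, the winning probability, times a
  box probability under the updated rates. Agreement on finite boxes identifies the
  measures.\<close>

lemma race_step:
  assumes A: "finite A" "A \<subseteq> R" "l \<in> A" and \<rho>: "\<And>p. 0 < \<rho> p"
    and B: "B \<in> sets (Pi\<^sub>M (R \<times> UNIV) (\<lambda>_. borel))"
  shows "emeasure (exp_family R \<rho>) {x \<in> space (exp_family R \<rho>). race_wins A l x \<and> race_shift R A l x \<in> B} =
     ennreal (\<rho> (l, 0) / (\<Sum>i\<in>A. \<rho> (i, 0))) * emeasure (exp_family R (\<lambda>p. \<rho> (race_index l p))) B"
proof -
  let ?P = "Pi\<^sub>M (R \<times> UNIV) (\<lambda>_. borel) :: ('a \<times> nat \<Rightarrow> real) measure"
  let ?\<mu> = "exp_family R \<rho>" and ?\<mu>' = "exp_family R (\<lambda>p. \<rho> (race_index l p))"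
  let ?I = "R \<times> UNIV - {(l, 0::nat)}"
  let ?K = "Pi\<^sub>M ?I (\<lambda>p. exp_measure (\<rho> p))"
  let ?q = "ennreal (\<rho> (l, 0) / (\<Sum>i\<in>A. \<rho> (i, 0)))"
  let ?W = "{x \<in> space ?P. race_wins A l x}"
  interpret prob_space "exp_measure (\<rho> p)" for p by (rule prob_space_exp_measure) (rule \<rho>)
  interpret \<mu>': product_prob_space "\<lambda>p. exp_measure (\<rho> (race_index l p))" "R \<times> UNIV" by unfold_locales
  interpret K: product_prob_space "\<lambda>p. exp_measure (\<rho> p)" ?I by unfold_locales
  have lR: "l \<in> R" using A by auto
  have [measurable_cong]: "sets ?\<mu> = sets ?P" "sets ?\<mu>' = sets ?P" by (rule sets_exp_family)+
  have W [measurable]: "?W \<in> sets ?P" by (rule sets_race_wins) (use A lR in auto)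
  have shift [measurable]: "race_shift R A l \<in> measurable ?P ?P" by (rule measurable_race_shift[OF A(2) lR])
  have sp: "space ?\<mu> = space ?P" "space ?\<mu>' = space ?P" by (rule space_exp_family)+
  \<comment> \<open>The density restricts to the event that \<open>l\<close> wins, so
    \<open>?D\<close> is the unnormalised law of the residual times on this event.\<close>
  let ?D = "distr (density ?\<mu> (indicator ?W)) ?P (race_shift R A l)"
  have D: "emeasure ?D B = emeasure ?\<mu> {x \<in> space ?\<mu>. race_wins A l x \<and> race_shift R A l x \<in> B}"
    if [measurable]: "B \<in> sets ?P" for B
  proof -
    have "emeasure ?D B = emeasure (density ?\<mu> (indicator ?W)) (race_shift R A l -` B \<inter> space ?P)"
      by (subst emeasure_distr) (auto simp: sp)
    also have "\<dots> = emeasure ?\<mu> (?W \<inter> (race_shift R A l -` B \<inter> space ?P))"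
      by (rule emeasure_restricted) (use measurable_sets[OF shift that] in \<open>auto simp: sets_exp_family\<close>)
    also have "?W \<inter> (race_shift R A l -` B \<inter> space ?P) = {x \<in> space ?\<mu>. race_wins A l x \<and> race_shift R A l x \<in> B}"
      by (auto simp: sp)
    finally show ?thesis .
  qed
  have sum: "\<rho> (l, 0) + (\<Sum>i\<in>A - {l}. \<rho> (i, 0)) = (\<Sum>i\<in>A. \<rho> (i, 0))"
    using A by (simp add: sum.remove[of A l])
  have "scale_measure ?q ?\<mu>' = ?D"
  proof (rule measure_eqI_PiM_infinite[where I = "R \<times> UNIV" and M = "\<lambda>_. borel"])
    show "finite_measure (scale_measure ?q ?\<mu>')"
      by (rule finite_measureI) (simp add: \<mu>'.emeasure_space_1 ennreal_mult_eq_top_iff)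
    fix F and J :: "('a \<times> nat) set"
    assume J: "finite J" "J \<subseteq> R \<times> UNIV" "\<And>p. p \<in> J \<Longrightarrow> F p \<in> sets (borel :: real measure)"
    let ?box = "prod_emb (R \<times> UNIV) (\<lambda>_. borel) J (Pi\<^sub>E J F) :: ('a \<times> nat \<Rightarrow> real) set"
    have box: "?box = {x \<in> space ?P. \<forall>p\<in>J. x p \<in> F p}"
      using J by (auto simp: prod_emb_def space_PiM PiE_iff extensional_def)
    have box_sets: "?box \<in> sets ?P" by (rule sets_PiM_I) (use J in auto)
    let ?E = "{x \<in> space ?\<mu>. race_wins A l x \<and> race_shift R A l x \<in> ?box}"
    let ?f = "\<lambda>(t, X). X((l, 0) := t)"
    have E_sets: "?E \<in> sets ?\<mu>"
    proof -
      have "?E = ?W \<inter> (race_shift R A l -` ?box \<inter> space ?P)" by (auto simp: sp)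
      then show ?thesis using sets.Int[OF W measurable_sets[OF shift box_sets]] by (simp only: sets_exp_family)
    qed
    have ins: "insert (l, 0) ?I = R \<times> UNIV" using lR by auto
    have f: "?f \<in> measurable (exp_measure (\<rho> (l, 0)) \<Otimes>\<^sub>M ?K) ?\<mu>"
      unfolding split_beta by (rule measurable_fun_upd[where J = ?I]) (use lR in auto)
    have "?\<mu> = distr (exp_measure (\<rho> (l, 0)) \<Otimes>\<^sub>M ?K) ?\<mu> ?f"
      using distr_pair_PiM_eq_PiM[of ?I "\<lambda>p. exp_measure (\<rho> p)" "(l, 0)"]
      unfolding ins by (simp add: prob_space_axioms)
    then have "emeasure ?\<mu> ?E = emeasure (distr (exp_measure (\<rho> (l, 0)) \<Otimes>\<^sub>M ?K) ?\<mu> ?f) ?E" by simp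
    also have "\<dots> = emeasure (exp_measure (\<rho> (l, 0)) \<Otimes>\<^sub>M ?K) (?f -` ?E \<inter> space (exp_measure (\<rho> (l, 0)) \<Otimes>\<^sub>M ?K))"
      by (rule emeasure_distr[OF f E_sets])
    also have "\<dots> = (\<integral>\<^sup>+t. emeasure ?K (Pair t -` (?f -` ?E \<inter> space (exp_measure (\<rho> (l, 0)) \<Otimes>\<^sub>M ?K))) \<partial>exp_measure (\<rho> (l, 0)))"
      by (rule K.emeasure_pair_measure_alt) (rule measurable_sets[OF f E_sets])
    also have "\<dots> = (\<integral>\<^sup>+t. ennreal (exp (- (\<Sum>i\<in>A - {l}. \<rho> (i, 0)) * t)) *
        (\<Prod>p\<in>J. emeasure (exp_measure (\<rho> (race_index l p))) (F p)) \<partial>exp_measure (\<rho> (l, 0)))"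
    proof (rule nn_integral_cong_AE, rule AE_mp[OF AE_exp_measure_nonneg], rule AE_I2, rule impI)
      fix t :: real assume t: "0 \<le> t"
      have "X((l, 0) := t) \<in> space ?P" if "X \<in> space ?K" for X
        using that lR by (auto simp: space_PiM PiE_iff extensional_def)
      moreover have "race_shift R A l x \<in> space ?P" for x by (simp add: race_shift_def space_PiM)
      ultimately have "Pair t -` (?f -` ?E \<inter> space (exp_measure (\<rho> (l, 0)) \<Otimes>\<^sub>M ?K)) =
        {X \<in> space ?K. race_wins A l (X((l, 0) := t)) \<and> (\<forall>p\<in>J. race_shift R A l (X((l, 0) := t)) p \<in> F p)}"
        by (auto simp: space_pair_measure box sp)
      then show "emeasure ?K (Pair t -` (?f -` ?E \<inter> space (exp_measure (\<rho> (l, 0)) \<Otimes>\<^sub>M ?K))) =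
        ennreal (exp (- (\<Sum>i\<in>A - {l}. \<rho> (i, 0)) * t)) *
          (\<Prod>p\<in>J. emeasure (exp_measure (\<rho> (race_index l p))) (F p))"
        using race_section[OF J A \<rho> t] by simp
    qed
    also have "\<dots> = ?q * (\<Prod>p\<in>J. emeasure (exp_measure (\<rho> (race_index l p))) (F p))"
    proof -
      have "(\<integral>\<^sup>+t. ennreal (exp (- (\<Sum>i\<in>A - {l}. \<rho> (i, 0)) * t)) \<partial>exp_measure (\<rho> (l, 0))) = ?q"
        unfolding sum[symmetric] using \<rho> by (intro nn_integral_exp_exp_measure sum_nonneg) (auto intro: less_imp_le)
      then show ?thesis by (subst nn_integral_multc) auto
    qed
    also have "(\<Prod>p\<in>J. emeasure (exp_measure (\<rho> (race_index l p))) (F p)) = emeasure ?\<mu>' ?box"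
      unfolding box sp(2)[symmetric] using J by (intro \<mu>'.emeasure_PiM_Collect[symmetric]) auto
    finally show "emeasure (scale_measure ?q ?\<mu>') ?box = emeasure ?D ?box"
      using D[OF box_sets] by simp
  qed (auto simp: sets_exp_family)
  then show ?thesis using D[OF B] by (metis emeasure_scale_measure)
qed

text \<open>Every label carries clocks from the start, but only labels up to
  \<open>num_labels k n\<close> take part in the race that decides \<open>L n\<close>. The clocks of
  later labels are left alone, so a label joins with its full waiting times.\<close>

primrec residual :: "nat \<Rightarrow> (nat \<Rightarrow> nat) \<Rightarrow> nat \<Rightarrow> (nat \<times> nat \<Rightarrow> real) \<Rightarrow> nat \<times> nat \<Rightarrow> real" where
  "residual k L 0 x = x"
| "residual k L (Suc n) x = race_shift {1..} {1..num_labels k n} (L n) (residual k L n x)"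

definition race_path :: "nat \<Rightarrow> (nat \<Rightarrow> nat) \<Rightarrow> nat \<Rightarrow> (nat \<times> nat \<Rightarrow> real) \<Rightarrow> bool" where
  "race_path k L n x \<longleftrightarrow> (\<forall>j<n. race_wins {1..num_labels k j} (L j) (residual k L j x))"

text \<open>A process started at \<open>1\<close> that has jumped \<open>c i\<close> times is in
  state \<open>1 + c i\<close>; its pending waiting time number \<open>b\<close> is spent in state
  \<open>1 + c i + b\<close>.\<close>

definition birth_rate :: "real \<Rightarrow> (nat \<Rightarrow> nat) \<Rightarrow> nat \<times> nat \<Rightarrow> real" where
  "birth_rate \<delta> c p = 1 + real (c (fst p)) + real (snd p) + \<delta>"

lemma birth_rate_pos: "-1 < \<delta> \<Longrightarrow> 0 < birth_rate \<delta> c p"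
  by (simp add: birth_rate_def add_pos_nonneg)

text \<open>Moving on to the winner's next waiting time raises its rate by one, exactly as one more
  selection does. Hence the rates keep the form \<open>birth_rate\<close> after each race.\<close>

lemma birth_rate_race_index:
  "birth_rate \<delta> (label_count L n) (race_index (L n) p) = birth_rate \<delta> (label_count L (Suc n)) p"
  by (simp add: birth_rate_def race_index_def label_count_Suc)

abbreviation waiting_space :: "(nat \<times> nat \<Rightarrow> real) measure" where
  "waiting_space \<equiv> Pi\<^sub>M ({1..} \<times> UNIV) (\<lambda>_. borel)"

lemma measurable_residual:
  "valid_labels k n L \<Longrightarrow> residual k L n \<in> measurable waiting_space waiting_space"
proof (induction n)
  case 0
  have "residual k L 0 = (\<lambda>x. x)" by (simp add: fun_eq_iff)
  then show ?case by simp
next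
  case (Suc n)
  have "L n \<in> {1..}" using Suc.prems by (simp add: valid_labels_def)
  then have "race_shift {1..} {1..num_labels k n} (L n) \<in> measurable waiting_space waiting_space"
    by (intro measurable_race_shift) auto
  from measurable_compose[OF Suc.IH[OF valid_labels_mono[OF Suc.prems]] this]
  show ?case by simp
qed

lemma sets_race_path:
  assumes "valid_labels k n L"
  shows "{x \<in> space waiting_space. race_path k L n x} \<in> sets waiting_space"
proof -
  have "{x \<in> space waiting_space. race_wins {1..num_labels k j} (L j) (residual k L j x)} \<in> sets waiting_space"
    if "j < n" for j
  proof -
    have val: "valid_labels k j L" using valid_labels_mono[OF assms] that by simp
    let ?W = "{x \<in> space waiting_space. race_wins {1..num_labels k j} (L j) x}"
    have "?W \<in> sets waiting_space"
      using assms that by (intro sets_race_wins) (auto simp: valid_labels_def)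
    from measurable_sets[OF measurable_residual[OF val] this]
    have "residual k L j -` ?W \<inter> space waiting_space \<in> sets waiting_space" .
    also have "residual k L j -` ?W \<inter> space waiting_space =
        {x \<in> space waiting_space. race_wins {1..num_labels k j} (L j) (residual k L j x)}"
      using measurable_space[OF measurable_residual[OF val]] by auto
    finally show ?thesis .
  qed
  then have "{x \<in> space waiting_space. \<forall>j\<in>{..<n}. race_wins {1..num_labels k j} (L j) (residual k L j x)} \<in> sets waiting_space"
    by (intro sets.sets_Collect_finite_All) auto
  then show ?thesis unfolding race_path_def by (simp only: Ball_def lessThan_iff)
qed

text \<open>The next race is run on the residual times, so the induction must carry their law
  jointly with the past winners; the product form says that the two are independent.\<close>

lemma race_path_residual_law:
  assumes \<delta>: "-1 < \<delta>" and "valid_labels k n L" and "B \<in> sets waiting_space"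
  shows "emeasure (exp_family {1..} (birth_rate \<delta> (\<lambda>_. 0)))
      {x \<in> space waiting_space. race_path k L n x \<and> residual k L n x \<in> B} =
    ennreal (label_prob k \<delta> L n) * emeasure (exp_family {1..} (birth_rate \<delta> (label_count L n))) B"
  using assms(2,3)
proof (induction n arbitrary: B)
  case 0
  have "{x \<in> space waiting_space. race_path k L 0 x \<and> residual k L 0 x \<in> B} = B"
    using sets.sets_into_space[OF 0(2)] by (auto simp: race_path_def)
  moreover have "label_count L 0 = (\<lambda>_. 0)" by (simp add: fun_eq_iff)
  ultimately show ?case by (simp add: label_prob_def)
next
  case (Suc n)
  let ?\<rho> = "birth_rate \<delta> (label_count L n)" and ?A = "{1..num_labels k n}"
  let ?w = "(1 + real (label_count L n (L n)) + \<delta>) / (\<Sum>i\<in>{1..num_labels k n}. 1 + real (label_count L n i) + \<delta>)"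
  \<comment> \<open>\<open>?C\<close> is \<open>B\<close> pulled back through one race, together
    with the win of \<open>L n\<close>; the induction hypothesis is applied to it in place of
    \<open>B\<close>.\<close>
  let ?C = "{x \<in> space waiting_space. race_wins ?A (L n) x \<and> race_shift {1..} ?A (L n) x \<in> B}"
  have val: "valid_labels k n L" using Suc.prems(1) by (rule valid_labels_mono) simp
  have Ln: "L n \<in> ?A" using Suc.prems(1) by (simp add: valid_labels_def)
  have C: "?C \<in> sets waiting_space"
  proof -
    have "?C = {x \<in> space waiting_space. race_wins ?A (L n) x} \<inter> (race_shift {1..} ?A (L n) -` B \<inter> space waiting_space)"
      by auto
    then show ?thesis
      using sets.Int[OF sets_race_wins measurable_sets[OF measurable_race_shift Suc.prems(2)], of ?A "L n" ?A "L n"] Ln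
      by (simp only:) auto
  qed
  have split: "{x \<in> space waiting_space. race_path k L (Suc n) x \<and> residual k L (Suc n) x \<in> B} =
      {x \<in> space waiting_space. race_path k L n x \<and> residual k L n x \<in> ?C}"
    using measurable_space[OF measurable_residual[OF val]] by (auto simp: race_path_def less_Suc_eq)
  have step: "emeasure (exp_family {1..} ?\<rho>) ?C = ennreal ?w *
      emeasure (exp_family {1..} (birth_rate \<delta> (label_count L (Suc n)))) B"
    using race_step[of ?A "{1..}" "L n" ?\<rho> B, unfolded space_exp_family birth_rate_race_index]
      Ln Suc.prems(2) birth_rate_pos[OF \<delta>] by (simp add: birth_rate_def)
  have "0 \<le> ?w" using \<delta> by (intro divide_nonneg_nonneg sum_nonneg) auto
  moreover have "label_prob k \<delta> L (Suc n) = label_prob k \<delta> L n * ?w" by (simp add: label_prob_def)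
  ultimately have prob: "ennreal (label_prob k \<delta> L (Suc n)) = ennreal (label_prob k \<delta> L n) * ennreal ?w"
    by (simp only: ennreal_mult'')
  show ?case unfolding split Suc.IH[OF val C] step prob by (rule mult.assoc[symmetric])
qed

lemma race_path_prob:
  assumes "-1 < \<delta>" "valid_labels k n L"
  shows "emeasure (exp_family {1..} (birth_rate \<delta> (\<lambda>_. 0))) {x \<in> space waiting_space. race_path k L n x} =
    ennreal (label_prob k \<delta> L n)"
proof -
  have "prob_space (exp_family {1..} (birth_rate \<delta> (label_count L n)))"
    by (intro prob_space_PiM prob_space_exp_measure birth_rate_pos assms)
  then have "emeasure (exp_family {1..} (birth_rate \<delta> (label_count L n))) (space waiting_space) = 1"
    using prob_space.emeasure_space_1 by (metis space_exp_family)
  moreover have "{x \<in> space waiting_space. race_path k L n x \<and> residual k L n x \<in> space waiting_space} =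
      {x \<in> space waiting_space. race_path k L n x}"
    using measurable_space[OF measurable_residual[OF assms(2)]] by auto
  ultimately show ?thesis using race_path_residual_law[OF assms sets.top] by simp
qed

section \<open>The birth processes as a race\<close>

lemma next_jump_ge: "s \<le> next_jump f s"
proof (cases "\<exists>t>s. f t \<noteq> f s")
  case True
  then show ?thesis unfolding next_jump_def if_P[OF True] by (intro cInf_greatest) auto
next
  case False
  then show ?thesis unfolding next_jump_def if_not_P[OF False] by simp
qed

lemma next_jump_constant: "s \<le> t \<Longrightarrow> t < next_jump f s \<Longrightarrow> f t = f s"
proof (rule ccontr)
  assume t: "s \<le> t" "t < next_jump f s" and neq: "f t \<noteq> f s"
  then have "s < t" by (cases "s = t") auto
  then have "next_jump f s \<le> t"
    using neq unfolding next_jump_def by (auto intro!: cInf_lower bdd_belowI[of _ s])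
  then show False using t by simp
qed

lemma next_jump_eqI:
  assumes "s < u" "f u \<noteq> f s" "\<And>t. s < t \<Longrightarrow> t < u \<Longrightarrow> f t = f s"
  shows "next_jump f s = u"
proof -
  have "Inf {t. s < t \<and> f t \<noteq> f s} = u"
    using assms by (intro cInf_eq_minimum) (auto simp: not_less[symmetric])
  then show ?thesis using assms unfolding next_jump_def by auto
qed

text \<open>The pathwise form of the almost sure condition on a birth process started at
  \<open>1\<close>. It excludes the default value of \<open>next_jump\<close>: the values at
  consecutive jump times differ, so every jump exists and the jump times increase strictly.\<close>

definition unit_jumps :: "(real \<Rightarrow> nat) \<Rightarrow> bool" where
  "unit_jumps f \<longleftrightarrow> (\<forall>a. f (jump_time f a) = 1 + a)"

lemma unit_jumps_less: "unit_jumps f \<Longrightarrow> jump_time f a < jump_time f (Suc a)"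
proof -
  assume "unit_jumps f"
  then have "f (jump_time f a) \<noteq> f (jump_time f (Suc a))" by (simp add: unit_jumps_def del: jump_time.simps)
  then have "jump_time f a \<noteq> jump_time f (Suc a)" by metis
  then show ?thesis using next_jump_ge[of "jump_time f a" f] by simp
qed

lemma unit_jumps_value:
  assumes "unit_jumps f" "jump_time f a \<le> t" "t < jump_time f (Suc a)"
  shows "f t = 1 + a"
  using next_jump_constant[of "jump_time f a" t f] assms by (simp add: unit_jumps_def)

lemma unit_jumps_nonneg: "unit_jumps f \<Longrightarrow> 0 \<le> jump_time f a"
proof (induction a)
  case (Suc a)
  then show ?case using unit_jumps_less[of f a] by linarith
qed simp

lemma unit_jumps_before:
  assumes "unit_jumps f" "0 \<le> t" "t < jump_time f a"
  shows "f t < 1 + a"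
  using assms(3)
proof (induction a)
  case 0
  then show ?case using assms(2) by simp
next
  case (Suc a)
  show ?case
  proof (cases "t < jump_time f a")
    case True
    then show ?thesis using Suc.IH by simp
  next
    case False
    then show ?thesis using unit_jumps_value[OF assms(1), of a t] Suc.prems by simp
  qed
qed

definition waiting_times :: "(nat \<Rightarrow> real \<Rightarrow> nat) \<Rightarrow> nat \<times> nat \<Rightarrow> real" where
  "waiting_times X = (\<lambda>p\<in>{1..} \<times> UNIV. holding_time (X (fst p)) (snd p))"

definition bi_label :: "nat \<Rightarrow> (nat \<Rightarrow> real \<Rightarrow> nat) \<Rightarrow> nat \<Rightarrow> nat" where
  "bi_label k X n = event_label k X (Suc n)"

lemma bi_enum_eq_lab_enum: "bi_enum k X n = lab_enum k (bi_label k X) n"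
  by (induction n) (simp_all add: bi_label_def)

lemma birth_index_new:
  assumes "num_labels k n < i" "i \<le> num_labels k (Suc n)"
  shows "birth_index k i = Suc n"
proof -
  define r where "r = i - num_labels k n - 1"
  have "i - 2 = Suc n * (k + 1) + r" "r < k + 1"
    using assms by (simp_all add: r_def num_labels_def)
  then show ?thesis
    unfolding birth_index_def using div_mult_self3[of "k + 1" "Suc n" r] by (simp only: div_less)
qed

lemma label_count_new:
  assumes "valid_labels k n L" "num_labels k n < i"
  shows "label_count L n i = 0"
proof -
  have "L j \<noteq> i" if "j < n" for j
  proof -
    have "L j \<le> num_labels k j" using assms(1) that by (auto simp: valid_labels_def)
    also have "\<dots> \<le> num_labels k n" using that by (intro num_labels_mono) auto
    finally show ?thesis using assms(2) by auto
  qed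
  then show ?thesis by (auto simp: label_count_def)
qed

text \<open>The invariant linking races to real time. At event \<open>n\<close> each existing
  process is between the jump numbered by its selection count and the next one, and its residual is
  the time left until that next jump; all other entries are untouched holding times. As wins are
  strict, only the winner jumps at the next event.\<close>

lemma race_path_events:
  assumes X: "\<And>i. 1 \<le> i \<Longrightarrow> unit_jumps (X i)"
    and "valid_labels k n L" "race_path k L n (waiting_times X)"
  shows "(\<forall>j<n. bi_label k X j = L j) \<and>
    (\<forall>i\<in>{1..num_labels k n}.
       jump_time (X i) (label_count L n i) \<le> event_time k X n - event_time k X (birth_index k i) \<and>
       event_time k X n - event_time k X (birth_index k i) < jump_time (X i) (Suc (label_count L n i)) \<and>
       residual k L n (waiting_times X) (i, 0) =
         event_time k X (birth_index k i) + jump_time (X i) (Suc (label_count L n i)) - event_time k X n) \<and>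
    (\<forall>i\<ge>1. \<forall>b. 0 < b \<or> num_labels k n < i \<longrightarrow>
       residual k L n (waiting_times X) (i, b) = holding_time (X i) (label_count L n i + b))"
  using assms(2,3)
proof (induction n)
  case 0
  have "event_time k X (birth_index k i) = 0" if "i \<in> {1..num_labels k 0}" for i
    using birth_index_le[of i k 0] that by simp
  moreover have "0 < jump_time (X i) (Suc 0)" if "1 \<le> i" for i
    using unit_jumps_less[OF X[OF that], of 0] by simp
  ultimately show ?case
    by (auto simp: waiting_times_def holding_time_def simp del: jump_time.simps(2))
next
  case (Suc n)
  let ?T = "event_time k X" and ?h = "residual k L n (waiting_times X)"
    and ?h' = "residual k L (Suc n) (waiting_times X)" and ?c = "label_count L n"
  let ?B = "\<lambda>i. ?T (birth_index k i)" and ?J = "\<lambda>i. jump_time (X i)"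
  define l where "l = L n"
  have val: "valid_labels k n L" using Suc.prems(1) by (rule valid_labels_mono) simp
  have l: "l \<in> {1..num_labels k n}" using Suc.prems(1) by (simp add: valid_labels_def l_def)
  have "race_path k L n (waiting_times X)" and wins: "race_wins {1..num_labels k n} l ?h"
    using Suc.prems(2) by (auto simp: race_path_def l_def)
  with Suc.IH[OF val]
  have lab: "\<And>j. j < n \<Longrightarrow> bi_label k X j = L j"
    and lo: "\<And>i. i \<in> {1..num_labels k n} \<Longrightarrow> ?J i (?c i) \<le> ?T n - ?B i"
    and hi: "\<And>i. i \<in> {1..num_labels k n} \<Longrightarrow> ?T n - ?B i < ?J i (Suc (?c i))"
    and res: "\<And>i. i \<in> {1..num_labels k n} \<Longrightarrow> ?h (i, 0) = ?B i + ?J i (Suc (?c i)) - ?T n"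
    and later: "\<And>i b. 1 \<le> i \<Longrightarrow> 0 < b \<or> num_labels k n < i \<Longrightarrow> ?h (i, b) = holding_time (X i) (?c i + b)"
    by blast+
  define u where "u = ?T n + ?h (l, 0)"
  have u_l: "u = ?B l + ?J l (Suc (?c l))" using res[OF l] by (simp add: u_def)
  have u_gt: "?T n < u" using hi[OF l] u_l by simp
  have u_other: "u < ?B i + ?J i (Suc (?c i))" if "i \<in> {1..num_labels k n}" "i \<noteq> l" for i
  proof -
    have "?h (l, 0) < ?h (i, 0)" using wins that unfolding race_wins_def by blast
    then show ?thesis using res[OF that(1)] unfolding u_def by linarith
  qed
  \<comment> \<open>Nobody moves before \<open>u\<close>, and at \<open>u\<close> nobody except
    \<open>l\<close>; the last condition on \<open>t\<close> and \<open>i\<close> covers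
    both.\<close>
  have const: "X i (t - ?B i) = 1 + ?c i"
    if "i \<in> {1..num_labels k n}" "?T n \<le> t" "t \<le> u" "t < u \<or> i \<noteq> l" for i t
  proof (rule unit_jumps_value)
    show "unit_jumps (X i)" using X that by auto
    show "?J i (?c i) \<le> t - ?B i" using lo[OF that(1)] that by simp
    show "t - ?B i < ?J i (Suc (?c i))"
      using that u_l u_other[OF that(1)] by (cases "i = l") (auto simp del: jump_time.simps)
  qed
  have jump: "X l (u - ?B l) = 2 + ?c l"
  proof -
    have "X l (?J l (Suc (?c l))) = 1 + Suc (?c l)" using X[of l] l unfolding unit_jumps_def by (auto simp del: jump_time.simps)
    then show ?thesis by (simp add: u_l del: jump_time.simps)
  qed
  have T: "?T (Suc n) = u"
    unfolding event_time.simps(2)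
  proof (rule next_jump_eqI[OF u_gt])
    let ?F = "\<lambda>t i. if 1 \<le> i \<and> i \<le> num_labels k n then X i (t - ?B i) else 0"
    have "?F u l \<noteq> ?F (?T n) l"
      using l jump const[OF l, of "?T n"] u_gt by simp
    then show "?F u \<noteq> ?F (?T n)" by metis
    fix t assume t: "?T n < t" "t < u"
    show "?F t = ?F (?T n)"
      using const[of _ t] const[of _ "?T n"] t by (auto simp: fun_eq_iff)
  qed
  have "bi_label k X n = l"
    unfolding bi_label_def event_label_def T
  proof (rule Least_equality)
    show "1 \<le> l \<and> l \<le> 1 + Suc n * (k + 1) \<and> X l (u - ?B l) \<noteq> X l (?T (Suc n - 1) - ?B l)"
      using l jump const[OF l, of "?T n"] u_gt by (simp add: num_labels_def)
    fix i assume i: "1 \<le> i \<and> i \<le> 1 + Suc n * (k + 1) \<and> X i (u - ?B i) \<noteq> X i (?T (Suc n - 1) - ?B i)"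
    then have "i \<in> {1..num_labels k n}" by (simp add: num_labels_def)
    with i const[of i u] const[of i "?T n"] u_gt have "i = l" by auto
    then show "l \<le> i" by simp
  qed
  moreover have "?J i (label_count L (Suc n) i) \<le> ?T (Suc n) - ?B i \<and>
       ?T (Suc n) - ?B i < ?J i (Suc (label_count L (Suc n) i)) \<and>
       ?h' (i, 0) = ?B i + ?J i (Suc (label_count L (Suc n) i)) - ?T (Suc n)"
    if i: "i \<in> {1..num_labels k (Suc n)}" for i
  proof -
    have Xi: "unit_jumps (X i)" using X i by auto
    consider "i = l" | "i \<le> num_labels k n" "i \<noteq> l" | "num_labels k n < i" by linarith
    then show ?thesis
    proof cases
      case 1
      have c: "label_count L (Suc n) l = Suc (?c l)" using 1 by (simp add: label_count_Suc l_def)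
      \<comment> \<open>The used waiting time of the winner is replaced by its next one, which is
        still a complete holding time.\<close>
      have "?h' (i, 0) = ?h (l, 1)" using l by (simp add: race_shift_def race_index_def 1 l_def)
      also have "\<dots> = ?J l (Suc (Suc (?c l))) - ?J l (Suc (?c l))"
        using later[of l 1] l by (simp add: holding_time_def del: jump_time.simps)
      finally have "?h' (i, 0) = ?J l (Suc (Suc (?c l))) - ?J l (Suc (?c l))" .
      then show ?thesis
        using unit_jumps_less[OF Xi, of "Suc (?c l)"] unfolding c T u_l 1
        by (simp del: jump_time.simps residual.simps)
    next
      case 2
      then have i': "i \<in> {1..num_labels k n}" using i by auto
      have c: "label_count L (Suc n) i = ?c i" using 2 by (simp add: label_count_Suc l_def)
      have "?h' (i, 0) = ?h (i, 0) - ?h (l, 0)"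
        using 2 i l by (simp add: race_shift_def race_index_def l_def)
      then show ?thesis
        unfolding c T using lo[OF i'] u_gt u_other[OF i' 2(2)] res[OF i']
        by (simp add: u_def del: jump_time.simps residual.simps)
    next
      case 3
      \<comment> \<open>The label is born at this very event, so its age is zero and its whole first
        waiting time lies ahead.\<close>
      have b: "birth_index k i = Suc n" using birth_index_new[OF 3] i by simp
      have c: "label_count L (Suc n) i = 0" "?c i = 0"
        using label_count_new[OF val 3] 3 l by (auto simp: label_count_Suc l_def)
      have "?h' (i, 0) = ?h (i, 0)" using 3 i l by (simp add: race_shift_def race_index_def l_def)
      also have "\<dots> = ?J i (Suc 0)" using later[of i 0] 3 i c by (simp add: holding_time_def)
      finally show ?thesis
        unfolding b c using unit_jumps_less[OF Xi, of 0] by (simp del: jump_time.simps(2) residual.simps)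
    qed
  qed
  moreover have "?h' (i, b) = holding_time (X i) (label_count L (Suc n) i + b)"
    if i: "1 \<le> i" "0 < b \<or> num_labels k (Suc n) < i" for i b
  proof (cases "i = l")
    case True
    then have "0 < b" using that l num_labels_mono[of n "Suc n" k] by auto
    have "?h' (i, b) = ?h (l, Suc b)"
      using l \<open>0 < b\<close> by (simp add: race_shift_def race_index_def True l_def)
    then show ?thesis using later[of l "Suc b"] l True by (simp add: label_count_Suc l_def)
  next
    case False
    have "0 < b \<or> num_labels k n < i" using that num_labels_mono[of n "Suc n" k] by auto
    moreover from this have "?h' (i, b) = ?h (i, b)"
      using i False by (auto simp: race_shift_def race_index_def l_def)
    ultimately show ?thesis using later[of i b] i False by (simp add: label_count_Suc l_def)
  qed
  ultimately show ?case using lab unfolding l_def by (auto simp: less_Suc_eq simp del: jump_time.simps event_time.simps residual.simps)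
qed

lemma race_path_values:
  assumes "\<And>i. 1 \<le> i \<Longrightarrow> unit_jumps (X i)" "valid_labels k n L" "race_path k L n (waiting_times X)"
    and "i \<in> {1..num_labels k n}"
  shows "X i (event_time k X n - event_time k X (birth_index k i)) = 1 + label_count L n i"
  using race_path_events[OF assms(1-3)] assms(1)[of i] assms(4)
  by (intro unit_jumps_value) (auto simp del: jump_time.simps)

text \<open>Along a race path each process has the value \<open>1 + label_count L n i\<close>, so
  the double counting applies. \<open>L\<close> and \<open>bi_label k X\<close> are known to agree
  only below \<open>n\<close>, which is all that time \<open>n\<close> reads.\<close>

lemma bi_degree_vector_eq:
  assumes X: "\<And>i. 1 \<le> i \<Longrightarrow> unit_jumps (X i)" and L: "valid_labels k n L"
    and path: "race_path k L n (waiting_times X)"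
  shows "bi_degree_vector k X n = lab_degrees k (bi_label k X) n"
proof -
  have lab: "bi_label k X j = L j" if "j < n" for j using race_path_events[OF X L path] that by blast
  have enum: "bi_enum k X n = lab_enum k L n"
    unfolding bi_enum_eq_lab_enum by (rule lab_enum_cong) (rule lab)
  have enum': "lab_enum k (bi_label k X) n = lab_enum k L n" by (rule lab_enum_cong) (rule lab)
  have facet: "lab_facet k (bi_label k X) i = lab_facet k L i" if "i \<le> n" for i
    by (rule lab_facet_cong) (use lab that in auto)
  show ?thesis
    unfolding bi_degree_vector_def lab_degrees_def enum enum'
  proof (intro restrict_ext if_cong refl)
    fix j m assume "j \<in> {1..}" "m \<in> {..k}" "j \<le> num_labels k n"
    then have j: "j \<in> {1..num_labels k n}" and m: "m \<le> k" by auto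
    let ?A = "top_face k m (lab_enum k L n j)"
    let ?S = "{i. i \<in> {1..num_labels k n} \<and> ?A \<subseteq> lab_enum k L n i}"
    have "(\<Sum>i\<in>?S. real (X i (event_time k X n - event_time k X (birth_index k i)))) =
        (\<Sum>i\<in>?S. real (1 + label_count L n i))"
      by (intro sum.cong refl arg_cong[where f = real] race_path_values[OF X L path]) auto
    also have "\<dots> = real (\<Sum>i\<in>?S. 1 + label_count L n i)" by (rule of_nat_sum[symmetric])
    also have "\<dots> = real (k - m + 1) * real (card {i. i \<le> n \<and> ?A \<subseteq> lab_facet k L i})"
      unfolding sum_label_count_containing[OF L top_face_lab_enum(1)[OF L j m] m] by (rule of_nat_mult)
    finally have "1 / real (k - m + 1) *
        (\<Sum>i\<in>?S. real (X i (event_time k X n - event_time k X (birth_index k i)))) =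
        real (card {i. i \<le> n \<and> ?A \<subseteq> lab_facet k L i})"
      by simp
    moreover have "{i. i \<le> n \<and> ?A \<subseteq> lab_facet k L i} = {i. i \<le> n \<and> ?A \<subseteq> lab_facet k (bi_label k X) i}"
      using facet by auto
    ultimately show "real (k - m) + 1 / real (k - m + 1) *
        (\<Sum>i\<in>?S. real (X i (event_time k X n - event_time k X (birth_index k i)))) =
        real (k - m) + real (card {i. i \<le> n \<and> ?A \<subseteq> lab_facet k (bi_label k X) i})"
      by simp
  qed
qed

section \<open>The law of the waiting times\<close>

text \<open>The jump times of a path with unit jumps, recovered from its values at the rational times only;
  unlike \<open>jump_time\<close> this is measurable on the product space of all paths.\<close>

definition hitting_time :: "(real \<Rightarrow> nat) \<Rightarrow> nat \<Rightarrow> real" where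
  "hitting_time f a = real_of_ereal (INF q\<in>\<rat> \<inter> {0..}. if 1 + a \<le> f q then ereal q else \<infinity>)"

lemma countable_nonneg_rationals: "countable (\<rat> \<inter> {0..} :: real set)"
  by (intro countable_Int1 countable_rat)

text \<open>Rational times shortly after jump \<open>a\<close> show the value \<open>1 + a\<close>
  and all earlier times a smaller one. So the infimum is the jump time even when this is
  irrational.\<close>

lemma hitting_time_eq:
  assumes "unit_jumps f"
  shows "hitting_time f a = jump_time f a"
proof -
  let ?J = "jump_time f"
  let ?I = "INF q\<in>\<rat> \<inter> {0..}. if 1 + a \<le> f q then ereal q else \<infinity>"
  have "?I = ereal (?J a)"
  proof (rule antisym)
    show "ereal (?J a) \<le> ?I"
      using unit_jumps_before[OF assms, of _ a] by (intro INF_greatest) (auto simp: not_less[symmetric])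
    show "?I \<le> ereal (?J a)"
    proof (rule ereal_le_epsilon2)
      fix e :: real assume "0 < e"
      then have "?J a < min (?J a + e) (?J (Suc a))"
        using unit_jumps_less[OF assms, of a] by simp
      then obtain q where q: "q \<in> \<rat>" "?J a < q" "q < min (?J a + e) (?J (Suc a))"
        using Rats_dense_in_real by blast
      have "f q = 1 + a" using unit_jumps_value[OF assms, of a q] q by simp
      moreover have "0 \<le> q" using unit_jumps_nonneg[OF assms, of a] q by simp
      ultimately have "?I \<le> ereal q" using q by (intro INF_lower2[of q]) auto
      also have "\<dots> \<le> ereal (?J a) + ereal e" using q by simp
      finally show "?I \<le> ereal (?J a) + ereal e" .
    qed
  qed
  then show ?thesis by (simp add: hitting_time_def)
qed

text \<open>Lets the waiting times be computed from the restricted paths, for which independence is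
  assumed.\<close>

lemma hitting_time_restrict: "hitting_time (restrict f {0..}) a = hitting_time f a"
  unfolding hitting_time_def by (intro arg_cong[where f = real_of_ereal] INF_cong) auto

lemma measurable_hitting_time:
  "(\<lambda>f. hitting_time f a) \<in> borel_measurable (Pi\<^sub>M {0..} (\<lambda>_. count_space UNIV))"
proof -
  have "(\<lambda>f. INF q\<in>\<rat> \<inter> {0..}. if 1 + a \<le> f q then ereal q else \<infinity>) \<in>
      borel_measurable (Pi\<^sub>M {0..} (\<lambda>_. count_space UNIV :: nat measure))"
  proof (rule borel_measurable_INF[OF countable_nonneg_rationals])
    fix q :: real assume "q \<in> \<rat> \<inter> {0..}"
    then have [measurable]: "(\<lambda>f. f q) \<in> measurable (Pi\<^sub>M {0..} (\<lambda>_. count_space UNIV :: nat measure)) (count_space UNIV)"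
      by (intro measurable_component_singleton) auto
    show "(\<lambda>f. if 1 + a \<le> f q then ereal q else \<infinity>) \<in> borel_measurable (Pi\<^sub>M {0..} (\<lambda>_. count_space UNIV :: nat measure))"
      by measurable
  qed
  then show ?thesis unfolding hitting_time_def by measurable
qed

definition path_waiting_times :: "(real \<Rightarrow> nat) \<Rightarrow> nat \<Rightarrow> real" where
  "path_waiting_times f b = hitting_time f (Suc b) - hitting_time f b"

lemma path_waiting_times_eq: "unit_jumps f \<Longrightarrow> path_waiting_times f b = holding_time f b"
  by (simp add: path_waiting_times_def holding_time_def hitting_time_eq del: jump_time.simps)

lemma measurable_path_waiting_times:
  "path_waiting_times \<in> measurable (Pi\<^sub>M {0..} (\<lambda>_. count_space UNIV)) (Pi\<^sub>M UNIV (\<lambda>_. borel))"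
proof -
  note measurable_hitting_time[measurable]
  show ?thesis
    unfolding path_waiting_times_def[abs_def] by (intro measurable_PiM_single') auto
qed

text \<open>Independence of the labels gives a product over rows and independence within a path a
  product inside each row, while the race uses one product over pairs. A finite box over pairs
  splits into boxes over finitely many rows, and the measures multiply.\<close>

lemma distr_uncurry_PiM:
  fixes E :: "'i \<times> 'j \<Rightarrow> real measure"
  assumes E: "\<And>p. prob_space (E p)" and bor: "\<And>p. sets (E p) = sets borel"
  shows "distr (Pi\<^sub>M R (\<lambda>i. Pi\<^sub>M UNIV (\<lambda>b. E (i, b)))) (Pi\<^sub>M (R \<times> UNIV) (\<lambda>_. borel))
           (\<lambda>z. \<lambda>p\<in>R \<times> UNIV. z (fst p) (snd p)) = Pi\<^sub>M (R \<times> UNIV) E"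
proof -
  let ?Q = "Pi\<^sub>M R (\<lambda>i. Pi\<^sub>M UNIV (\<lambda>b. E (i, b)))" and ?f = "\<lambda>z. \<lambda>p\<in>R \<times> UNIV. z (fst p) (snd p)"
  let ?P = "Pi\<^sub>M (R \<times> UNIV) (\<lambda>_. borel) :: ('i \<times> 'j \<Rightarrow> real) measure"
  interpret E: prob_space "E p" for p by (rule E)
  interpret row: product_prob_space "\<lambda>b. E (i, b)" UNIV for i by unfold_locales
  interpret Q: product_prob_space "\<lambda>i. Pi\<^sub>M UNIV (\<lambda>b. E (i, b))" R by unfold_locales
  interpret F: product_prob_space E "R \<times> UNIV" by unfold_locales
  have spE [simp]: "space (E p) = UNIV" for p using sets_eq_imp_space_eq[OF bor[of p]] by simp
  have [measurable_cong]: "sets (E p) = sets borel" for p by (rule bor)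
  have coord: "(\<lambda>z. z (fst p) (snd p)) \<in> borel_measurable ?Q" if "p \<in> R \<times> UNIV" for p
  proof -
    have "(\<lambda>z. z (fst p)) \<in> measurable ?Q (Pi\<^sub>M UNIV (\<lambda>b. E (fst p, b)))"
      using that by (intro measurable_component_singleton) auto
    moreover have "(\<lambda>y. y (snd p)) \<in> measurable (Pi\<^sub>M UNIV (\<lambda>b. E (fst p, b))) borel"
      by measurable
    ultimately show ?thesis by (rule measurable_compose)
  qed
  have f: "?f \<in> measurable ?Q ?P" by (rule measurable_restrict) (rule coord)
  have "Pi\<^sub>M (R \<times> UNIV) E = distr ?Q ?P ?f"
  proof (rule measure_eqI_PiM_infinite[where I = "R \<times> UNIV" and M = "\<lambda>_. borel"])
    show "finite_measure (Pi\<^sub>M (R \<times> UNIV) E)" by unfold_locales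
    show "sets (Pi\<^sub>M (R \<times> UNIV) E) = sets ?P" by (intro sets_PiM_cong) (auto simp: bor)
    fix A and J :: "('i \<times> 'j) set"
    assume J: "finite J" "J \<subseteq> R \<times> UNIV" "\<And>p. p \<in> J \<Longrightarrow> A p \<in> sets (borel :: real measure)"
    let ?box = "prod_emb (R \<times> UNIV) (\<lambda>_. borel) J (Pi\<^sub>E J A) :: ('i \<times> 'j \<Rightarrow> real) set"
    have box: "?box = {x \<in> space ?P. \<forall>p\<in>J. x p \<in> A p}"
      using J by (auto simp: prod_emb_def space_PiM PiE_iff extensional_def)
    have box_sets: "?box \<in> sets ?P" by (rule sets_PiM_I) (use J in auto)
    define Ji where "Ji i = {b. (i, b) \<in> J}" for i
    have finJi: "finite (Ji i)" for i
    proof -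
      have "Ji i \<subseteq> snd ` J" by (force simp: Ji_def)
      then show ?thesis using J finite_subset by blast
    qed
    have J_eq: "J = Sigma (fst ` J) Ji" by (force simp: Ji_def)
    define C where "C i = {y \<in> space (Pi\<^sub>M UNIV (\<lambda>b. E (i, b))). \<forall>b\<in>Ji i. y b \<in> A (i, b)}" for i
    have C: "C i \<in> sets (Pi\<^sub>M UNIV (\<lambda>b. E (i, b)))" for i
    proof -
      have "C i = prod_emb UNIV (\<lambda>b. E (i, b)) (Ji i) (Pi\<^sub>E (Ji i) (\<lambda>b. A (i, b)))"
        by (auto simp: C_def prod_emb_def space_PiM PiE_iff)
      also have "\<dots> \<in> sets (Pi\<^sub>M UNIV (\<lambda>b. E (i, b)))"
        by (rule sets_PiM_I) (use J finJi in \<open>auto simp: Ji_def bor\<close>)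
      finally show ?thesis .
    qed
    have "?f -` ?box \<inter> space ?Q = {z \<in> space ?Q. \<forall>i\<in>fst ` J. z i \<in> C i}"
    proof (intro set_eqI iffI)
      fix z assume z: "z \<in> ?f -` ?box \<inter> space ?Q"
      have "z i b \<in> A (i, b)" if "(i, b) \<in> J" for i b
      proof -
        have "?f z (i, b) \<in> A (i, b)" using z that unfolding box vimage_def by blast
        then show ?thesis using that J(2) by auto
      qed
      then show "z \<in> {z \<in> space ?Q. \<forall>i\<in>fst ` J. z i \<in> C i}"
        using z by (auto simp: C_def Ji_def space_PiM)
    next
      fix z assume z: "z \<in> {z \<in> space ?Q. \<forall>i\<in>fst ` J. z i \<in> C i}"
      have "?f z p \<in> A p" if "p \<in> J" for p
        using z that J(2) by (cases p) (force simp: C_def Ji_def)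
      then show "z \<in> ?f -` ?box \<inter> space ?Q" using z unfolding box by (auto simp: space_PiM)
    qed
    then have "emeasure (distr ?Q ?P ?f) ?box = emeasure ?Q {z \<in> space ?Q. \<forall>i\<in>fst ` J. z i \<in> C i}"
      using emeasure_distr[OF f box_sets] by simp
    also have "\<dots> = (\<Prod>i\<in>fst ` J. emeasure (Pi\<^sub>M UNIV (\<lambda>b. E (i, b))) (C i))"
      using J C by (intro Q.emeasure_PiM_Collect) auto
    also have "\<dots> = (\<Prod>i\<in>fst ` J. \<Prod>b\<in>Ji i. emeasure (E (i, b)) (A (i, b)))"
      unfolding C_def using J finJi by (intro prod.cong refl row.emeasure_PiM_Collect) (auto simp: Ji_def bor)
    also have "\<dots> = (\<Prod>p\<in>Sigma (fst ` J) Ji. emeasure (E p) (A p))"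
      using J finJi by (subst prod.Sigma) (auto simp: split_beta)
    also have "\<dots> = (\<Prod>p\<in>J. emeasure (E p) (A p))"
      using J_eq by simp
    also have "\<dots> = emeasure (Pi\<^sub>M (R \<times> UNIV) E) {x \<in> space (Pi\<^sub>M (R \<times> UNIV) E). \<forall>p\<in>J. x p \<in> A p}"
      using J by (intro F.emeasure_PiM_Collect[symmetric]) (auto simp: bor)
    also have "{x \<in> space (Pi\<^sub>M (R \<times> UNIV) E). \<forall>p\<in>J. x p \<in> A p} = ?box"
      unfolding box by (simp add: space_PiM)
    finally show "emeasure (Pi\<^sub>M (R \<times> UNIV) E) ?box = emeasure (distr ?Q ?P ?f) ?box" ..
  qed auto
  then show ?thesis ..
qed

lemma birth_immigration_unit_jumps:
  assumes "birth_immigration N \<delta> X"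
  shows "AE \<omega> in N. unit_jumps (\<lambda>t. X t \<omega>)"
  using assms unfolding birth_immigration_def pure_birth_chain_def unit_jumps_def by blast

lemma birth_immigration_measurable_path:
  assumes "birth_immigration N \<delta> X"
  shows "(\<lambda>\<omega>. \<lambda>t\<in>{0..}. X t \<omega>) \<in> measurable N (Pi\<^sub>M {0..} (\<lambda>_. count_space UNIV))"
  using assms unfolding birth_immigration_def pure_birth_chain_def by (intro measurable_restrict) auto

text \<open>The recovered waiting times agree almost surely with the holding times and so inherit
  their law, a product of exponentials by the definition of the chain.\<close>

lemma birth_immigration_waiting_law:
  assumes N: "prob_space N" and X: "birth_immigration N \<delta> X"
  shows "(\<lambda>\<omega>. path_waiting_times (\<lambda>t\<in>{0..}. X t \<omega>)) \<in> measurable N (Pi\<^sub>M UNIV (\<lambda>_. borel))"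
    and "distr N (Pi\<^sub>M UNIV (\<lambda>_. borel)) (\<lambda>\<omega>. path_waiting_times (\<lambda>t\<in>{0..}. X t \<omega>)) =
      Pi\<^sub>M UNIV (\<lambda>b. exp_measure (1 + real b + \<delta>))"
proof -
  interpret prob_space N by fact
  let ?P = "Pi\<^sub>M UNIV (\<lambda>_. borel) :: (nat \<Rightarrow> real) measure"
  let ?H = "\<lambda>b \<omega>. holding_time (\<lambda>t. X t \<omega>) b"
  have ind: "indep_vars (\<lambda>_. borel) ?H UNIV"
    and dis: "\<And>b. distributed N lborel (?H b) (exponential_density (1 + real b + \<delta>))"
    using X by (auto simp: birth_immigration_def pure_birth_chain_def)
  have H: "?H b \<in> borel_measurable N" for b
    using distributed_measurable[OF dis[of b]] by simp
  show meas: "(\<lambda>\<omega>. path_waiting_times (\<lambda>t\<in>{0..}. X t \<omega>)) \<in> measurable N ?P"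
    by (rule measurable_compose[OF birth_immigration_measurable_path[OF X] measurable_path_waiting_times])
  have "distr N ?P (\<lambda>\<omega>. path_waiting_times (\<lambda>t\<in>{0..}. X t \<omega>)) = distr N ?P (\<lambda>\<omega>. \<lambda>b\<in>UNIV. ?H b \<omega>)"
  proof (rule distr_cong_AE)
    show "AE \<omega> in N. path_waiting_times (\<lambda>t\<in>{0..}. X t \<omega>) = (\<lambda>b\<in>UNIV. ?H b \<omega>)"
      using birth_immigration_unit_jumps[OF X]
    proof eventually_elim
      case (elim \<omega>)
      show ?case
        using path_waiting_times_eq[OF elim]
        by (simp add: fun_eq_iff path_waiting_times_def hitting_time_restrict)
    qed
    show "(\<lambda>\<omega>. \<lambda>b\<in>UNIV. ?H b \<omega>) \<in> measurable N ?P" using H by (intro measurable_restrict) auto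
  qed (use meas in auto)
  also have "\<dots> = Pi\<^sub>M UNIV (\<lambda>b. distr N borel (?H b))"
    using ind H by (subst indep_vars_iff_distr_eq_PiM[symmetric]) auto
  also have "\<dots> = Pi\<^sub>M UNIV (\<lambda>b. exp_measure (1 + real b + \<delta>))"
  proof (rule PiM_cong)
    fix b
    have "distr N borel (?H b) = distr N lborel (?H b)" by (rule distr_cong) auto
    also have "\<dots> = exp_measure (1 + real b + \<delta>)"
      unfolding exp_measure_def by (rule distributed_distr_eq_density[OF dis])
    finally show "distr N borel (?H b) = exp_measure (1 + real b + \<delta>)" .
  qed simp
  finally show "distr N ?P (\<lambda>\<omega>. path_waiting_times (\<lambda>t\<in>{0..}. X t \<omega>)) =
      Pi\<^sub>M UNIV (\<lambda>b. exp_measure (1 + real b + \<delta>))" .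
qed

text \<open>Equals \<open>waiting_times\<close> on paths with unit jumps, but is a measurable
  function of the restricted paths; probabilities of races are computed with this version.\<close>

definition waiting_version :: "(nat \<Rightarrow> real \<Rightarrow> 'b \<Rightarrow> nat) \<Rightarrow> 'b \<Rightarrow> nat \<times> nat \<Rightarrow> real" where
  "waiting_version BI \<omega> = (\<lambda>p\<in>{1..} \<times> UNIV. path_waiting_times (\<lambda>t\<in>{0..}. BI (fst p) t \<omega>) (snd p))"

lemma waiting_version_eq:
  assumes "\<And>i. 1 \<le> i \<Longrightarrow> unit_jumps (\<lambda>t. BI i t \<omega>)"
  shows "waiting_version BI \<omega> = waiting_times (\<lambda>i t. BI i t \<omega>)"
  unfolding waiting_version_def waiting_times_def
proof (rule restrict_ext)
  fix p :: "nat \<times> nat" assume "p \<in> {1..} \<times> UNIV"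
  then have "unit_jumps (\<lambda>t. BI (fst p) t \<omega>)" using assms by auto
  from path_waiting_times_eq[OF this]
  show "path_waiting_times (\<lambda>t\<in>{0..}. BI (fst p) t \<omega>) (snd p) = holding_time (\<lambda>t. BI (fst p) t \<omega>) (snd p)"
    by (simp add: path_waiting_times_def hitting_time_restrict)
qed

lemma waiting_version_law:
  assumes N: "prob_space N" and \<delta>: "-1 < \<delta>"
    and BI: "\<And>i. 1 \<le> i \<Longrightarrow> birth_immigration N \<delta> (BI i)"
    and ind: "prob_space.indep_vars N (\<lambda>_. Pi\<^sub>M {0..} (\<lambda>_. count_space UNIV))
           (\<lambda>i \<omega>. \<lambda>t\<in>{0..}. BI i t \<omega>) {1..}"
  shows "waiting_version BI \<in> measurable N waiting_space"
    and "distr N waiting_space (waiting_version BI) = exp_family {1..} (birth_rate \<delta> (\<lambda>_. 0))"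
proof -
  interpret prob_space N by fact
  let ?P = "Pi\<^sub>M UNIV (\<lambda>_. borel) :: (nat \<Rightarrow> real) measure"
  let ?Y = "\<lambda>i \<omega>. path_waiting_times (\<lambda>t\<in>{0..}. BI i t \<omega>)"
  let ?E = "\<lambda>p. exp_measure (birth_rate \<delta> (\<lambda>_. 0) p)"
  let ?f = "\<lambda>z. \<lambda>p\<in>{1::nat..} \<times> UNIV. z (fst p) (snd p :: nat) :: real"
  have Y: "?Y i \<in> measurable N ?P" if "i \<in> {1..}" for i
    using birth_immigration_waiting_law(1)[OF N BI] that by auto
  have rows: "(\<lambda>\<omega>. \<lambda>i\<in>{1..}. ?Y i \<omega>) \<in> measurable N (Pi\<^sub>M {1..} (\<lambda>_. ?P))"
    using Y by (intro measurable_restrict) auto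
  have f: "?f \<in> measurable (Pi\<^sub>M {1..} (\<lambda>_. ?P)) waiting_space"
  proof (rule measurable_restrict)
    fix p :: "nat \<times> nat" assume "p \<in> {1..} \<times> UNIV"
    then have "(\<lambda>z. z (fst p)) \<in> measurable (Pi\<^sub>M {1..} (\<lambda>_. ?P)) ?P"
      by (intro measurable_component_singleton) auto
    from measurable_compose[OF this measurable_component_singleton[of "snd p"]]
    show "(\<lambda>z. z (fst p) (snd p)) \<in> borel_measurable (Pi\<^sub>M {1..} (\<lambda>_. ?P))" by simp
  qed
  have comp: "waiting_version BI = (\<lambda>\<omega>. ?f (\<lambda>i\<in>{1..}. ?Y i \<omega>))"
    by (auto simp: waiting_version_def fun_eq_iff)
  show "waiting_version BI \<in> measurable N waiting_space"
    unfolding comp by (rule measurable_compose[OF rows f])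
  have "indep_vars (\<lambda>_. ?P) ?Y {1..}"
    by (rule indep_vars_compose2[OF ind]) (rule measurable_path_waiting_times)
  then have "distr N (Pi\<^sub>M {1..} (\<lambda>_. ?P)) (\<lambda>\<omega>. \<lambda>i\<in>{1..}. ?Y i \<omega>) = Pi\<^sub>M {1..} (\<lambda>i. distr N ?P (?Y i))"
    using Y by (subst indep_vars_iff_distr_eq_PiM'[symmetric]) auto
  also have "\<dots> = Pi\<^sub>M {1..} (\<lambda>i. Pi\<^sub>M UNIV (\<lambda>b. ?E (i, b)))"
    by (intro PiM_cong refl) (simp add: birth_immigration_waiting_law(2)[OF N BI] birth_rate_def)
  finally have law: "distr N (Pi\<^sub>M {1..} (\<lambda>_. ?P)) (\<lambda>\<omega>. \<lambda>i\<in>{1..}. ?Y i \<omega>) = Pi\<^sub>M {1..} (\<lambda>i. Pi\<^sub>M UNIV (\<lambda>b. ?E (i, b)))" .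
  have "distr N waiting_space (waiting_version BI) =
      distr (distr N (Pi\<^sub>M {1..} (\<lambda>_. ?P)) (\<lambda>\<omega>. \<lambda>i\<in>{1..}. ?Y i \<omega>)) waiting_space ?f"
    unfolding comp by (subst distr_distr[OF f rows]) (simp add: comp_def)
  also have "\<dots> = exp_family {1..} (birth_rate \<delta> (\<lambda>_. 0))"
    unfolding law by (rule distr_uncurry_PiM) (auto intro: prob_space_exp_measure birth_rate_pos[OF \<delta>])
  finally show "distr N waiting_space (waiting_version BI) = exp_family {1..} (birth_rate \<delta> (\<lambda>_. 0))" .
qed

lemma race_path_waiting_version_prob:
  assumes "prob_space N" "-1 < \<delta>"
    and "\<And>i. 1 \<le> i \<Longrightarrow> birth_immigration N \<delta> (BI i)"
    and "prob_space.indep_vars N (\<lambda>_. Pi\<^sub>M {0..} (\<lambda>_. count_space UNIV))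
           (\<lambda>i \<omega>. \<lambda>t\<in>{0..}. BI i t \<omega>) {1..}"
    and L: "valid_labels k n L"
  shows "{\<omega> \<in> space N. race_path k L n (waiting_version BI \<omega>)} \<in> sets N"
    and "emeasure N {\<omega> \<in> space N. race_path k L n (waiting_version BI \<omega>)} = ennreal (label_prob k \<delta> L n)"
proof -
  let ?W = "{x \<in> space waiting_space. race_path k L n x}"
  have law: "waiting_version BI \<in> measurable N waiting_space"
      "distr N waiting_space (waiting_version BI) = exp_family {1..} (birth_rate \<delta> (\<lambda>_. 0))"
    by (rule waiting_version_law[OF assms(1-4)]; assumption)+
  have eq: "{\<omega> \<in> space N. race_path k L n (waiting_version BI \<omega>)} = waiting_version BI -` ?W \<inter> space N"
    using measurable_space[OF law(1)] by auto
  show "{\<omega> \<in> space N. race_path k L n (waiting_version BI \<omega>)} \<in> sets N"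
    unfolding eq by (rule measurable_sets[OF law(1) sets_race_path[OF L]])
  show "emeasure N {\<omega> \<in> space N. race_path k L n (waiting_version BI \<omega>)} = ennreal (label_prob k \<delta> L n)"
    unfolding eq
    by (rule trans[OF emeasure_distr[OF law(1) sets_race_path[OF L], symmetric]])
      (unfold law(2), rule race_path_prob[OF assms(2) L])
qed

section \<open>Measurability\<close>

lemma continuous_at_right_natD:
  fixes f :: "real \<Rightarrow> nat"
  assumes "continuous (at_right t) f"
  obtains e where "0 < e" "\<And>u. t \<le> u \<Longrightarrow> u < t + e \<Longrightarrow> f u = f t"
proof -
  have "eventually (\<lambda>u. f u = f t) (at_right t)"
    using assms by (simp add: continuous_within tendsto_discrete)
  then obtain b where b: "t < b" "\<And>u. t < u \<Longrightarrow> u < b \<Longrightarrow> f u = f t"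
    by (auto simp: eventually_at_right_field)
  show thesis
  proof (rule that[of "b - t"])
    fix u assume "t \<le> u" "u < t + (b - t)"
    then show "f u = f t" using b(2)[of u] by (cases "u = t") auto
  qed (use b in simp)
qed

lemma measurable_countable_valuedI:
  fixes f :: "'a \<Rightarrow> 'c :: countable"
  assumes "\<And>v. {x \<in> space M. f x = v} \<in> sets M"
  shows "f \<in> measurable M (count_space UNIV)"
proof -
  have "f -` {v} \<inter> space M = {x \<in> space M. f x = v}" for v by auto
  then show ?thesis using assms by (auto simp: measurable_count_space_eq2_countable)
qed

lemma pred_neq_countable:
  fixes f g :: "'a \<Rightarrow> 'c :: countable"
  assumes [measurable]: "f \<in> measurable M (count_space UNIV)" "g \<in> measurable M (count_space UNIV)"
  shows "Measurable.pred M (\<lambda>x. f x \<noteq> g x)"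
  by measurable

text \<open>A right-continuous integer-valued path is constant for a while after \<open>T\<close>,
  so its value at \<open>T\<close> is visible at the rational times just after \<open>T\<close>.
  This describes the event through countably many deterministic times.\<close>

lemma measurable_at_random_time:
  fixes X :: "real \<Rightarrow> 'b \<Rightarrow> nat"
  assumes X: "\<And>t. 0 \<le> t \<Longrightarrow> X t \<in> measurable N (count_space UNIV)"
    and cont: "\<And>\<omega> t. \<omega> \<in> space N \<Longrightarrow> 0 \<le> t \<Longrightarrow> continuous (at_right t) (\<lambda>u. X u \<omega>)"
    and T: "T \<in> borel_measurable N" "\<And>\<omega>. \<omega> \<in> space N \<Longrightarrow> 0 \<le> T \<omega>"
  shows "(\<lambda>\<omega>. X (T \<omega>) \<omega>) \<in> measurable N (count_space UNIV)"
proof (rule measurable_countable_valuedI)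
  fix v
  let ?P = "\<lambda>\<omega>. \<exists>m::nat. \<forall>r::rat. 0 \<le> r \<longrightarrow> T \<omega> < of_rat r \<and> of_rat r < T \<omega> + 1 / real (Suc m) \<longrightarrow> X (of_rat r) \<omega> = v"
  have iff: "X (T \<omega>) \<omega> = v \<longleftrightarrow> ?P \<omega>" if \<omega>: "\<omega> \<in> space N" for \<omega>
  proof -
    obtain e where e: "0 < e" "\<And>u. T \<omega> \<le> u \<Longrightarrow> u < T \<omega> + e \<Longrightarrow> X u \<omega> = X (T \<omega>) \<omega>"
      using continuous_at_right_natD[OF cont[OF \<omega> T(2)[OF \<omega>]]] by metis
    obtain m where m: "1 / real (Suc m) < e" using nat_approx_posE[OF e(1)] by blast
    show ?thesis
    proof
      assume v: "X (T \<omega>) \<omega> = v"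
      show "?P \<omega>"
      proof (intro exI[of _ m] allI impI)
        fix r :: rat
        assume "T \<omega> < of_rat r \<and> of_rat r < T \<omega> + 1 / real (Suc m)"
        then show "X (of_rat r) \<omega> = v" using e(2)[of "of_rat r"] m v by simp
      qed
    next
      assume "?P \<omega>"
      then obtain m' where m': "\<And>r::rat. 0 \<le> r \<Longrightarrow> T \<omega> < of_rat r \<Longrightarrow> of_rat r < T \<omega> + 1 / real (Suc m') \<Longrightarrow> X (of_rat r) \<omega> = v"
        by blast
      have "T \<omega> < T \<omega> + min e (1 / real (Suc m'))" using e by simp
      then obtain r :: rat where r: "T \<omega> < of_rat r" "of_rat r < T \<omega> + min e (1 / real (Suc m'))"
        using of_rat_dense by blast
      have "(0::real) \<le> of_rat r" using r T(2)[OF \<omega>] by linarith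
      then show "X (T \<omega>) \<omega> = v" using m'[of r] e(2)[of "of_rat r"] r by auto
    qed
  qed
  have X': "Measurable.pred N (\<lambda>\<omega>. X (of_rat r) \<omega> = v)" if "0 \<le> r" for r :: rat
    using X[of "of_rat r"] that by (simp add: pred_count_space_const1)
  note T(1)[measurable]
  have "{\<omega> \<in> space N. X (T \<omega>) \<omega> = v} = {\<omega> \<in> space N. ?P \<omega>}" using iff by blast
  also have "\<dots> \<in> sets N"
  proof (rule predE, intro pred_intros_countable)
    fix m :: nat and r :: rat
    show "Measurable.pred N (\<lambda>\<omega>. 0 \<le> r \<longrightarrow> T \<omega> < of_rat r \<and> of_rat r < T \<omega> + 1 / real (Suc m) \<longrightarrow> X (of_rat r) \<omega> = v)"
    proof (cases "0 \<le> r")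
      case True
      note X'[OF True, measurable]
      show ?thesis by measurable
    qed simp
  qed
  finally show "{\<omega> \<in> space N. X (T \<omega>) \<omega> = v} \<in> sets N" .
qed

text \<open>Removes the infimum so that measurability can be checked; the second disjunct is the
  default value of \<open>next_jump\<close>.\<close>

lemma next_jump_less_iff:
  "next_jump f s < c \<longleftrightarrow> (\<exists>t>s. f t \<noteq> f s \<and> t < c) \<or> ((\<forall>t>s. f t = f s) \<and> s < c)"
proof (cases "\<exists>t>s. f t \<noteq> f s")
  case True
  then have "next_jump f s < c \<longleftrightarrow> (\<exists>t\<in>{t. s < t \<and> f t \<noteq> f s}. t < c)"
    unfolding next_jump_def if_P[OF True] by (intro cInf_less_iff) (auto intro!: bdd_belowI[of _ s])
  then show ?thesis using True by blast
next
  case False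
  then show ?thesis unfolding next_jump_def if_not_P[OF False] by blast
qed

lemma event_time_mono: "m \<le> n \<Longrightarrow> event_time k X m \<le> event_time k X n"
  by (rule lift_Suc_mono_le[of "event_time k X"]) (auto intro: next_jump_ge)

text \<open>The part of \<open>birth_immigration\<close> that holds at every sample point and not
  just almost surely; measurability is derived from it alone.\<close>

definition regular_paths :: "'b measure \<Rightarrow> (nat \<Rightarrow> real \<Rightarrow> 'b \<Rightarrow> nat) \<Rightarrow> bool" where
  "regular_paths N BI \<longleftrightarrow> (\<forall>i\<ge>1. \<forall>t\<ge>0. BI i t \<in> measurable N (count_space UNIV) \<and>
     (\<forall>\<omega>\<in>space N. continuous (at_right t) (\<lambda>u. BI i u \<omega>)))"

lemma regular_pathsI: "(\<And>i. 1 \<le> i \<Longrightarrow> birth_immigration N \<delta> (BI i)) \<Longrightarrow> regular_paths N BI"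
  by (auto simp: regular_paths_def birth_immigration_def pure_birth_chain_def)

lemma measurable_value_since_birth:
  assumes reg: "regular_paths N BI"
    and T: "\<And>j. j \<le> n \<Longrightarrow> (\<lambda>\<omega>. event_time k (\<lambda>i t. BI i t \<omega>) j) \<in> borel_measurable N"
    and i: "1 \<le> i" "birth_index k i \<le> n"
  shows "(\<lambda>\<omega>. BI i (event_time k (\<lambda>i t. BI i t \<omega>) n - event_time k (\<lambda>i t. BI i t \<omega>) (birth_index k i)) \<omega>)
    \<in> measurable N (count_space UNIV)"
proof (rule measurable_at_random_time)
  show "BI i t \<in> measurable N (count_space UNIV)" if "0 \<le> t" for t
    using reg that i by (auto simp: regular_paths_def)
  show "continuous (at_right t) (\<lambda>u. BI i u \<omega>)" if "\<omega> \<in> space N" "0 \<le> t" for \<omega> t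
    using reg that i by (auto simp: regular_paths_def)
  show "(\<lambda>\<omega>. event_time k (\<lambda>i t. BI i t \<omega>) n - event_time k (\<lambda>i t. BI i t \<omega>) (birth_index k i)) \<in> borel_measurable N"
    using T[of n] T[OF i(2)] by measurable
  show "0 \<le> event_time k (\<lambda>i t. BI i t \<omega>) n - event_time k (\<lambda>i t. BI i t \<omega>) (birth_index k i)" for \<omega>
    using event_time_mono[OF i(2)] by simp
qed

text \<open>Strong induction, because the clock of a label is shifted by the event time of its
  birth. By right-continuity a changed value persists for a while, so a change of the vector is
  already seen at a rational age of one of finitely many labels.\<close>

lemma measurable_event_time:
  assumes reg: "regular_paths N BI"
  shows "(\<lambda>\<omega>. event_time k (\<lambda>i t. BI i t \<omega>) n) \<in> borel_measurable N"
proof (induction n rule: less_induct)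
  case (less n)
  show ?case
  proof (cases n)
    case 0
    then show ?thesis by simp
  next
    case (Suc n')
    let ?T = "\<lambda>\<omega>. event_time k (\<lambda>i t. BI i t \<omega>)"
    let ?B = "\<lambda>\<omega> i. ?T \<omega> (birth_index k i)"
    let ?A = "{1..num_labels k n'}"
    let ?F = "\<lambda>\<omega> t i. if 1 \<le> i \<and> i \<le> num_labels k n' then BI i (t - ?B \<omega> i) \<omega> else 0"
    let ?V = "\<lambda>\<omega> i. BI i (?T \<omega> n' - ?B \<omega> i) \<omega>"
    \<comment> \<open>\<open>r\<close> is the age of label \<open>i\<close> and
      \<open>of_rat r + ?B \<omega> i\<close> the absolute time. Rational ages, rather than rational
      absolute times, keep the argument of \<open>BI i\<close> deterministic.\<close>
    let ?R = "\<lambda>\<omega> c. \<exists>i\<in>?A. \<exists>r::rat. 0 \<le> r \<and> ?T \<omega> n' < of_rat r + ?B \<omega> i \<and> of_rat r + ?B \<omega> i < c \<and> BI i (of_rat r) \<omega> \<noteq> ?V \<omega> i"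
    have bi: "birth_index k i \<le> n'" if "i \<in> ?A" for i using birth_index_le that by auto
    have T: "(\<lambda>\<omega>. ?T \<omega> j) \<in> borel_measurable N" if "j \<le> n'" for j using less that Suc by simp
    have iff: "(\<exists>t>?T \<omega> n'. ?F \<omega> t \<noteq> ?F \<omega> (?T \<omega> n') \<and> t < c) \<longleftrightarrow> ?R \<omega> c" if \<omega>: "\<omega> \<in> space N" for \<omega> c
    proof
      assume "\<exists>t>?T \<omega> n'. ?F \<omega> t \<noteq> ?F \<omega> (?T \<omega> n') \<and> t < c"
      then obtain t where t: "?T \<omega> n' < t" "t < c" "?F \<omega> t \<noteq> ?F \<omega> (?T \<omega> n')" by blast
      from t(3) obtain i where "?F \<omega> t i \<noteq> ?F \<omega> (?T \<omega> n') i" by (meson ext)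
      then have i: "i \<in> ?A" and neq: "BI i (t - ?B \<omega> i) \<omega> \<noteq> ?V \<omega> i" by (auto split: if_splits)
      have "0 \<le> t - ?B \<omega> i" using event_time_mono[OF bi[OF i], of k "\<lambda>i t. BI i t \<omega>"] t by simp
      then have "continuous (at_right (t - ?B \<omega> i)) (\<lambda>u. BI i u \<omega>)"
        using reg i \<omega> by (auto simp: regular_paths_def)
      then obtain e where e: "0 < e" "\<And>u. t - ?B \<omega> i \<le> u \<Longrightarrow> u < t - ?B \<omega> i + e \<Longrightarrow> BI i u \<omega> = BI i (t - ?B \<omega> i) \<omega>"
        using continuous_at_right_natD by metis
      have "t - ?B \<omega> i < t - ?B \<omega> i + min e (c - t)" using e t by simp
      then obtain r :: rat where r: "t - ?B \<omega> i < of_rat r" "of_rat r < t - ?B \<omega> i + min e (c - t)"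
        using of_rat_dense by blast
      have "(0::real) \<le> of_rat r" using r \<open>0 \<le> t - ?B \<omega> i\<close> by linarith
      then have "0 \<le> r" by simp
      moreover have "BI i (of_rat r) \<omega> \<noteq> ?V \<omega> i" using e(2)[of "of_rat r"] r neq by simp
      moreover have "?T \<omega> n' < of_rat r + ?B \<omega> i" "of_rat r + ?B \<omega> i < c" using r t by simp_all
      ultimately show "?R \<omega> c" using i by blast
    next
      assume "?R \<omega> c"
      then obtain i and r :: rat where i: "i \<in> ?A" and r: "?T \<omega> n' < of_rat r + ?B \<omega> i" "of_rat r + ?B \<omega> i < c"
        "BI i (of_rat r) \<omega> \<noteq> ?V \<omega> i" by blast
      have "?F \<omega> (of_rat r + ?B \<omega> i) i \<noteq> ?F \<omega> (?T \<omega> n') i" using i r by simp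
      then have "?F \<omega> (of_rat r + ?B \<omega> i) \<noteq> ?F \<omega> (?T \<omega> n')"
        by (rule contrapos_nn) (drule fun_cong[of _ _ i], assumption)
      then show "\<exists>t>?T \<omega> n'. ?F \<omega> t \<noteq> ?F \<omega> (?T \<omega> n') \<and> t < c" using r by blast
    qed
    have V: "(\<lambda>\<omega>. ?V \<omega> i) \<in> measurable N (count_space UNIV)" if "i \<in> ?A" for i
      by (rule measurable_value_since_birth[OF reg T]) (use that bi in auto)
    have R: "Measurable.pred N (\<lambda>\<omega>. ?R \<omega> c)" for c
    proof (intro pred_intros_finite pred_intros_countable)
      fix i and r :: rat assume i: "i \<in> ?A"
      show "Measurable.pred N (\<lambda>\<omega>. 0 \<le> r \<and> ?T \<omega> n' < of_rat r + ?B \<omega> i \<and> of_rat r + ?B \<omega> i < c \<and>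
          BI i (of_rat r) \<omega> \<noteq> ?V \<omega> i)"
      proof (cases "0 \<le> r")
        case True
        have X: "BI i (of_rat r) \<in> measurable N (count_space UNIV)"
          using reg i True by (auto simp: regular_paths_def)
        note T[OF order_refl, measurable] T[OF bi[OF i], measurable]
        have "Measurable.pred N (\<lambda>\<omega>. ?T \<omega> n' < of_rat r + ?B \<omega> i)" "Measurable.pred N (\<lambda>\<omega>. of_rat r + ?B \<omega> i < c)"
          by measurable
        then show ?thesis
          by (intro pred_intros_logic pred_neq_countable V[OF i] X) simp_all
      qed simp
    qed simp
    \<comment> \<open>Reduces the default case of \<open>next_jump\<close> to countably many bounds:
      no jump at all means none before any natural number.\<close>
    have ex: "(\<forall>t>?T \<omega> n'. ?F \<omega> t = ?F \<omega> (?T \<omega> n')) \<longleftrightarrow> \<not> (\<exists>m::nat. ?R \<omega> (real m))" if "\<omega> \<in> space N" for \<omega>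
      unfolding iff[OF that, symmetric] by (meson reals_Archimedean2)
    show ?thesis
    proof (rule borel_measurableI_less)
      fix c :: real
      have "{\<omega> \<in> space N. ?T \<omega> n < c} =
          {\<omega> \<in> space N. ?R \<omega> c \<or> (\<not> (\<exists>m::nat. ?R \<omega> (real m)) \<and> ?T \<omega> n' < c)}"
      proof (intro Collect_cong conj_cong refl)
        fix \<omega> assume \<omega>: "\<omega> \<in> space N"
        show "?T \<omega> n < c \<longleftrightarrow> ?R \<omega> c \<or> (\<not> (\<exists>m::nat. ?R \<omega> (real m)) \<and> ?T \<omega> n' < c)"
          unfolding Suc event_time.simps(2) next_jump_less_iff iff[OF \<omega>] ex[OF \<omega>] by (rule refl)
      qed
      also have "\<dots> \<in> sets N"
      proof (rule predE)
        note R[measurable] T[OF order_refl, measurable]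
        show "Measurable.pred N (\<lambda>\<omega>. ?R \<omega> c \<or> (\<not> (\<exists>m::nat. ?R \<omega> (real m)) \<and> ?T \<omega> n' < c))"
          by measurable
      qed
      finally show "{\<omega> \<in> space N. ?T \<omega> n < c} \<in> sets N" .
    qed
  qed
qed

lemma measurable_bi_label:
  assumes reg: "regular_paths N BI"
  shows "(\<lambda>\<omega>. bi_label k (\<lambda>i t. BI i t \<omega>)) \<in> measurable N label_space"
proof (rule measurable_PiM_single')
  fix n :: nat
  show "(\<lambda>\<omega>. bi_label k (\<lambda>i t. BI i t \<omega>) n) \<in> measurable N (count_space UNIV)"
    unfolding bi_label_def event_label_def
  proof (rule measurable_Least)
    fix i
    let ?V = "\<lambda>n \<omega>. BI i (event_time k (\<lambda>i t. BI i t \<omega>) n - event_time k (\<lambda>i t. BI i t \<omega>) (birth_index k i)) \<omega>"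
    show "Measurable.pred N (\<lambda>\<omega>. 1 \<le> i \<and> i \<le> 1 + Suc n * (k + 1) \<and> ?V (Suc n) \<omega> \<noteq> ?V (Suc n - 1) \<omega>)"
    proof (cases "1 \<le> i \<and> i \<le> 1 + Suc n * (k + 1)")
      case True
      then have i: "1 \<le> i" "birth_index k i \<le> n"
        using birth_index_le[of i k n] by (simp_all add: num_labels_def)
      have V: "?V m \<in> measurable N (count_space UNIV)" if "n \<le> m" for m
        by (rule measurable_value_since_birth[OF reg measurable_event_time[OF reg]]) (use i that in auto)
      have "Measurable.pred N (\<lambda>\<omega>. ?V (Suc n) \<omega> \<noteq> ?V (Suc n - 1) \<omega>)"
        by (intro pred_neq_countable V) simp_all
      then show ?thesis using True by (simp del: event_time.simps)
    next
      case False
      then show ?thesis by (cases "1 \<le> i") (simp_all del: event_time.simps)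
    qed
  qed
qed auto

lemma measurable_label_prefix:
  "(\<lambda>L. map L [0..<n]) \<in> measurable label_space (count_space UNIV)"
proof (rule measurable_countable_valuedI)
  fix xs :: "nat list"
  have "{L \<in> space label_space. map L [0..<n] = xs} =
      (if length xs = n then {L \<in> space label_space. \<forall>i\<in>{..<n}. L i = xs ! i} else {})"
    by (auto simp: list_eq_iff_nth_eq)
  also have "\<dots> \<in> sets label_space"
    by (auto intro!: sets.sets_Collect_finite_All)
  finally show "{L \<in> space label_space. map L [0..<n] = xs} \<in> sets label_space" .
qed

text \<open>The first \<open>n\<close> labels form an element of a countable set of lists, so
  \<open>g\<close> factors through a discrete space.\<close>

lemma measurable_label_function:
  assumes "\<And>L L'. (\<And>i. i < n \<Longrightarrow> L i = L' i) \<Longrightarrow> g L = g L'"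
  shows "g \<in> measurable label_space (count_space UNIV)"
proof -
  have "(\<lambda>L. g (\<lambda>i. map L [0..<n] ! i)) \<in> measurable label_space (count_space UNIV)"
    by (rule measurable_compose[OF measurable_label_prefix, of "\<lambda>xs. g ((!) xs)"]) simp
  moreover have "g (\<lambda>i. map L [0..<n] ! i) = g L" for L
    by (rule assms) simp
  ultimately show ?thesis by simp
qed

lemma measurable_degree_seqI:
  assumes "\<And>n j m. 1 \<le> j \<Longrightarrow> m \<le> k \<Longrightarrow> (\<lambda>\<omega>. D \<omega> n j m) \<in> borel_measurable N"
    and "\<And>\<omega> n. D \<omega> n = (\<lambda>j\<in>{1..}. \<lambda>m\<in>{..k}. D \<omega> n j m)"
  shows "D \<in> measurable N (degree_seq_space k)"
proof -
  have "(\<lambda>\<omega>. \<lambda>n\<in>UNIV. \<lambda>j\<in>{1..}. \<lambda>m\<in>{..k}. D \<omega> n j m) \<in> measurable N (degree_seq_space k)"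
    unfolding degree_seq_space_def by (intro measurable_restrict assms(1)) auto
  also have "(\<lambda>\<omega>. \<lambda>n\<in>UNIV. \<lambda>j\<in>{1..}. \<lambda>m\<in>{..k}. D \<omega> n j m) = D"
    using assms(2)[symmetric] by (simp add: fun_eq_iff)
  finally show ?thesis .
qed

lemma lab_degrees_cong: "(\<And>i. i < n \<Longrightarrow> L i = L' i) \<Longrightarrow> lab_degrees k L n = lab_degrees k L' n"
proof -
  assume eq: "\<And>i. i < n \<Longrightarrow> L i = L' i"
  have "lab_enum k L n = lab_enum k L' n" by (rule lab_enum_cong) (rule eq)
  moreover have "lab_facet k L i = lab_facet k L' i" if "i \<le> n" for i
    by (rule lab_facet_cong) (use eq that in auto)
  ultimately show ?thesis 
    by (simp add: lab_degrees_def restrict_def fun_eq_iff cong: conj_cong)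
qed

lemma measurable_lab_degrees: "lab_degrees k \<in> measurable label_space (degree_seq_space k)"
proof (rule measurable_degree_seqI)
  fix n j m
  have "(\<lambda>L. lab_degrees k L n j m) \<in> measurable label_space (count_space UNIV)"
    by (rule measurable_label_function[where n = n]) (metis lab_degrees_cong)
  from measurable_compose[OF this, of "\<lambda>x. x" borel]
  show "(\<lambda>L. lab_degrees k L n j m) \<in> borel_measurable label_space" by simp
qed (simp add: lab_degrees_def restrict_def fun_eq_iff)

lemma measurable_bi_degrees:
  assumes reg: "regular_paths N BI"
  shows "bi_degrees k BI \<in> measurable N (degree_seq_space k)"
proof (rule measurable_degree_seqI)
  fix n j m :: nat assume jm: "1 \<le> j" "m \<le> k"
  let ?X = "\<lambda>\<omega> i t. BI i t \<omega>"
  let ?V = "\<lambda>\<omega> i. BI i (event_time k (?X \<omega>) n - event_time k (?X \<omega>) (birth_index k i)) \<omega>"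
  let ?Q = "\<lambda>\<omega> i. top_face k m (bi_enum k (?X \<omega>) n j) \<subseteq> bi_enum k (?X \<omega>) n i"
  have V: "(\<lambda>\<omega>. real (?V \<omega> i)) \<in> borel_measurable N" if "i \<in> {1..num_labels k n}" for i
  proof -
    have "(\<lambda>\<omega>. ?V \<omega> i) \<in> measurable N (count_space UNIV)"
      by (rule measurable_value_since_birth[OF reg measurable_event_time[OF reg]])
        (use that birth_index_le in auto)
    then show ?thesis by measurable
  qed
  have Q: "Measurable.pred N (\<lambda>\<omega>. ?Q \<omega> i)" for i
  proof -
    have "(\<lambda>L. top_face k m (lab_enum k L n j) \<subseteq> lab_enum k L n i) \<in> measurable label_space (count_space UNIV)"
      by (rule measurable_label_function[where n = n]) (metis lab_enum_cong)
    from measurable_compose[OF measurable_bi_label[OF reg] this]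
    show ?thesis unfolding bi_enum_eq_lab_enum .
  qed
  \<comment> \<open>The random index set of the sum is traded for a fixed one with a measurable
    condition inside.\<close>
  have "(\<lambda>\<omega>. \<Sum>i\<in>{1..num_labels k n}. if ?Q \<omega> i then real (?V \<omega> i) else 0) \<in> borel_measurable N"
    by (intro borel_measurable_sum measurable_If V borel_measurable_const) (use Q in \<open>auto simp: pred_def\<close>)
  then have "(\<lambda>\<omega>. if j \<le> num_labels k n then real (k - m) + 1 / real (k - m + 1) *
      (\<Sum>i\<in>{1..num_labels k n}. if ?Q \<omega> i then real (?V \<omega> i) else 0) else 0) \<in> borel_measurable N"
    by measurable
  also have "(\<lambda>\<omega>. if j \<le> num_labels k n then real (k - m) + 1 / real (k - m + 1) *
      (\<Sum>i\<in>{1..num_labels k n}. if ?Q \<omega> i then real (?V \<omega> i) else 0) else 0) = (\<lambda>\<omega>. bi_degrees k BI \<omega> n j m)"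
    unfolding bi_degrees_def bi_degree_vector_def using jm
    by (simp add: fun_eq_iff sum.inter_filter[symmetric] del: event_time.simps)
  finally show "(\<lambda>\<omega>. bi_degrees k BI \<omega> n j m) \<in> borel_measurable N" .
next
  show "bi_degrees k BI \<omega> n = (\<lambda>j\<in>{1..}. \<lambda>m\<in>{..k}. bi_degrees k BI \<omega> n j m)" for \<omega> n
    unfolding bi_degrees_def bi_degree_vector_def by (simp add: restrict_def fun_eq_iff del: event_time.simps)
qed

section \<open>Equality of the laws\<close>

lemma residual_cong:
  "(\<And>i. i < n \<Longrightarrow> L i = L' i) \<Longrightarrow> residual k L n x = residual k L' n x"
  by (induction n) auto

lemma race_path_cong:
  assumes "\<And>i. i < n \<Longrightarrow> L i = L' i"
  shows "race_path k L n x \<longleftrightarrow> race_path k L' n x"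
proof -
  have "residual k L j x = residual k L' j x" if "j < n" for j
    by (rule residual_cong) (use assms that in auto)
  then show ?thesis using assms by (simp add: race_path_def)
qed

text \<open>Wins are strict, so two labels cannot both win on the same residual times, and equal
  earlier winners leave equal residual times. Hence race events of different label prefixes are
  disjoint.\<close>

lemma race_path_unique:
  assumes "valid_labels k n L" "valid_labels k n L'" "race_path k L n x" "race_path k L' n x" "j < n"
  shows "L j = L' j"
  using assms(5)
proof (induction j rule: less_induct)
  case (less j)
  have res: "residual k L j x = residual k L' j x"
    by (rule residual_cong) (use less in auto)
  have "race_wins {1..num_labels k j} (L j) (residual k L j x)"
    "race_wins {1..num_labels k j} (L' j) (residual k L j x)"
    using assms(3,4) less.prems res by (auto simp: race_path_def)
  moreover have "L j \<in> {1..num_labels k j}" "L' j \<in> {1..num_labels k j}"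
    using assms(1,2) less.prems by (auto simp: valid_labels_def)
  ultimately show ?case
    unfolding race_wins_def by (metis DiffI less_asym singletonD)
qed

text \<open>A finite box depends only on a prefix of the sequence, and the law of a prefix lives on
  the countable set of lists, where point masses determine it.\<close>

lemma distr_label_space_eqI:
  assumes M: "prob_space M" and N: "prob_space N"
    and U: "U \<in> measurable M label_space" and V: "V \<in> measurable N label_space"
    and eq: "\<And>n L. emeasure M {\<omega> \<in> space M. \<forall>i<n. U \<omega> i = L i} = emeasure N {\<omega> \<in> space N. \<forall>i<n. V \<omega> i = L i}"
  shows "distr M label_space U = distr N label_space V"
proof (rule measure_eqI_PiM_infinite[where I = UNIV and M = "\<lambda>_. count_space UNIV"])
  interpret M: prob_space M by fact
  interpret D: prob_space "distr M label_space U" by (rule M.prob_space_distr[OF U])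
  show "finite_measure (distr M label_space U)" by unfold_locales
  fix A and J :: "nat set" assume J: "finite J"
  obtain n where n: "\<And>j. j \<in> J \<Longrightarrow> j < n" using J unfolding finite_nat_set_iff_bounded by auto
  let ?pre = "\<lambda>L :: nat \<Rightarrow> nat. map L [0..<n]"
  let ?box = "prod_emb UNIV (\<lambda>_. count_space UNIV) J (Pi\<^sub>E J A) :: (nat \<Rightarrow> nat) set"
  let ?C = "{xs. length xs = n \<and> (\<forall>j\<in>J. xs ! j \<in> A j)}"
  have pU: "(\<lambda>\<omega>. ?pre (U \<omega>)) \<in> measurable M (count_space UNIV)"
    and pV: "(\<lambda>\<omega>. ?pre (V \<omega>)) \<in> measurable N (count_space UNIV)"
    by (rule measurable_compose[OF U measurable_label_prefix], rule measurable_compose[OF V measurable_label_prefix])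
  have box: "?box = {L. \<forall>j\<in>J. L j \<in> A j}"
    by (auto simp: prod_emb_def PiE_iff)
  have box_sets: "?box \<in> sets label_space" by (rule sets_PiM_I) (use J in auto)
  have box_pre: "f -` ?box \<inter> S = (\<lambda>\<omega>. ?pre (f \<omega>)) -` ?C \<inter> S" for f :: "'c \<Rightarrow> nat \<Rightarrow> nat" and S
    unfolding box using n by auto
  have "distr M (count_space UNIV) (\<lambda>\<omega>. ?pre (U \<omega>)) = distr N (count_space UNIV) (\<lambda>\<omega>. ?pre (V \<omega>))"
  proof (rule measure_eqI_countable[where A = UNIV])
    fix xs :: "nat list"
    have pre: "(\<lambda>\<omega>. ?pre (f \<omega>)) -` {xs} \<inter> S = {\<omega> \<in> S. length xs = n \<and> (\<forall>i<n. f \<omega> i = xs ! i)}"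
      for f :: "'c \<Rightarrow> nat \<Rightarrow> nat" and S
    proof -
      have "?pre L = xs \<longleftrightarrow> length xs = n \<and> (\<forall>i<n. L i = xs ! i)" for L :: "nat \<Rightarrow> nat"
        unfolding list_eq_iff_nth_eq by (cases "length xs = n") simp_all
      then show ?thesis by blast
    qed
    have "emeasure M ((\<lambda>\<omega>. ?pre (U \<omega>)) -` {xs} \<inter> space M) = emeasure N ((\<lambda>\<omega>. ?pre (V \<omega>)) -` {xs} \<inter> space N)"
      unfolding pre using eq[of n "(!) xs"] by (cases "length xs = n") simp_all
    then show "emeasure (distr M (count_space UNIV) (\<lambda>\<omega>. ?pre (U \<omega>))) {xs} = emeasure (distr N (count_space UNIV) (\<lambda>\<omega>. ?pre (V \<omega>))) {xs}"
      using emeasure_distr[OF pU, of "{xs}"] emeasure_distr[OF pV, of "{xs}"] by simp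
  qed auto
  then have "emeasure (distr M (count_space UNIV) (\<lambda>\<omega>. ?pre (U \<omega>))) ?C = emeasure (distr N (count_space UNIV) (\<lambda>\<omega>. ?pre (V \<omega>))) ?C"
    by (rule arg_cong)
  then show "emeasure (distr M label_space U) ?box = emeasure (distr N label_space V) ?box"
    unfolding emeasure_distr[OF U box_sets] emeasure_distr[OF V box_sets] box_pre
    using emeasure_distr[OF pU, of ?C] emeasure_distr[OF pV, of ?C] by simp
qed auto

theorem proposition3p1:
  fixes k :: nat and \<delta> :: real
    and M :: "'a measure" and S :: "nat \<Rightarrow> 'a \<Rightarrow> nat set"
    and N :: "'b measure" and BI :: "nat \<Rightarrow> real \<Rightarrow> 'b \<Rightarrow> nat"
  assumes "\<delta> > -1"
    and "prob_space M"
    and "preferential_attachment M k \<delta> S"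
    and "prob_space N"
    and "\<And>i. i \<ge> 1 \<Longrightarrow> birth_immigration N \<delta> (BI i)"
    and "prob_space.indep_vars N (\<lambda>_. Pi\<^sub>M {0..} (\<lambda>_. count_space UNIV))
           (\<lambda>i \<omega>. \<lambda>t\<in>{0..}. BI i t \<omega>) {1..}"
  shows "pa_degrees k S \<in> measurable M (degree_seq_space k) \<and>
         bi_degrees k BI \<in> measurable N (degree_seq_space k) \<and>
         (AE \<omega> in N. \<forall>n. \<forall>j\<ge>1. \<forall>m\<le>k. bi_degrees k BI \<omega> n j m \<in> \<nat>) \<and>
         distr M (degree_seq_space k) (pa_degrees k S) =
         distr N (degree_seq_space k) (bi_degrees k BI)"
proof -
  interpret M: prob_space M by fact
  interpret N: prob_space N by fact
  note pa = assms(3) and BI = assms(5)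
  have reg: "regular_paths N BI" by (rule regular_pathsI[OF BI])
  define U where "U \<omega> = pa_label k (\<lambda>i. S i \<omega>)" for \<omega>
  define V where "V \<omega> = bi_label k (\<lambda>i t. BI i t \<omega>)" for \<omega>
  \<comment> \<open>The event that \<open>L\<close> wins the first \<open>n\<close> races strictly;
    it is stated with \<open>waiting_version\<close> to be measurable.\<close>
  define R where "R n L = {\<omega> \<in> space N. race_path k L n (waiting_version BI \<omega>)}" for n L
  have U: "U \<in> measurable M label_space"
    unfolding U_def[abs_def] by (rule pa_label_measurable[OF pa])
  have V: "V \<in> measurable N label_space"
    unfolding V_def[abs_def] by (rule measurable_bi_label[OF reg])
  have U_sets: "{\<omega> \<in> space M. \<forall>i<n. U \<omega> i = L i} \<in> sets M" for n L
    unfolding U_def by (rule pa_label_event_sets[OF pa])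
  have R_sets: "R n L \<in> sets N" and R_U: "emeasure N (R n L) = emeasure M {\<omega> \<in> space M. \<forall>i<n. U \<omega> i = L i}"
    if "valid_labels k n L" for n L
    using race_path_waiting_version_prob[OF assms(4,1) BI assms(6) that] pa_label_prob[OF assms(2) pa that]
    by (auto simp: R_def U_def M.emeasure_eq_measure)
  have U_valid: "valid_labels k n (U \<omega>)" if "\<omega> \<in> space M" for n \<omega>
    unfolding U_def by (rule pa_label_props(1)[OF preferential_attachment_admissible[OF pa that]])
  \<comment> \<open>The race events of valid prefixes are disjoint and have the probabilities of the
    corresponding label events on \<open>M\<close>, which cover \<open>space M\<close>. So their
    union has probability one, and ties are negligible.\<close>
  have "AE \<omega> in N. \<exists>L. valid_labels k n L \<and> \<omega> \<in> R n L" for n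
  proof -
    let ?W = "{xs. length xs = n \<and> valid_labels k n ((!) xs)}"
    let ?E = "\<lambda>xs. {\<omega> \<in> space M. \<forall>i<n. U \<omega> i = xs ! i}"
    have "(\<Union>xs\<in>?W. ?E xs) = space M"
    proof (intro equalityI subsetI)
      fix \<omega> assume \<omega>: "\<omega> \<in> space M"
      let ?xs = "map (U \<omega>) [0..<n]"
      have "valid_labels k n ((!) ?xs)"
        using U_valid[OF \<omega>, of n] valid_labels_cong[of n "(!) ?xs" "U \<omega>" k] by simp
      then show "\<omega> \<in> (\<Union>xs\<in>?W. ?E xs)" using \<omega> by (intro UN_I[of ?xs]) auto
    qed auto
    moreover have "emeasure M (\<Union>xs\<in>?W. ?E xs) = (\<integral>\<^sup>+xs. emeasure M (?E xs) \<partial>count_space ?W)"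
    proof (intro emeasure_UN_countable)
      show "disjoint_family_on ?E ?W"
      proof (unfold disjoint_family_on_def, intro ballI impI)
        fix xs ys assume "xs \<in> ?W" "ys \<in> ?W" "xs \<noteq> ys"
        then obtain i where "i < n" "xs ! i \<noteq> ys ! i" using nth_equalityI[of xs ys] by auto
        then show "?E xs \<inter> ?E ys = {}" by fastforce
      qed
    qed (rule U_sets, rule countableI_type)
    moreover have "emeasure N (\<Union>xs\<in>?W. R n ((!) xs)) = (\<integral>\<^sup>+xs. emeasure N (R n ((!) xs)) \<partial>count_space ?W)"
    proof (intro emeasure_UN_countable)
      show "disjoint_family_on (\<lambda>xs. R n ((!) xs)) ?W"
      proof (unfold disjoint_family_on_def, intro ballI impI)
        fix xs ys assume xy: "xs \<in> ?W" "ys \<in> ?W" "xs \<noteq> ys"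
        show "R n ((!) xs) \<inter> R n ((!) ys) = {}"
        proof (rule ccontr)
          assume "R n ((!) xs) \<inter> R n ((!) ys) \<noteq> {}"
          then obtain \<omega> where "race_path k ((!) xs) n (waiting_version BI \<omega>)"
            "race_path k ((!) ys) n (waiting_version BI \<omega>)"
            by (auto simp: R_def)
          then have "xs ! j = ys ! j" if "j < n" for j
            using race_path_unique[of k n "(!) xs" "(!) ys"] xy that by auto
          then show False using xy by (auto intro: nth_equalityI)
        qed
      qed
    qed (use R_sets in auto)
    moreover have "(\<integral>\<^sup>+xs. emeasure N (R n ((!) xs)) \<partial>count_space ?W) = (\<integral>\<^sup>+xs. emeasure M (?E xs) \<partial>count_space ?W)"
      by (rule nn_integral_cong) (simp add: R_U)
    ultimately have "emeasure N (\<Union>xs\<in>?W. R n ((!) xs)) = 1" by (simp add: M.emeasure_space_1)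
    moreover have "(\<Union>xs\<in>?W. R n ((!) xs)) \<in> sets N"
      by (intro sets.countable_UN'' R_sets) auto
    ultimately have "AE \<omega> in N. \<omega> \<in> (\<Union>xs\<in>?W. R n ((!) xs))"
      by (intro N.AE_prob_1) (simp add: N.emeasure_eq_measure)
    then show ?thesis by eventually_elim auto
  qed
  then have "AE \<omega> in N. \<forall>n. \<exists>L. valid_labels k n L \<and> \<omega> \<in> R n L" by (simp add: AE_all_countable)
  moreover have "AE \<omega> in N. \<forall>i. 1 \<le> i \<longrightarrow> unit_jumps (\<lambda>t. BI i t \<omega>)"
    unfolding AE_all_countable using birth_immigration_unit_jumps[OF BI] by auto
  ultimately have generic: "AE \<omega> in N. (\<forall>i\<ge>1. unit_jumps (\<lambda>t. BI i t \<omega>)) \<and>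
      (\<forall>n. \<exists>L. valid_labels k n L \<and> race_path k L n (waiting_times (\<lambda>i t. BI i t \<omega>)) \<and> \<omega> \<in> R n L)"
  proof eventually_elim
    case (elim \<omega>)
    then have "waiting_version BI \<omega> = waiting_times (\<lambda>i t. BI i t \<omega>)" by (intro waiting_version_eq) auto
    then show ?case using elim by (auto simp: R_def)
  qed
  then have bi: "AE \<omega> in N. bi_degrees k BI \<omega> = lab_degrees k (V \<omega>)"
  proof eventually_elim
    case (elim \<omega>)
    show ?case
    proof (rule ext)
      fix n
      obtain L where "valid_labels k n L" "race_path k L n (waiting_times (\<lambda>i t. BI i t \<omega>))"
        using elim by blast
      then show "bi_degrees k BI \<omega> n = lab_degrees k (V \<omega>) n"
        unfolding bi_degrees_def V_def using elim by (intro bi_degree_vector_eq) auto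
    qed
  qed
  have law: "emeasure M {\<omega> \<in> space M. \<forall>i<n. U \<omega> i = L i} = emeasure N {\<omega> \<in> space N. \<forall>i<n. V \<omega> i = L i}" for n L
  proof -
    let ?V = "{\<omega> \<in> space N. \<forall>i<n. V \<omega> i = L i}"
    have V_sets: "?V \<in> sets N"
    proof -
      have "(\<lambda>L'. \<forall>i<n. L' i = L i) \<in> measurable label_space (count_space UNIV)"
        by (rule measurable_label_function[where n = n]) simp
      from measurable_compose[OF V this] show ?thesis by (rule predE)
    qed
    \<comment> \<open>At a generic point some valid \<open>L'\<close> wins the first
      \<open>n\<close> races and \<open>V\<close> agrees with it. So the event that \<open>V\<close>
      starts with \<open>L\<close> is, up to a null set, the race event of \<open>L\<close>, or
      empty if \<open>L\<close> is not valid.\<close>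
    have iff: "AE \<omega> in N. \<omega> \<in> ?V \<longleftrightarrow> valid_labels k n L \<and> \<omega> \<in> R n L"
      using generic AE_space
    proof eventually_elim
      case (elim \<omega>)
      have jumps: "\<And>i. 1 \<le> i \<Longrightarrow> unit_jumps (\<lambda>t. BI i t \<omega>)" using elim by auto
      have VL: "V \<omega> j = L' j"
        if "valid_labels k n L'" "race_path k L' n (waiting_times (\<lambda>i t. BI i t \<omega>))" "j < n" for L' j
        using race_path_events[of "\<lambda>i t. BI i t \<omega>" k n L', OF jumps that(1,2)] that(3) by (auto simp: V_def)
      have R: "\<omega> \<in> R n L' \<longleftrightarrow> race_path k L' n (waiting_times (\<lambda>i t. BI i t \<omega>))" for L'
        using elim waiting_version_eq[of BI \<omega>] by (auto simp: R_def)
      obtain L' where L': "valid_labels k n L'" "\<omega> \<in> R n L'" using elim by blast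
      show ?case
      proof
        assume "\<omega> \<in> ?V"
        then have "L j = L' j" if "j < n" for j using VL[OF L'(1) _ that] L'(2) that R by simp
        then show "valid_labels k n L \<and> \<omega> \<in> R n L"
          using L' valid_labels_cong[of n L L' k] race_path_cong[of n L L' k] unfolding R by simp
      next
        assume "valid_labels k n L \<and> \<omega> \<in> R n L"
        then show "\<omega> \<in> ?V" using VL R elim by simp
      qed
    qed
    show ?thesis
    proof (cases "valid_labels k n L")
      case True
      have "AE \<omega> in N. \<omega> \<in> ?V \<longleftrightarrow> \<omega> \<in> R n L"
        using iff by eventually_elim (use True in blast)
      from emeasure_eq_AE[OF this V_sets R_sets[OF True]] show ?thesis using R_U[OF True] by simp
    next
      case False
      have "AE \<omega> in N. \<omega> \<in> ?V \<longleftrightarrow> \<omega> \<in> {}"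
        using iff by eventually_elim (use False in blast)
      from emeasure_eq_AE[OF this V_sets sets.empty_sets] have "emeasure N ?V = 0" by simp
      moreover have "{\<omega> \<in> space M. \<forall>i<n. U \<omega> i = L i} = {}"
        using False U_valid valid_labels_cong[of n _ L k] by blast
      ultimately show ?thesis by (simp only: emeasure_empty)
    qed
  qed
  have pa_eq: "pa_degrees k S \<omega> = lab_degrees k (U \<omega>)" if "\<omega> \<in> space M" for \<omega>
    unfolding U_def using pa_degree_vector_eq[OF preferential_attachment_admissible[OF pa that]]
    by (simp add: pa_degrees_def fun_eq_iff)
  have \<Phi>U: "(\<lambda>\<omega>. lab_degrees k (U \<omega>)) \<in> measurable M (degree_seq_space k)"
    and \<Phi>V: "(\<lambda>\<omega>. lab_degrees k (V \<omega>)) \<in> measurable N (degree_seq_space k)"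
    by (rule measurable_compose[OF U measurable_lab_degrees], rule measurable_compose[OF V measurable_lab_degrees])
  have pa_meas: "pa_degrees k S \<in> measurable M (degree_seq_space k)"
    using \<Phi>U by (subst measurable_cong[OF pa_eq])
  have bi_meas: "bi_degrees k BI \<in> measurable N (degree_seq_space k)" by (rule measurable_bi_degrees[OF reg])
  have "distr M (degree_seq_space k) (pa_degrees k S) = distr M (degree_seq_space k) (\<lambda>\<omega>. lab_degrees k (U \<omega>))"
    by (rule distr_cong) (auto simp: pa_eq)
  also have "\<dots> = distr (distr M label_space U) (degree_seq_space k) (lab_degrees k)"
    by (subst distr_distr[OF measurable_lab_degrees U]) (simp add: comp_def)
  also have "distr M label_space U = distr N label_space V"
    by (rule distr_label_space_eqI[OF assms(2,4) U V law])
  also have "distr (distr N label_space V) (degree_seq_space k) (lab_degrees k) =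
      distr N (degree_seq_space k) (\<lambda>\<omega>. lab_degrees k (V \<omega>))"
    by (subst distr_distr[OF measurable_lab_degrees V]) (simp add: comp_def)
  also have "\<dots> = distr N (degree_seq_space k) (bi_degrees k BI)"
    by (rule distr_cong_AE) (use bi bi_meas \<Phi>V in auto)
  finally have "distr M (degree_seq_space k) (pa_degrees k S) = distr N (degree_seq_space k) (bi_degrees k BI)" .
  \<comment> \<open>Integrality, not visible from the quotient, is read off from
    \<open>lab_degrees\<close>, whose entries are natural numbers by construction.\<close>
  moreover have "AE \<omega> in N. \<forall>n. \<forall>j\<ge>1. \<forall>m\<le>k. bi_degrees k BI \<omega> n j m \<in> \<nat>"
    using bi by eventually_elim (auto simp: lab_degrees_def)
  ultimately show ?thesis using pa_meas bi_meas by blast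
qed

end
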